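(* Let $O_n$ be the group of real orthogonal matrices of order $n$, endowed with the Riemannian metric $g$ induced by the Frobenius metric, $g(V,W)=\operatorname{tr}(V^TW)$. Then: a) $(O_n,g)$ is a globally symmetric Riemannian manifold with non-negative sectional curvature. b) The geodesic curves of $(O_n,g)$ are precisely the curves of type $P(t)=G\exp(tA)$ with $G\in O_n$ and $A$ a real skew symmetric matrix of order $n$. c) $(O_n,g)$ is an Einstein manifold with Ricci tensor $Ric=\dfrac{n-2}{4}\,g$. Moreover its scalar curvature is $S=\dfrac{(n-2)(n-1)n}{8}$.
   Context: $O_n$ is viewed as a submanifold of the space of real matrices of order $n$; its tangent space at $G\in O_n$ is $\{V : G^{T}V \text{ is skew symmetric}\}$. *)

theory Defs
  imports "HOL-Analysis.Analysis"
begin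

section \<open>Smooth maps\<close>

text \<open>The set \<open>S\<close> is meant to be open. Iterated directional derivatives are used so that
  all derivatives keep the type of \<open>f\<close>.\<close>

primrec Ck_on :: "nat \<Rightarrow> 'a::euclidean_space set \<Rightarrow> ('a \<Rightarrow> 'b::real_normed_vector) \<Rightarrow> bool"
where
  "Ck_on 0 S f = continuous_on S f"
| "Ck_on (Suc k) S f =
     (f differentiable_on S \<and> (\<forall>v. Ck_on k S (\<lambda>x. frechet_derivative f (at x) v)))"

definition smooth_on :: "'a::euclidean_space set \<Rightarrow> ('a \<Rightarrow> 'b::real_normed_vector) \<Rightarrow> bool" where
  "smooth_on S f \<longleftrightarrow> (\<forall>k. Ck_on k S f)"

text \<open>Smoothness on a subset \<open>M\<close> that need not be open: local smooth extendability. Values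
  of \<open>f\<close> outside \<open>M\<close> are irrelevant.\<close>

definition smooth_map_on :: "'a::euclidean_space set \<Rightarrow> ('a \<Rightarrow> 'b::real_normed_vector) \<Rightarrow> bool" where
  "smooth_map_on M f \<longleftrightarrow>
     (\<forall>p\<in>M. \<exists>U F. open U \<and> p \<in> U \<and> smooth_on U F \<and> (\<forall>x\<in>M \<inter> U. F x = f x))"


section \<open>Riemannian submanifolds of Euclidean space\<close>

definition embedded_submanifold :: "'a::euclidean_space set \<Rightarrow> nat \<Rightarrow> bool" where
  "embedded_submanifold M d \<longleftrightarrow>
     (\<forall>p\<in>M. \<exists>(U::'a set) (V::'a set) (\<Phi>::'a \<Rightarrow> 'a) (\<Psi>::'a \<Rightarrow> 'a) (S::'a set).
        open U \<and> p \<in> U \<and> open V \<and> smooth_on U \<Phi> \<and> smooth_on V \<Psi> \<and> \<Phi> ` U = V \<and>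
        (\<forall>x\<in>U. \<Psi> (\<Phi> x) = x) \<and> (\<forall>y\<in>V. \<Phi> (\<Psi> y) = y) \<and>
        subspace S \<and> dim S = d \<and> \<Phi> ` (U \<inter> M) = V \<inter> S)"

definition tangent_space :: "'a::euclidean_space set \<Rightarrow> 'a \<Rightarrow> 'a set" where
  "tangent_space M p =
     {v. \<exists>(\<gamma>::real \<Rightarrow> 'a) \<epsilon>. \<epsilon> > 0 \<and> smooth_on {-\<epsilon><..<\<epsilon>} \<gamma> \<and> \<gamma> ` {-\<epsilon><..<\<epsilon>} \<subseteq> M \<and>
           \<gamma> 0 = p \<and> (\<gamma> has_vector_derivative v) (at 0)}"

text \<open>Tangent vectors at \<open>p\<close> are ambient vectors, so a vector field is a map from \<open>M\<close> to the
  ambient space.\<close>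

definition vector_fields :: "'a::euclidean_space set \<Rightarrow> ('a \<Rightarrow> 'a) set" where
  "vector_fields M = {X. smooth_map_on M X \<and> (\<forall>p\<in>M. X p \<in> tangent_space M p)}"

text \<open>The differential of \<open>f\<close> at \<open>p \<in> M\<close>, to be applied to tangent vectors \<open>v\<close> only: a
  derivative within \<open>M\<close> need not be unique as a linear map on the ambient space, but its
  values on \<open>tangent_space M p\<close> are.\<close>

definition differential ::
  "'a::euclidean_space set \<Rightarrow> ('a \<Rightarrow> 'b::real_normed_vector) \<Rightarrow> 'a \<Rightarrow> 'a \<Rightarrow> 'b" where
  "differential M f p v = frechet_derivative f (at p within M) v"

text \<open>The metric \<open>g p v w\<close> matters only for \<open>p \<in> M\<close> and \<open>v\<close>, \<open>w\<close> tangent at \<open>p\<close>.\<close>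

definition riemannian_manifold ::
  "'a::euclidean_space set \<Rightarrow> ('a \<Rightarrow> 'a \<Rightarrow> 'a \<Rightarrow> real) \<Rightarrow> bool" where
  "riemannian_manifold M g \<longleftrightarrow>
     (\<exists>d. embedded_submanifold M d) \<and>
     (\<forall>p\<in>M. \<forall>u\<in>tangent_space M p. \<forall>v\<in>tangent_space M p. \<forall>w\<in>tangent_space M p. \<forall>a b.
        g p (a *\<^sub>R u + b *\<^sub>R v) w = a * g p u w + b * g p v w \<and> g p u v = g p v u) \<and>
     (\<forall>p\<in>M. \<forall>v\<in>tangent_space M p. v \<noteq> 0 \<longrightarrow> g p v v > 0) \<and>
     (\<forall>X\<in>vector_fields M. \<forall>Y\<in>vector_fields M. smooth_map_on M (\<lambda>p. g p (X p) (Y p)))"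


section \<open>The Levi-Civita connection\<close>

text \<open>The coordinate formula for the Lie bracket, in the coordinates of the ambient space.\<close>

definition lie_bracket :: "'a::euclidean_space set \<Rightarrow> ('a \<Rightarrow> 'a) \<Rightarrow> ('a \<Rightarrow> 'a) \<Rightarrow> 'a \<Rightarrow> 'a" where
  "lie_bracket M X Y p = differential M Y p (X p) - differential M X p (Y p)"

definition affine_connection ::
  "'a::euclidean_space set \<Rightarrow> (('a \<Rightarrow> 'a) \<Rightarrow> ('a \<Rightarrow> 'a) \<Rightarrow> 'a \<Rightarrow> 'a) \<Rightarrow> bool" where
  "affine_connection M D \<longleftrightarrow>
     (\<forall>X\<in>vector_fields M. \<forall>Y\<in>vector_fields M. D X Y \<in> vector_fields M) \<and>
     (\<forall>X\<in>vector_fields M. \<forall>Y\<in>vector_fields M. \<forall>Z\<in>vector_fields M. \<forall>f h.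
        smooth_map_on M f \<longrightarrow> smooth_map_on M h \<longrightarrow>
        (\<forall>p\<in>M. D (\<lambda>x. f x *\<^sub>R X x + h x *\<^sub>R Y x) Z p = f p *\<^sub>R D X Z p + h p *\<^sub>R D Y Z p)) \<and>
     (\<forall>X\<in>vector_fields M. \<forall>Y\<in>vector_fields M. \<forall>Z\<in>vector_fields M.
        \<forall>p\<in>M. D X (\<lambda>x. Y x + Z x) p = D X Y p + D X Z p) \<and>
     (\<forall>X\<in>vector_fields M. \<forall>Y\<in>vector_fields M. \<forall>f. smooth_map_on M f \<longrightarrow>
        (\<forall>p\<in>M. D X (\<lambda>x. f x *\<^sub>R Y x) p = f p *\<^sub>R D X Y p + differential M f p (X p) *\<^sub>R Y p))"

definition is_levi_civita ::
  "'a::euclidean_space set \<Rightarrow> ('a \<Rightarrow> 'a \<Rightarrow> 'a \<Rightarrow> real) \<Rightarrow>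
   (('a \<Rightarrow> 'a) \<Rightarrow> ('a \<Rightarrow> 'a) \<Rightarrow> 'a \<Rightarrow> 'a) \<Rightarrow> bool" where
  "is_levi_civita M g D \<longleftrightarrow>
     affine_connection M D \<and>
     (\<forall>X\<in>vector_fields M. \<forall>Y\<in>vector_fields M. \<forall>p\<in>M. D X Y p - D Y X p = lie_bracket M X Y p) \<and>
     (\<forall>X\<in>vector_fields M. \<forall>Y\<in>vector_fields M. \<forall>Z\<in>vector_fields M. \<forall>p\<in>M.
        differential M (\<lambda>x. g x (Y x) (Z x)) p (X p) = g p (D X Y p) (Z p) + g p (Y p) (D X Z p))"

text \<open>\<open>SOME\<close> rather than \<open>THE\<close>: uniqueness only concerns smooth vector fields and points
  of \<open>M\<close>.\<close>

definition levi_civita ::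
  "'a::euclidean_space set \<Rightarrow> ('a \<Rightarrow> 'a \<Rightarrow> 'a \<Rightarrow> real) \<Rightarrow> ('a \<Rightarrow> 'a) \<Rightarrow> ('a \<Rightarrow> 'a) \<Rightarrow> 'a \<Rightarrow> 'a" where
  "levi_civita M g = (SOME D. is_levi_civita M g D)"


section \<open>Geodesics\<close>

definition fields_along ::
  "'a::euclidean_space set \<Rightarrow> real set \<Rightarrow> (real \<Rightarrow> 'a) \<Rightarrow> (real \<Rightarrow> 'a) set" where
  "fields_along M I \<gamma> = {V. smooth_on I V \<and> (\<forall>t\<in>I. V t \<in> tangent_space M (\<gamma> t))}"

text \<open>The characterising properties of the covariant derivative along a curve: additivity,
  the Leibniz rule, and \<open>D(Y \<circ> \<gamma>)/dt = \<nabla>\<^bsub>\<gamma>'\<^esub> Y\<close>. The last one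
  is expressed with any vector field \<open>X\<close> that takes the value \<open>\<gamma>' t\<close> at \<open>\<gamma> t\<close>.\<close>

definition is_covariant_derivative_along ::
  "'a::euclidean_space set \<Rightarrow> ('a \<Rightarrow> 'a \<Rightarrow> 'a \<Rightarrow> real) \<Rightarrow> real set \<Rightarrow> (real \<Rightarrow> 'a) \<Rightarrow>
   ((real \<Rightarrow> 'a) \<Rightarrow> real \<Rightarrow> 'a) \<Rightarrow> bool" where
  "is_covariant_derivative_along M g I \<gamma> D \<longleftrightarrow>
     (\<forall>V\<in>fields_along M I \<gamma>. D V \<in> fields_along M I \<gamma>) \<and>
     (\<forall>V\<in>fields_along M I \<gamma>. \<forall>W\<in>fields_along M I \<gamma>. \<forall>t\<in>I.
        D (\<lambda>s. V s + W s) t = D V t + D W t) \<and>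
     (\<forall>V\<in>fields_along M I \<gamma>. \<forall>f. smooth_on I f \<longrightarrow>
        (\<forall>t\<in>I. D (\<lambda>s. f s *\<^sub>R V s) t = deriv f t *\<^sub>R V t + f t *\<^sub>R D V t)) \<and>
     (\<forall>X\<in>vector_fields M. \<forall>Y\<in>vector_fields M. \<forall>t\<in>I.
        X (\<gamma> t) = vector_derivative \<gamma> (at t) \<longrightarrow> D (Y \<circ> \<gamma>) t = levi_civita M g X Y (\<gamma> t))"

definition covariant_derivative_along ::
  "'a::euclidean_space set \<Rightarrow> ('a \<Rightarrow> 'a \<Rightarrow> 'a \<Rightarrow> real) \<Rightarrow> real set \<Rightarrow> (real \<Rightarrow> 'a) \<Rightarrow>
   (real \<Rightarrow> 'a) \<Rightarrow> real \<Rightarrow> 'a" where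
  "covariant_derivative_along M g I \<gamma> = (SOME D. is_covariant_derivative_along M g I \<gamma> D)"

text \<open>Here \<open>I\<close> is meant to be an open interval. Constant curves count as geodesics.\<close>

definition geodesic ::
  "'a::euclidean_space set \<Rightarrow> ('a \<Rightarrow> 'a \<Rightarrow> 'a \<Rightarrow> real) \<Rightarrow> real set \<Rightarrow> (real \<Rightarrow> 'a) \<Rightarrow> bool" where
  "geodesic M g I \<gamma> \<longleftrightarrow>
     smooth_on I \<gamma> \<and> \<gamma> ` I \<subseteq> M \<and>
     (\<forall>t\<in>I. covariant_derivative_along M g I \<gamma> (\<lambda>s. vector_derivative \<gamma> (at s)) t = 0)"


section \<open>Curvature\<close>

definition curvature_field ::
  "'a::euclidean_space set \<Rightarrow> ('a \<Rightarrow> 'a \<Rightarrow> 'a \<Rightarrow> real) \<Rightarrow>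
   ('a \<Rightarrow> 'a) \<Rightarrow> ('a \<Rightarrow> 'a) \<Rightarrow> ('a \<Rightarrow> 'a) \<Rightarrow> 'a \<Rightarrow> 'a" where
  "curvature_field M g X Y Z p =
     levi_civita M g X (levi_civita M g Y Z) p
     - levi_civita M g Y (levi_civita M g X Z) p
     - levi_civita M g (lie_bracket M X Y) Z p"

text \<open>The value of the curvature tensor on tangent vectors: by tensoriality the curvature of
  vector fields at \<open>p\<close> depends only on their values at \<open>p\<close>.\<close>

definition riemann_curvature ::
  "'a::euclidean_space set \<Rightarrow> ('a \<Rightarrow> 'a \<Rightarrow> 'a \<Rightarrow> real) \<Rightarrow> 'a \<Rightarrow> 'a \<Rightarrow> 'a \<Rightarrow> 'a \<Rightarrow> 'a" where
  "riemann_curvature M g p u v w =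
     (THE z. \<forall>X\<in>vector_fields M. \<forall>Y\<in>vector_fields M. \<forall>Z\<in>vector_fields M.
        X p = u \<longrightarrow> Y p = v \<longrightarrow> Z p = w \<longrightarrow> curvature_field M g X Y Z p = z)"

definition sectional_curvature ::
  "'a::euclidean_space set \<Rightarrow> ('a \<Rightarrow> 'a \<Rightarrow> 'a \<Rightarrow> real) \<Rightarrow> 'a \<Rightarrow> 'a \<Rightarrow> 'a \<Rightarrow> real" where
  "sectional_curvature M g p u v =
     g p (riemann_curvature M g p u v v) u / (g p u u * g p v v - (g p u v)\<^sup>2)"

definition nonneg_sectional_curvature ::
  "'a::euclidean_space set \<Rightarrow> ('a \<Rightarrow> 'a \<Rightarrow> 'a \<Rightarrow> real) \<Rightarrow> bool" where
  "nonneg_sectional_curvature M g \<longleftrightarrow>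
     (\<forall>p\<in>M. \<forall>u\<in>tangent_space M p. \<forall>v\<in>tangent_space M p.
        u \<noteq> v \<and> independent {u, v} \<longrightarrow> sectional_curvature M g p u v \<ge> 0)"

definition is_orthonormal_basis ::
  "'a::euclidean_space set \<Rightarrow> ('a \<Rightarrow> 'a \<Rightarrow> 'a \<Rightarrow> real) \<Rightarrow> 'a \<Rightarrow> 'a set \<Rightarrow> bool" where
  "is_orthonormal_basis M g p B \<longleftrightarrow>
     independent B \<and> span B = tangent_space M p \<and>
     (\<forall>e\<in>B. \<forall>e'\<in>B. g p e e' = (if e = e' then 1 else 0))"

definition orthonormal_basis ::
  "'a::euclidean_space set \<Rightarrow> ('a \<Rightarrow> 'a \<Rightarrow> 'a \<Rightarrow> real) \<Rightarrow> 'a \<Rightarrow> 'a set" where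
  "orthonormal_basis M g p = (SOME B. is_orthonormal_basis M g p B)"

text \<open>The trace of \<open>u \<mapsto> R(u, v) w\<close>, computed in an orthonormal basis.\<close>

definition ricci ::
  "'a::euclidean_space set \<Rightarrow> ('a \<Rightarrow> 'a \<Rightarrow> 'a \<Rightarrow> real) \<Rightarrow> 'a \<Rightarrow> 'a \<Rightarrow> 'a \<Rightarrow> real" where
  "ricci M g p v w = (\<Sum>e\<in>orthonormal_basis M g p. g p (riemann_curvature M g p e v w) e)"

definition scalar_curvature ::
  "'a::euclidean_space set \<Rightarrow> ('a \<Rightarrow> 'a \<Rightarrow> 'a \<Rightarrow> real) \<Rightarrow> 'a \<Rightarrow> real" where
  "scalar_curvature M g p = (\<Sum>e\<in>orthonormal_basis M g p. ricci M g p e e)"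

definition einstein_manifold ::
  "'a::euclidean_space set \<Rightarrow> ('a \<Rightarrow> 'a \<Rightarrow> 'a \<Rightarrow> real) \<Rightarrow> bool" where
  "einstein_manifold M g \<longleftrightarrow>
     riemannian_manifold M g \<and>
     (\<exists>c::real. \<forall>p\<in>M. \<forall>v\<in>tangent_space M p. \<forall>w\<in>tangent_space M p. ricci M g p v w = c * g p v w)"


section \<open>Globally symmetric manifolds\<close>

definition riemannian_isometry ::
  "'a::euclidean_space set \<Rightarrow> ('a \<Rightarrow> 'a \<Rightarrow> 'a \<Rightarrow> real) \<Rightarrow> ('a \<Rightarrow> 'a) \<Rightarrow> bool" where
  "riemannian_isometry M g s \<longleftrightarrow>
     bij_betw s M M \<and> smooth_map_on M s \<and> smooth_map_on M (inv_into M s) \<and>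
     (\<forall>p\<in>M. \<forall>u\<in>tangent_space M p. \<forall>v\<in>tangent_space M p.
        g (s p) (differential M s p u) (differential M s p v) = g p u v)"

text \<open>Every point is an isolated fixed point of an involutive isometry. \<open>M\<close> is not required
  to be connected, and the identity counts as involutive (as is needed in dimension \<open>0\<close>).\<close>

definition globally_symmetric ::
  "'a::euclidean_space set \<Rightarrow> ('a \<Rightarrow> 'a \<Rightarrow> 'a \<Rightarrow> real) \<Rightarrow> bool" where
  "globally_symmetric M g \<longleftrightarrow>
     riemannian_manifold M g \<and>
     (\<forall>p\<in>M. \<exists>s. riemannian_isometry M g s \<and> (\<forall>x\<in>M. s (s x) = x) \<and> s p = p \<and>
        (\<exists>U. open U \<and> p \<in> U \<and> (\<forall>x\<in>M \<inter> U. s x = x \<longrightarrow> x = p)))"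


section \<open>The orthogonal group\<close>

definition orthogonal_group :: "(real^'n^'n) set" where
  "orthogonal_group = {G. orthogonal_matrix G}"

definition frobenius_metric :: "real^'n^'n \<Rightarrow> real^'n^'n \<Rightarrow> real^'n^'n \<Rightarrow> real" where
  "frobenius_metric G V W = trace (transpose V ** W)"

definition skew_symmetric :: "real^'n^'n \<Rightarrow> bool" where
  "skew_symmetric A \<longleftrightarrow> transpose A = - A"

text \<open>The library's \<open>^\<close> on \<open>real^'n^'n\<close> is the componentwise power, and its \<open>exp\<close> does not apply
  to this type.\<close>

primrec matrix_pow :: "real^'n^'n \<Rightarrow> nat \<Rightarrow> real^'n^'n" where
  "matrix_pow A 0 = mat 1"
| "matrix_pow A (Suc k) = A ** matrix_pow A k"

definition matrix_exp :: "real^'n^'n \<Rightarrow> real^'n^'n" where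
  "matrix_exp A = (\<Sum>k. (1 / fact k) *\<^sub>R matrix_pow A k)"

end

theory Submission
  imports Defs
begin

text \<open>A vector field on \<open>O\<^sub>n\<close> is written as \<open>X p = p a(p)\<close> with \<open>a\<close> skew symmetric. In this left
  trivialisation the tangential part of the ambient derivative is
  \<open>\<nabla>\<^sub>X Y = p (1/2 [a, b] + db(X))\<close>, which is the only connection that is torsion free and metric.
  Substituting this in the definition of curvature, the Jacobi identity and the symmetry of second
  derivatives leave \<open>R(X, Y) Z = - 1/4 p [[a, b], c]\<close>, so that
  \<open>g(R(X, Y) Z, X) = 1/4 \<langle>[a, b], [a, c]\<rangle>\<close>; its trace follows from the completeness relation of an
  orthonormal basis of the skew symmetric matrices. Along a curve the same projection shows that
  \<open>\<gamma>\<^sup>T \<gamma>''\<close> is symmetric exactly when \<open>\<gamma>\<^sup>T \<gamma>'\<close> has derivative \<open>0\<close>, which turns the geodesic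
  equation into \<open>\<gamma>' = \<gamma> A\<close>. Charts are given by the Cayley transform, and the symmetry at \<open>p\<close> is
  \<open>x \<mapsto> p x\<^sup>T p\<close>.\<close>

section \<open>Calculus of smooth maps\<close>

text \<open>The notions are choices over axioms: \<open>levi_civita\<close> and
  \<open>covariant_derivative_along\<close> by \<open>SOME\<close>, \<open>riemann_curvature\<close>
  by \<open>THE\<close>. A formula for one of them is usable only with a proof that the axioms admit
  nothing else, and then only for smooth tangent fields at points of the group. Such proofs stay
  short because the group is parallelizable: left-invariant fields are globally smooth, take any
  prescribed tangent value at a point and give a frame along every curve, so no bump functions
  occur. A second obstacle is that fields matter only on the group, where smoothness means local
  extendability. The identity X(Yf) - Y(Xf) = [X,Y]f is therefore computed with extensions to open
  sets, where second derivatives commute. The constants: -1/4 = 1/4 - 1/2, with 1/4 from nesting the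
  half commutator and 1/2 from the bracket term of the curvature. Over an orthonormal basis of skew
  matrices the sum of e X e is (X^T - tr X)/2; skew X together with X = 1 gives n - 2, and X = 1
  alone gives the dimension n(n-1)/2 that enters the scalar curvature.\<close>

lemma Ck_on_SucD:
  assumes "Ck_on (Suc k) S f" "open S" "x \<in> S"
  shows "(f has_derivative frechet_derivative f (at x)) (at x)"
proof -
  have "f differentiable at x"
    using assms differentiable_on_eq_differentiable_at[OF assms(2)] by auto
  then show ?thesis by (simp only: frechet_derivative_works)
qed

text \<open>On an open set a derivative sees only nearby values, so
  \<open>frechet_derivative\<close> is the same for both maps at each point of \<open>S\<close>. The
  induction runs over all pairs of maps because the derivatives form such a pair again.\<close>

lemma Ck_on_cong:
  assumes "open S" "\<And>x. x \<in> S \<Longrightarrow> f x = g x" "Ck_on k S f"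
  shows "Ck_on k S g"
  using assms(2,3)
proof (induction k arbitrary: f g)
  case 0
  then show ?case using continuous_on_cong by auto
next
  case (Suc k)
  have der: "(g has_derivative frechet_derivative f (at x)) (at x)" if "x \<in> S" for x
    using has_derivative_transform_within_open[OF Ck_on_SucD[OF Suc.prems(2) assms(1) that] assms(1) that]
      Suc.prems(1) by auto
  then have "g differentiable_on S"
    unfolding differentiable_on_eq_differentiable_at[OF assms(1)] by (blast intro: differentiableI)
  moreover have "Ck_on k S (\<lambda>x. frechet_derivative g (at x) v)" for v
  proof (rule Suc.IH)
    show "Ck_on k S (\<lambda>x. frechet_derivative f (at x) v)"
      using Suc.prems(2) by simp
  qed (simp add: frechet_derivative_at[OF der])
  ultimately show ?case by simp
qed

text \<open>Frees the inductions below from \<open>frechet_derivative\<close>: a derivative supplied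
  by any calculus rule may be used, since derivatives at a point are unique.\<close>

lemma Ck_on_SucI:
  assumes "open S" "\<And>x. x \<in> S \<Longrightarrow> (f has_derivative f' x) (at x)"
    "\<And>v. Ck_on k S (\<lambda>x. f' x v)"
  shows "Ck_on (Suc k) S f"
proof -
  have "f differentiable_on S"
    unfolding differentiable_on_eq_differentiable_at[OF assms(1)] by (blast intro: differentiableI assms(2))
  moreover have "Ck_on k S (\<lambda>x. frechet_derivative f (at x) v)" for v
    by (rule Ck_on_cong[OF assms(1) _ assms(3)]) (simp add: frechet_derivative_at[OF assms(2)])
  ultimately show ?thesis by simp
qed

lemma Ck_on_pred: "Ck_on (Suc k) S f \<Longrightarrow> Ck_on k S f"
proof (induction k arbitrary: f)
  case 0
  then show ?case by (simp add: differentiable_imp_continuous_on)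
qed auto

lemma Ck_on_subset: "Ck_on k S f \<Longrightarrow> T \<subseteq> S \<Longrightarrow> Ck_on k T f"
  by (induction k arbitrary: f) (auto intro: continuous_on_subset differentiable_on_subset)

lemma Ck_on_const: "open S \<Longrightarrow> Ck_on k S (\<lambda>x. c)"
  by (induction k arbitrary: c) (auto simp: differentiable_on_const)

lemma Ck_on_id: "open S \<Longrightarrow> Ck_on k S (\<lambda>x. x)"
  by (cases k) (auto simp: differentiable_on_ident Ck_on_const)

lemma Ck_on_bounded_linear:
  assumes "bounded_linear L" "open S" "Ck_on k S f"
  shows "Ck_on k S (\<lambda>x. L (f x))"
  using assms(3)
proof (induction k arbitrary: f)
  case 0
  then show ?case using bounded_linear.continuous_on[OF assms(1)] by auto
next
  case (Suc k)
  show ?case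
  proof (rule Ck_on_SucI[OF assms(2)])
    show "((\<lambda>x. L (f x)) has_derivative (\<lambda>v. L (frechet_derivative f (at x) v))) (at x)"
      if "x \<in> S" for x
      using Ck_on_SucD[OF Suc.prems assms(2) that] bounded_linear.has_derivative[OF assms(1)] by auto
    show "Ck_on k S (\<lambda>x. L (frechet_derivative f (at x) v))" for v
      using Suc by auto
  qed
qed

lemma Ck_on_add:
  assumes "open S" "Ck_on k S f" "Ck_on k S g"
  shows "Ck_on k S (\<lambda>x. f x + g x)"
  using assms(2,3)
proof (induction k arbitrary: f g)
  case 0
  then show ?case using continuous_on_add by auto
next
  case (Suc k)
  show ?case
  proof (rule Ck_on_SucI[OF assms(1)])
    show "((\<lambda>x. f x + g x) has_derivative
        (\<lambda>v. frechet_derivative f (at x) v + frechet_derivative g (at x) v)) (at x)"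
      if "x \<in> S" for x
      using Suc.prems that assms(1) by (intro has_derivative_add Ck_on_SucD)
  qed (use Suc in auto)
qed

text \<open>One product rule for scalar multiples, matrix products, inner products and commutators.
  The derivative still contains the undifferentiated factors, which \<open>Ck_on_pred\<close> lowers
  to order \<open>k\<close> before the induction hypothesis applies.\<close>

lemma Ck_on_bilinear:
  assumes "bounded_bilinear h" "open S" "Ck_on k S f" "Ck_on k S g"
  shows "Ck_on k S (\<lambda>x. h (f x) (g x))"
  using assms(3,4)
proof (induction k arbitrary: f g)
  case 0
  then show ?case using bounded_bilinear.continuous_on[OF assms(1)] by auto
next
  case (Suc k)
  show ?case
  proof (rule Ck_on_SucI[OF assms(2)])
    show "((\<lambda>x. h (f x) (g x)) has_derivative
        (\<lambda>v. h (f x) (frechet_derivative g (at x) v) + h (frechet_derivative f (at x) v) (g x))) (at x)"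
      if "x \<in> S" for x
      using Suc.prems that assms(2) by (intro bounded_bilinear.FDERIV[OF assms(1)] Ck_on_SucD)
    show "Ck_on k S (\<lambda>x. h (f x) (frechet_derivative g (at x) v) + h (frechet_derivative f (at x) v) (g x))" for v
      using Suc.prems Ck_on_pred[OF Suc.prems(1)] Ck_on_pred[OF Suc.prems(2)]
      by (intro Ck_on_add[OF assms(2)] Suc.IH) auto
  qed
qed

lemma smooth_on_subset: "smooth_on S f \<Longrightarrow> T \<subseteq> S \<Longrightarrow> smooth_on T f"
  using Ck_on_subset unfolding smooth_on_def by blast

lemma smooth_on_cong: "open S \<Longrightarrow> (\<And>x. x \<in> S \<Longrightarrow> f x = g x) \<Longrightarrow> smooth_on S f \<Longrightarrow> smooth_on S g"
  using Ck_on_cong unfolding smooth_on_def by blast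

lemma smooth_on_const: "open S \<Longrightarrow> smooth_on S (\<lambda>x. c)"
  by (simp add: smooth_on_def Ck_on_const)

lemma smooth_on_id: "open S \<Longrightarrow> smooth_on S (\<lambda>x. x)"
  by (simp add: smooth_on_def Ck_on_id)

lemma smooth_on_bounded_linear:
  "bounded_linear L \<Longrightarrow> open S \<Longrightarrow> smooth_on S f \<Longrightarrow> smooth_on S (\<lambda>x. L (f x))"
  by (simp add: smooth_on_def Ck_on_bounded_linear)

lemma smooth_on_add: "open S \<Longrightarrow> smooth_on S f \<Longrightarrow> smooth_on S g \<Longrightarrow> smooth_on S (\<lambda>x. f x + g x)"
  by (simp add: smooth_on_def Ck_on_add)

lemma smooth_on_bilinear:
  "bounded_bilinear h \<Longrightarrow> open S \<Longrightarrow> smooth_on S f \<Longrightarrow> smooth_on S g \<Longrightarrow> smooth_on S (\<lambda>x. h (f x) (g x))"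
  by (simp add: smooth_on_def Ck_on_bilinear)

lemma smooth_on_diff:
  "open S \<Longrightarrow> smooth_on S f \<Longrightarrow> smooth_on S g \<Longrightarrow> smooth_on S (\<lambda>x. f x - g x)"
  using smooth_on_add[of S f "\<lambda>x. - g x"]
    smooth_on_bounded_linear[OF bounded_linear_minus[OF bounded_linear_ident]] by auto

lemma smooth_on_sum:
  "open S \<Longrightarrow> (\<And>i. i \<in> A \<Longrightarrow> smooth_on S (f i)) \<Longrightarrow> smooth_on S (\<lambda>x. \<Sum>i\<in>A. f i x)"
  by (induction A rule: infinite_finite_induct) (auto intro: smooth_on_const smooth_on_add)

lemma smooth_on_has_derivative:
  "smooth_on S f \<Longrightarrow> open S \<Longrightarrow> x \<in> S \<Longrightarrow> (f has_derivative frechet_derivative f (at x)) (at x)"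
  unfolding smooth_on_def by (rule Ck_on_SucD) auto

lemma smooth_on_frechet_derivative:
  "smooth_on S f \<Longrightarrow> smooth_on S (\<lambda>x. frechet_derivative f (at x) v)"
  unfolding smooth_on_def
proof
  fix k assume "\<forall>k. Ck_on k S f"
  then have "Ck_on (Suc k) S f" by blast
  then show "Ck_on k S (\<lambda>x. frechet_derivative f (at x) v)" by simp
qed

lemma linear_Basis_expansion:
  assumes "linear L"
  shows "L w = (\<Sum>b\<in>Basis. (w \<bullet> b) *\<^sub>R L b)"
proof -
  have "L w = L (\<Sum>b\<in>Basis. (w \<bullet> b) *\<^sub>R b)"
    by (simp add: euclidean_representation)
  also have "\<dots> = (\<Sum>b\<in>Basis. (w \<bullet> b) *\<^sub>R L b)"
    using assms by (simp add: linear_sum linear_cmul)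
  finally show ?thesis .
qed

text \<open>\<open>smooth_on\<close> speaks only of fixed directions. Expanding the moving direction
  \<open>h x\<close> in \<open>Basis\<close> leaves derivatives in fixed directions with smooth
  coefficients.\<close>

lemma smooth_on_directional_derivative:
  assumes "open S" "smooth_on S f" "smooth_on S h"
  shows "smooth_on S (\<lambda>x. frechet_derivative f (at x) (h x))"
proof (rule smooth_on_cong[OF assms(1)])
  show "smooth_on S (\<lambda>x. \<Sum>b\<in>Basis. (h x \<bullet> b) *\<^sub>R frechet_derivative f (at x) b)"
    using assms
    by (intro smooth_on_sum smooth_on_bilinear[OF bounded_bilinear_scaleR] smooth_on_frechet_derivative
        smooth_on_bounded_linear[OF bounded_linear_inner_left])
  show "(\<Sum>b\<in>Basis. (h x \<bullet> b) *\<^sub>R frechet_derivative f (at x) b) = frechet_derivative f (at x) (h x)"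
    if "x \<in> S" for x
    by (rule linear_Basis_expansion[symmetric])
      (rule has_derivative_linear[OF smooth_on_has_derivative[OF assms(2,1) that]])
qed

lemma smooth_on_has_vector_derivative:
  "smooth_on I c \<Longrightarrow> open I \<Longrightarrow> t \<in> I \<Longrightarrow> (c has_vector_derivative vector_derivative c (at t)) (at t)"
  unfolding vector_derivative_works[symmetric]
  by (rule differentiableI, rule smooth_on_has_derivative)

lemma smooth_on_vector_derivative:
  assumes "open I" "smooth_on I c"
  shows "smooth_on I (\<lambda>t. vector_derivative c (at t))"
proof (rule smooth_on_cong[OF assms(1)])
  show "smooth_on I (\<lambda>t. frechet_derivative c (at t) 1)"
    using assms smooth_on_frechet_derivative by auto
  show "frechet_derivative c (at t) 1 = vector_derivative c (at t)" if "t \<in> I" for t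
    using frechet_derivative_eq_vector_derivative[OF differentiableI[OF smooth_on_has_derivative[OF assms(2,1) that]]]
    by simp
qed

section \<open>Smooth maps on subsets that need not be open\<close>

lemma smooth_map_onI:
  "open U \<Longrightarrow> M \<subseteq> U \<Longrightarrow> smooth_on U F \<Longrightarrow> (\<And>x. x \<in> M \<Longrightarrow> F x = f x) \<Longrightarrow> smooth_map_on M f"
  unfolding smooth_map_on_def by blast

lemma smooth_map_on_cong:
  "smooth_map_on M f \<Longrightarrow> (\<And>x. x \<in> M \<Longrightarrow> f x = g x) \<Longrightarrow> smooth_map_on M g"
  unfolding smooth_map_on_def by simp

lemma smooth_map_onE:
  assumes "smooth_map_on M f" "p \<in> M"
  obtains U F where "open U" "p \<in> U" "smooth_on U F" "\<And>x. x \<in> M \<inter> U \<Longrightarrow> F x = f x"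
  using assms unfolding smooth_map_on_def by metis

lemma smooth_map_onE2:
  assumes "smooth_map_on M f" "smooth_map_on M g" "p \<in> M"
  obtains U F G where "open U" "p \<in> U" "smooth_on U F" "smooth_on U G"
    "\<And>x. x \<in> M \<inter> U \<Longrightarrow> F x = f x" "\<And>x. x \<in> M \<inter> U \<Longrightarrow> G x = g x"
proof -
  obtain U F where 1: "open U" "p \<in> U" "smooth_on U F" "\<And>x. x \<in> M \<inter> U \<Longrightarrow> F x = f x"
    using smooth_map_onE[OF assms(1,3)] by metis
  obtain V G where 2: "open V" "p \<in> V" "smooth_on V G" "\<And>x. x \<in> M \<inter> V \<Longrightarrow> G x = g x"
    using smooth_map_onE[OF assms(2,3)] by metis
  show thesis
    by (rule that[of "U \<inter> V" F G]) (use 1 2 in \<open>auto intro: smooth_on_subset\<close>)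
qed

lemma smooth_map_on_const: "smooth_map_on M (\<lambda>x. c)"
  by (rule smooth_map_onI[of UNIV]) (auto simp: smooth_on_const)

lemma smooth_map_on_id: "smooth_map_on M (\<lambda>x. x)"
  by (rule smooth_map_onI[of UNIV]) (auto simp: smooth_on_id)

lemma smooth_map_on_bounded_linear:
  assumes "bounded_linear L" "smooth_map_on M f"
  shows "smooth_map_on M (\<lambda>x. L (f x))"
  unfolding smooth_map_on_def
proof
  fix p assume "p \<in> M"
  then obtain U F where "open U" "p \<in> U" "smooth_on U F" "\<And>x. x \<in> M \<inter> U \<Longrightarrow> F x = f x"
    using smooth_map_onE[OF assms(2)] by metis
  then show "\<exists>U F. open U \<and> p \<in> U \<and> smooth_on U F \<and> (\<forall>x\<in>M \<inter> U. F x = L (f x))"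
    by (intro exI[of _ U] exI[of _ "\<lambda>x. L (F x)"]) (auto intro: smooth_on_bounded_linear[OF assms(1)])
qed

lemma smooth_map_on_bilinear:
  assumes "bounded_bilinear h" "smooth_map_on M f" "smooth_map_on M g"
  shows "smooth_map_on M (\<lambda>x. h (f x) (g x))"
  unfolding smooth_map_on_def
proof
  fix p assume "p \<in> M"
  then obtain U F G where "open U" "p \<in> U" "smooth_on U F" "smooth_on U G"
    "\<And>x. x \<in> M \<inter> U \<Longrightarrow> F x = f x" "\<And>x. x \<in> M \<inter> U \<Longrightarrow> G x = g x"
    using smooth_map_onE2[OF assms(2,3)] by metis
  then show "\<exists>U F. open U \<and> p \<in> U \<and> smooth_on U F \<and> (\<forall>x\<in>M \<inter> U. F x = h (f x) (g x))"
    by (intro exI[of _ U] exI[of _ "\<lambda>x. h (F x) (G x)"]) (auto intro: smooth_on_bilinear[OF assms(1)])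
qed

lemma smooth_map_on_add:
  assumes "smooth_map_on M f" "smooth_map_on M g"
  shows "smooth_map_on M (\<lambda>x. f x + g x)"
  unfolding smooth_map_on_def
proof
  fix p assume "p \<in> M"
  then obtain U F G where "open U" "p \<in> U" "smooth_on U F" "smooth_on U G"
    "\<And>x. x \<in> M \<inter> U \<Longrightarrow> F x = f x" "\<And>x. x \<in> M \<inter> U \<Longrightarrow> G x = g x"
    using smooth_map_onE2[OF assms] by metis
  then show "\<exists>U F. open U \<and> p \<in> U \<and> smooth_on U F \<and> (\<forall>x\<in>M \<inter> U. F x = f x + g x)"
    by (intro exI[of _ U] exI[of _ "\<lambda>x. F x + G x"]) (auto intro: smooth_on_add)
qed

lemma smooth_map_on_diff:
  "smooth_map_on M f \<Longrightarrow> smooth_map_on M g \<Longrightarrow> smooth_map_on M (\<lambda>x. f x - g x)"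
  using smooth_map_on_add[of M f "\<lambda>x. - g x"]
    smooth_map_on_bounded_linear[OF bounded_linear_minus[OF bounded_linear_ident]] by auto

section \<open>Differentials and second derivatives\<close>

text \<open>The mean value theorem twice: along \<open>u\<close> for the increment of
  \<open>f\<close> over \<open>s v\<close>, then along \<open>v\<close> for the derivative in
  direction \<open>u\<close>. The second difference is symmetric in \<open>u\<close> and
  \<open>v\<close>, while the derivative it is expressed by is not visibly so; this is the source of
  the symmetry of second derivatives.\<close>

lemma second_difference_eq:
  fixes f :: "'a::euclidean_space \<Rightarrow> real"
  assumes "open U" "smooth_on U f" "ball p r \<subseteq> U" "0 < s" "s * (norm u + norm v) < r"
  obtains \<xi> where "\<xi> \<in> ball p r"
    "f (p + s *\<^sub>R u + s *\<^sub>R v) - f (p + s *\<^sub>R u) - f (p + s *\<^sub>R v) + f p =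
       s\<^sup>2 * frechet_derivative (\<lambda>x. frechet_derivative f (at x) u) (at \<xi>) v"
proof -
  define D where "D x = frechet_derivative f (at x) u" for x
  have D: "smooth_on U D"
    unfolding D_def by (rule smooth_on_frechet_derivative[OF assms(2)])
  \<comment> \<open>The parallelogram spanned by \<open>s u\<close> and \<open>s v\<close> stays in
    the ball, so both mean value steps remain inside \<open>U\<close>.\<close>
  have mem: "p + a *\<^sub>R u + b *\<^sub>R v \<in> ball p r" if "0 \<le> a" "a \<le> s" "0 \<le> b" "b \<le> s" for a b
  proof -
    have "norm (a *\<^sub>R u + b *\<^sub>R v) \<le> a * norm u + b * norm v"
      using norm_triangle_ineq[of "a *\<^sub>R u" "b *\<^sub>R v"] that by simp
    also have "\<dots> \<le> s * norm u + s * norm v"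
      using that by (intro add_mono mult_right_mono) auto
    also have "\<dots> < r" using assms(5) by (simp add: distrib_left)
    finally have "norm (a *\<^sub>R u + b *\<^sub>R v) < r" .
    then have "dist p (p + (a *\<^sub>R u + b *\<^sub>R v)) < r"
      by (metis add_diff_cancel_left' dist_commute dist_norm)
    then show ?thesis by (simp add: add.assoc)
  qed
  have line: "((\<lambda>a. F (q + a *\<^sub>R w)) has_real_derivative frechet_derivative F (at (q + a *\<^sub>R w)) w) (at a)"
    if "smooth_on U F" "q + a *\<^sub>R w \<in> U" for F :: "'a \<Rightarrow> real" and q w a
  proof -
    have "((\<lambda>a. q + a *\<^sub>R w) has_derivative (\<lambda>h. h *\<^sub>R w)) (at a)"
      by (auto intro!: derivative_eq_intros)
    from has_derivative_compose[OF this smooth_on_has_derivative[OF that(1) assms(1) that(2)]]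
    have "((\<lambda>a. F (q + a *\<^sub>R w)) has_derivative
        (\<lambda>h. frechet_derivative F (at (q + a *\<^sub>R w)) (h *\<^sub>R w))) (at a)" .
    moreover have "frechet_derivative F (at (q + a *\<^sub>R w)) (h *\<^sub>R w) =
        frechet_derivative F (at (q + a *\<^sub>R w)) w * h" for h
      using linear_cmul[OF has_derivative_linear[OF smooth_on_has_derivative[OF that(1) assms(1) that(2)]]]
      by simp
    ultimately show ?thesis by (simp add: has_field_derivative_def)
  qed
  have "\<exists>a>0. a < s \<and>
    (f (p + s *\<^sub>R v + s *\<^sub>R u) - f (p + s *\<^sub>R u)) - (f (p + s *\<^sub>R v + 0 *\<^sub>R u) - f (p + 0 *\<^sub>R u)) =
      (s - 0) * (D (p + s *\<^sub>R v + a *\<^sub>R u) - D (p + a *\<^sub>R u))"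
  proof (rule MVT2[OF assms(4)])
    fix a :: real assume "0 \<le> a" "a \<le> s"
    then show "((\<lambda>a. f (p + s *\<^sub>R v + a *\<^sub>R u) - f (p + a *\<^sub>R u)) has_real_derivative
        D (p + s *\<^sub>R v + a *\<^sub>R u) - D (p + a *\<^sub>R u)) (at a)"
      unfolding D_def using mem[of a s] mem[of a 0] assms(3,4)
      by (intro DERIV_diff line[OF assms(2)]) (auto simp: algebra_simps)
  qed
  then obtain a where a: "0 < a" "a < s"
    "f (p + s *\<^sub>R v + s *\<^sub>R u) - f (p + s *\<^sub>R u) - (f (p + s *\<^sub>R v) - f p) =
      s * (D (p + s *\<^sub>R v + a *\<^sub>R u) - D (p + a *\<^sub>R u))" by auto
  have "\<exists>b>0. b < s \<and> D (p + a *\<^sub>R u + s *\<^sub>R v) - D (p + a *\<^sub>R u + 0 *\<^sub>R v) =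
      (s - 0) * frechet_derivative D (at (p + a *\<^sub>R u + b *\<^sub>R v)) v"
  proof (rule MVT2[OF assms(4)])
    fix b :: real assume "0 \<le> b" "b \<le> s"
    then show "((\<lambda>b. D (p + a *\<^sub>R u + b *\<^sub>R v)) has_real_derivative
        frechet_derivative D (at (p + a *\<^sub>R u + b *\<^sub>R v)) v) (at b)"
      using mem[of a b] assms(3) a by (intro line[OF D]) auto
  qed
  then obtain b where b: "0 < b" "b < s" "D (p + a *\<^sub>R u + s *\<^sub>R v) - D (p + a *\<^sub>R u) =
      s * frechet_derivative D (at (p + a *\<^sub>R u + b *\<^sub>R v)) v" by auto
  show thesis
  proof (rule that)
    show "p + a *\<^sub>R u + b *\<^sub>R v \<in> ball p r" using mem[of a b] a b by simp
    have "p + s *\<^sub>R v + a *\<^sub>R u = p + a *\<^sub>R u + s *\<^sub>R v" "p + s *\<^sub>R v + s *\<^sub>R u = p + s *\<^sub>R u + s *\<^sub>R v"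
      by simp_all
    then show "f (p + s *\<^sub>R u + s *\<^sub>R v) - f (p + s *\<^sub>R u) - f (p + s *\<^sub>R v) + f p =
       s\<^sup>2 * frechet_derivative (\<lambda>x. frechet_derivative f (at x) u) (at (p + a *\<^sub>R u + b *\<^sub>R v)) v"
      using a(3) b(3) unfolding D_def[symmetric] by (simp add: power2_eq_square algebra_simps)
  qed
qed

lemma smooth_on_continuous_on: "smooth_on S f \<Longrightarrow> continuous_on S f"
  unfolding smooth_on_def using Ck_on.simps(1) by blast

text \<open>Schwarz's theorem. One and the same second difference is \<open>s\<^sup>2\<close> times
  either mixed derivative at some point near \<open>p\<close>; continuity of both excludes a gap at
  \<open>p\<close>.\<close>

lemma frechet_derivative_symmetric_real:
  fixes f :: "'a::euclidean_space \<Rightarrow> real"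
  assumes "open U" "smooth_on U f" "p \<in> U"
  shows "frechet_derivative (\<lambda>x. frechet_derivative f (at x) u) (at p) v =
         frechet_derivative (\<lambda>x. frechet_derivative f (at x) v) (at p) u"
proof (rule ccontr)
  define H where "H u v x = frechet_derivative (\<lambda>x. frechet_derivative f (at x) u) (at x) v" for u v x
  assume "\<not> ?thesis"
  then have ne: "H u v p \<noteq> H v u p" by (simp add: H_def)
  \<comment> \<open>Half the gap: numbers closer than \<open>d\<close> to each of the two values at
    \<open>p\<close> cannot coincide.\<close>
  define d where "d = \<bar>H u v p - H v u p\<bar> / 2"
  have d: "d > 0" using ne by (simp add: d_def)
  have cont: "isCont (H u v) p" for u v
    unfolding H_def
    using continuous_on_interior assms interior_open smooth_on_continuous_on
      smooth_on_frechet_derivative smooth_on_frechet_derivative by metis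
  obtain r1 where r1: "r1 > 0" "\<And>x. dist x p < r1 \<Longrightarrow> dist (H u v x) (H u v p) < d"
    using cont d unfolding continuous_at_eps_delta by metis
  obtain r2 where r2: "r2 > 0" "\<And>x. dist x p < r2 \<Longrightarrow> dist (H v u x) (H v u p) < d"
    using cont d unfolding continuous_at_eps_delta by metis
  obtain r3 where r3: "r3 > 0" "ball p r3 \<subseteq> U" using assms open_contains_ball by metis
  define r where "r = min r1 (min r2 r3)"
  have r: "r > 0" "ball p r \<subseteq> U" using r1 r2 r3 by (auto simp: r_def)
  \<comment> \<open>The summand 1 keeps \<open>K\<close> positive when \<open>u\<close> and
    \<open>v\<close> both vanish; \<open>s\<close> is then chosen so that
    \<open>s * K = r / 2\<close>.\<close>
  define K where "K = norm u + norm v + 1"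
  define s where "s = r / (2 * K)"
  have pos: "K > 0" unfolding K_def by (smt (verit) norm_ge_zero)
  have s: "s > 0" using r pos by (simp add: s_def)
  have "s * (norm u + norm v) < s * K" using s by (simp add: K_def)
  also have "\<dots> = r / 2" using pos by (simp add: s_def)
  finally have sr: "s * (norm u + norm v) < r" using r by simp
  obtain x where x: "x \<in> ball p r" "f (p + s *\<^sub>R u + s *\<^sub>R v) - f (p + s *\<^sub>R u) - f (p + s *\<^sub>R v) + f p = s\<^sup>2 * H u v x"
    unfolding H_def using second_difference_eq[OF assms(1,2) r(2) s sr] by metis
  obtain y where y: "y \<in> ball p r" "f (p + s *\<^sub>R v + s *\<^sub>R u) - f (p + s *\<^sub>R v) - f (p + s *\<^sub>R u) + f p = s\<^sup>2 * H v u y"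
    unfolding H_def using second_difference_eq[OF assms(1,2) r(2) s, of v u] sr by (metis add.commute)
  have "f (p + s *\<^sub>R v + s *\<^sub>R u) = f (p + s *\<^sub>R u + s *\<^sub>R v)" by (simp add: add.commute add.left_commute)
  then have "s\<^sup>2 * H u v x = s\<^sup>2 * H v u y" using x(2) y(2) by linarith
  then have "H u v x = H v u y" using s by simp
  moreover have "\<bar>H u v x - H u v p\<bar> < d" using r1(2)[of x] x(1) by (auto simp: r_def dist_real_def dist_commute)
  moreover have "\<bar>H v u y - H v u p\<bar> < d" using r2(2)[of y] y(1) by (auto simp: r_def dist_real_def dist_commute)
  ultimately have "\<bar>H u v p - H v u p\<bar> < 2 * d" by linarith
  then show False by (simp add: d_def)
qed

lemma frechet_derivative_bounded_linear:
  assumes "bounded_linear L" "(f has_derivative f') (at x)"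
  shows "frechet_derivative (\<lambda>x. L (f x)) (at x) = (\<lambda>v. L (f' v))"
  using frechet_derivative_at[OF bounded_linear.has_derivative[OF assms]] by simp

lemma frechet_derivative_symmetric:
  fixes f :: "'a::euclidean_space \<Rightarrow> 'b::euclidean_space"
  assumes "open U" "smooth_on U f" "p \<in> U"
  shows "frechet_derivative (\<lambda>x. frechet_derivative f (at x) u) (at p) v =
         frechet_derivative (\<lambda>x. frechet_derivative f (at x) v) (at p) u"
proof (rule euclidean_eqI)
  fix b :: 'b assume "b \<in> Basis"
  have comp: "frechet_derivative (\<lambda>x. frechet_derivative f (at x) u) (at p) v \<bullet> b =
     frechet_derivative (\<lambda>x. frechet_derivative (\<lambda>x. f x \<bullet> b) (at x) u) (at p) v" for u v
  proof -
    have sm: "smooth_on U (\<lambda>x. frechet_derivative f (at x) u)"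
      by (rule smooth_on_frechet_derivative[OF assms(2)])
    note D = smooth_on_has_derivative[OF sm assms(1,3)]
    have "((\<lambda>x. frechet_derivative f (at x) u \<bullet> b) has_derivative
        (\<lambda>v. frechet_derivative (\<lambda>x. frechet_derivative f (at x) u) (at p) v \<bullet> b)) (at p)"
      by (rule bounded_linear.has_derivative[OF bounded_linear_inner_left D])
    then have "((\<lambda>x. frechet_derivative (\<lambda>x. f x \<bullet> b) (at x) u) has_derivative
        (\<lambda>v. frechet_derivative (\<lambda>x. frechet_derivative f (at x) u) (at p) v \<bullet> b)) (at p)"
      by (rule has_derivative_transform_within_open[OF _ assms(1,3)])
        (simp add: frechet_derivative_bounded_linear[OF bounded_linear_inner_left
            smooth_on_has_derivative[OF assms(2,1)]])
    from fun_cong[OF frechet_derivative_at[OF this]] show ?thesis .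
  qed
  show "frechet_derivative (\<lambda>x. frechet_derivative f (at x) u) (at p) v \<bullet> b =
         frechet_derivative (\<lambda>x. frechet_derivative f (at x) v) (at p) u \<bullet> b"
    unfolding comp
    by (rule frechet_derivative_symmetric_real[OF assms(1) _ assms(3)])
      (rule smooth_on_bounded_linear[OF bounded_linear_inner_left assms(1,2)])
qed

text \<open>A derivative within \<open>M\<close> is enough for the chain rule, because the curve
  stays in \<open>M\<close> and the derivative within the open set \<open>I\<close> is the ordinary
  one.\<close>

lemma has_vector_derivative_along_curve:
  assumes "(f has_derivative f') (at (\<gamma> t) within M)" "open I" "t \<in> I" "\<gamma> ` I \<subseteq> M"
    "(\<gamma> has_vector_derivative v) (at t)"
  shows "((\<lambda>s. f (\<gamma> s)) has_vector_derivative f' v) (at t)"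
proof -
  have "(\<gamma> has_derivative (\<lambda>h. h *\<^sub>R v)) (at t within I)"
    using assms(5) unfolding at_within_open[OF assms(3,2)] has_vector_derivative_def .
  moreover have "(f has_derivative f') (at (\<gamma> t) within \<gamma> ` I)"
    using has_derivative_subset[OF assms(1,4)] .
  ultimately have "((\<lambda>s. f (\<gamma> s)) has_derivative (\<lambda>h. f' (h *\<^sub>R v))) (at t within I)"
    by (rule has_derivative_in_compose)
  then show ?thesis
    unfolding at_within_open[OF assms(3,2)] has_vector_derivative_def
      linear_cmul[OF has_derivative_linear[OF assms(1)]] .
qed

text \<open>\<open>differential\<close> is an arbitrary choice among the derivatives within
  \<open>M\<close>. On a tangent vector all choices agree: each gives the velocity of
  \<open>f\<close> along a curve with that tangent, and this velocity is unique.\<close>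

lemma differential_eq:
  assumes "(f has_derivative f') (at p within M)" "v \<in> tangent_space M p"
  shows "differential M f p v = f' v"
proof -
  obtain \<gamma> \<epsilon> where g: "\<epsilon> > 0" "\<gamma> ` {-\<epsilon><..<\<epsilon>} \<subseteq> M" "\<gamma> 0 = p" "(\<gamma> has_vector_derivative v) (at 0)"
    using assms(2) unfolding tangent_space_def by auto
  have *: "((\<lambda>s. f (\<gamma> s)) has_vector_derivative h v) (at 0)" if "(f has_derivative h) (at p within M)" for h
    by (rule has_vector_derivative_along_curve[of f h \<gamma> 0 M "{-\<epsilon><..<\<epsilon>}"]) (use g that in auto)
  have "(f has_derivative frechet_derivative f (at p within M)) (at p within M)"
    using differentiableI[OF assms(1)] by (simp only: frechet_derivative_works)
  from vector_derivative_unique_at[OF *[OF this] *[OF assms(1)]]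
  show ?thesis by (simp add: differential_def)
qed

lemma extension_has_derivative:
  assumes "open U" "p \<in> M \<inter> U" "smooth_on U F" "\<And>x. x \<in> M \<inter> U \<Longrightarrow> F x = f x"
  shows "(f has_derivative frechet_derivative F (at p)) (at p within M)"
proof -
  obtain d where d: "d > 0" "ball p d \<subseteq> U" using assms(1,2) open_contains_ball by blast
  have "(F has_derivative frechet_derivative F (at p)) (at p within M)"
    using smooth_on_has_derivative[OF assms(3,1)] assms(2) has_derivative_at_withinI by blast
  then show ?thesis
    by (rule has_derivative_transform_within[OF _ d(1)]) (use assms(2,4) d(2) in \<open>auto simp: dist_commute subset_iff\<close>)
qed

lemma smooth_map_on_has_derivative:
  assumes "smooth_map_on M f" "p \<in> M"
  shows "(f has_derivative differential M f p) (at p within M)"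
proof -
  obtain U F where "open U" "p \<in> U" "smooth_on U F" "\<And>x. x \<in> M \<inter> U \<Longrightarrow> F x = f x"
    using smooth_map_onE[OF assms] by metis
  then have "(f has_derivative frechet_derivative F (at p)) (at p within M)"
    using extension_has_derivative assms(2) by blast
  from differentiableI[OF this] show ?thesis
    unfolding differential_def by (simp only: frechet_derivative_works)
qed

lemma differential_extension:
  assumes "open U" "p \<in> M \<inter> U" "smooth_on U F" "\<And>x. x \<in> M \<inter> U \<Longrightarrow> F x = f x" "v \<in> tangent_space M p"
  shows "differential M f p v = frechet_derivative F (at p) v"
  using differential_eq[OF extension_has_derivative[OF assms(1-4)] assms(5)] .

lemma differential_linear: "smooth_map_on M f \<Longrightarrow> p \<in> M \<Longrightarrow> linear (differential M f p)"
  using smooth_map_on_has_derivative has_derivative_linear by blast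

text \<open>Maps that agree on \<open>M\<close> have the same derivatives within \<open>M\<close>,
  so the two choices coincide; this gives every \<open>v\<close>, tangent or not.\<close>

lemma differential_cong:
  assumes "p \<in> M" "\<And>x. x \<in> M \<Longrightarrow> f x = g x"
  shows "differential M f p v = differential M g p v"
proof -
  have "(f has_derivative f') (at p within M) = (g has_derivative f') (at p within M)" for f'
    using assms has_derivative_transform[of p M] by metis
  then show ?thesis by (simp add: differential_def frechet_derivative_def)
qed

lemma differential_ident: "v \<in> tangent_space M p \<Longrightarrow> differential M (\<lambda>x. x) p v = v"
  by (rule differential_eq) auto

lemma differential_bounded_linear:
  assumes "bounded_linear L" "smooth_map_on M f" "p \<in> M" "v \<in> tangent_space M p"
  shows "differential M (\<lambda>x. L (f x)) p v = L (differential M f p v)"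
  by (rule differential_eq[OF bounded_linear.has_derivative[OF assms(1)
          smooth_map_on_has_derivative[OF assms(2,3)]] assms(4)])

lemma differential_bilinear:
  assumes "bounded_bilinear h" "smooth_map_on M f" "smooth_map_on M g" "p \<in> M" "v \<in> tangent_space M p"
  shows "differential M (\<lambda>x. h (f x) (g x)) p v = h (f p) (differential M g p v) + h (differential M f p v) (g p)"
  by (rule differential_eq[OF bounded_bilinear.FDERIV[OF assms(1) smooth_map_on_has_derivative[OF assms(2,4)]
          smooth_map_on_has_derivative[OF assms(3,4)]] assms(5)])

lemma differential_add:
  assumes "smooth_map_on M f" "smooth_map_on M g" "p \<in> M" "v \<in> tangent_space M p"
  shows "differential M (\<lambda>x. f x + g x) p v = differential M f p v + differential M g p v"
  by (rule differential_eq[OF has_derivative_add[OF smooth_map_on_has_derivative[OF assms(1,3)]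
          smooth_map_on_has_derivative[OF assms(2,3)]] assms(4)])

lemma vector_fieldsD:
  assumes "X \<in> vector_fields M"
  shows "smooth_map_on M X" "p \<in> M \<Longrightarrow> X p \<in> tangent_space M p"
  using assms by (auto simp: vector_fields_def)

lemma smooth_map_on_differential:
  assumes "smooth_map_on M f" "X \<in> vector_fields M"
  shows "smooth_map_on M (\<lambda>x. differential M f x (X x))"
  unfolding smooth_map_on_def
proof
  fix p assume "p \<in> M"
  then obtain U F G where U: "open U" "p \<in> U" "smooth_on U F" "smooth_on U G"
    "\<And>x. x \<in> M \<inter> U \<Longrightarrow> F x = f x" "\<And>x. x \<in> M \<inter> U \<Longrightarrow> G x = X x"
    using smooth_map_onE2[OF assms(1) vector_fieldsD(1)[OF assms(2)]] by metis
  show "\<exists>U F. open U \<and> p \<in> U \<and> smooth_on U F \<and> (\<forall>x\<in>M \<inter> U. F x = differential M f x (X x))"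
  proof (intro exI conjI ballI)
    show "smooth_on U (\<lambda>x. frechet_derivative F (at x) (G x))"
      by (rule smooth_on_directional_derivative[OF U(1,3,4)])
    show "frechet_derivative F (at x) (G x) = differential M f x (X x)" if "x \<in> M \<inter> U" for x
      using differential_extension[OF U(1) that U(3,5) vector_fieldsD(2)[OF assms(2)]] U(6) that by simp
  qed (use U in auto)
qed

lemma frechet_derivative_directional:
  fixes f :: "'a::euclidean_space \<Rightarrow> 'b::euclidean_space"
  assumes "open U" "smooth_on U f" "smooth_on U h" "p \<in> U"
  shows "frechet_derivative (\<lambda>x. frechet_derivative f (at x) (h x)) (at p) v =
    frechet_derivative (\<lambda>x. frechet_derivative f (at x) v) (at p) (h p) +
    frechet_derivative f (at p) (frechet_derivative h (at p) v)"
proof -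
  let ?D = "frechet_derivative f"
  let ?h = "frechet_derivative h (at p)"
  have lin: "linear (?D (at x))" if "x \<in> U" for x
    using has_derivative_linear[OF smooth_on_has_derivative[OF assms(2,1) that]] .
  have lin2: "linear (\<lambda>w. frechet_derivative (\<lambda>x. ?D (at x) v) (at p) w)"
    using has_derivative_linear[OF smooth_on_has_derivative[OF smooth_on_frechet_derivative[OF assms(2)] assms(1,4)]] .
  have "((\<lambda>x. \<Sum>b\<in>Basis. (h x \<bullet> b) *\<^sub>R ?D (at x) b) has_derivative
    (\<lambda>v. \<Sum>b\<in>Basis. (h p \<bullet> b) *\<^sub>R frechet_derivative (\<lambda>x. ?D (at x) b) (at p) v + (?h v \<bullet> b) *\<^sub>R ?D (at p) b)) (at p)"
    by (intro has_derivative_sum has_derivative_scaleR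
        bounded_linear.has_derivative[OF bounded_linear_inner_left]
        smooth_on_has_derivative smooth_on_frechet_derivative) (use assms in auto)
  then have "((\<lambda>x. ?D (at x) (h x)) has_derivative
    (\<lambda>v. \<Sum>b\<in>Basis. (h p \<bullet> b) *\<^sub>R frechet_derivative (\<lambda>x. ?D (at x) b) (at p) v + (?h v \<bullet> b) *\<^sub>R ?D (at p) b)) (at p)"
    by (rule has_derivative_transform_within_open[OF _ assms(1,4)])
      (rule linear_Basis_expansion[OF lin, symmetric])
  from fun_cong[OF frechet_derivative_at[OF this], of v, symmetric]
  have "frechet_derivative (\<lambda>x. ?D (at x) (h x)) (at p) v =
     (\<Sum>b\<in>Basis. (h p \<bullet> b) *\<^sub>R frechet_derivative (\<lambda>x. ?D (at x) b) (at p) v + (?h v \<bullet> b) *\<^sub>R ?D (at p) b)" .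
  \<comment> \<open>Schwarz's theorem moves \<open>v\<close> inside, so that the basis sum
    reassembles by linearity into a single second derivative in direction
    \<open>h p\<close>.\<close>
  also have "\<dots> = (\<Sum>b\<in>Basis. (h p \<bullet> b) *\<^sub>R frechet_derivative (\<lambda>x. ?D (at x) v) (at p) b) + ?D (at p) (?h v)"
    unfolding frechet_derivative_symmetric[OF assms(1,2,4), of _ v]
    unfolding sum.distrib linear_Basis_expansion[OF lin[OF assms(4)], of "?h v", symmetric] ..
  also have "\<dots> = frechet_derivative (\<lambda>x. ?D (at x) v) (at p) (h p) + ?D (at p) (?h v)"
    unfolding linear_Basis_expansion[OF lin2, of "h p", symmetric] ..
  finally show ?thesis .
qed

text \<open>Computed with extensions of \<open>f\<close>, \<open>X\<close> and \<open>Y\<close> to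
  an open set: the second-order terms cancel by symmetry, and the first-order terms form the
  coordinate bracket. The bracket is assumed tangent because the differential is known to agree with
  the derivative of the extension on tangent vectors.\<close>

lemma differential_commutator:
  fixes f :: "'a::euclidean_space \<Rightarrow> 'b::euclidean_space"
  assumes "smooth_map_on M f" "X \<in> vector_fields M" "Y \<in> vector_fields M" "p \<in> M"
    "lie_bracket M X Y p \<in> tangent_space M p"
  shows "differential M (\<lambda>x. differential M f x (Y x)) p (X p) -
         differential M (\<lambda>x. differential M f x (X x)) p (Y p) =
         differential M f p (lie_bracket M X Y p)"
proof -
  obtain U1 F X1 where 1: "open U1" "p \<in> U1" "smooth_on U1 F" "smooth_on U1 X1"
    "\<And>x. x \<in> M \<inter> U1 \<Longrightarrow> F x = f x" "\<And>x. x \<in> M \<inter> U1 \<Longrightarrow> X1 x = X x"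
    using smooth_map_onE2[OF assms(1) vector_fieldsD(1)[OF assms(2)] assms(4)] by metis
  obtain U2 Y1 where 2: "open U2" "p \<in> U2" "smooth_on U2 Y1" "\<And>x. x \<in> M \<inter> U2 \<Longrightarrow> Y1 x = Y x"
    using smooth_map_onE[OF vector_fieldsD(1)[OF assms(3)] assms(4)] by metis
  define U where "U = U1 \<inter> U2"
  have U: "open U" "p \<in> M \<inter> U" "smooth_on U F" "smooth_on U X1" "smooth_on U Y1"
    "\<And>x. x \<in> M \<inter> U \<Longrightarrow> F x = f x" "\<And>x. x \<in> M \<inter> U \<Longrightarrow> X1 x = X x" "\<And>x. x \<in> M \<inter> U \<Longrightarrow> Y1 x = Y x"
    using 1 2 assms(4) by (auto simp: U_def intro: smooth_on_subset)
  note tan = vector_fieldsD(2)[OF assms(2)] vector_fieldsD(2)[OF assms(3)]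
  \<comment> \<open>The map to be differentiated once more is itself extended off \<open>M\<close>,
    by the derivative of \<open>F\<close> along \<open>W1\<close>.\<close>
  have second: "differential M (\<lambda>x. differential M f x (W x)) p v =
      frechet_derivative (\<lambda>x. frechet_derivative F (at x) (W1 x)) (at p) v"
    if "smooth_on U W1" "\<And>x. x \<in> M \<inter> U \<Longrightarrow> W1 x = W x" "\<And>x. x \<in> M \<Longrightarrow> W x \<in> tangent_space M x"
      "v \<in> tangent_space M p" for W W1 v
  proof (rule differential_extension[OF U(1,2)])
    show "smooth_on U (\<lambda>x. frechet_derivative F (at x) (W1 x))"
      by (rule smooth_on_directional_derivative[OF U(1,3) that(1)])
    show "frechet_derivative F (at x) (W1 x) = differential M f x (W x)" if "x \<in> M \<inter> U" for x
      using differential_extension[OF U(1) that U(3,6)] \<open>\<And>x. x \<in> M \<Longrightarrow> W x \<in> tangent_space M x\<close>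
        \<open>\<And>x. x \<in> M \<inter> U \<Longrightarrow> W1 x = W x\<close> that by simp
  qed (rule that)
  have bracket: "lie_bracket M X Y p = frechet_derivative Y1 (at p) (X p) - frechet_derivative X1 (at p) (Y p)"
    unfolding lie_bracket_def
    using differential_extension[OF U(1,2,5,8)] differential_extension[OF U(1,2,4,7)] tan assms(4) by simp
  have lin: "linear (frechet_derivative F (at p))"
    using has_derivative_linear[OF smooth_on_has_derivative[OF U(3,1)]] U(2) by blast
  have p: "p \<in> U" "X1 p = X p" "Y1 p = Y p" using U by auto
  have XY: "differential M (\<lambda>x. differential M f x (Y x)) p (X p) =
      frechet_derivative (\<lambda>x. frechet_derivative F (at x) (X p)) (at p) (Y p) +
      frechet_derivative F (at p) (frechet_derivative Y1 (at p) (X p))"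
    using second[OF U(5,8) tan(2) tan(1)[OF assms(4)]]
      frechet_derivative_directional[OF U(1,3,5) p(1), of "X p"] by (simp add: p)
  have YX: "differential M (\<lambda>x. differential M f x (X x)) p (Y p) =
      frechet_derivative (\<lambda>x. frechet_derivative F (at x) (Y p)) (at p) (X p) +
      frechet_derivative F (at p) (frechet_derivative X1 (at p) (Y p))"
    using second[OF U(4,7) tan(1) tan(2)[OF assms(4)]]
      frechet_derivative_directional[OF U(1,3,4) p(1), of "Y p"] by (simp add: p)
  have "differential M f p (lie_bracket M X Y p) = frechet_derivative F (at p) (frechet_derivative Y1 (at p) (X p)) -
      frechet_derivative F (at p) (frechet_derivative X1 (at p) (Y p))"
    using differential_extension[OF U(1,2,3,6) assms(5)] linear_diff[OF lin] by (simp add: bracket)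
  then show ?thesis
    unfolding XY YX using frechet_derivative_symmetric[OF U(1,3) p(1), of "Y p" "X p"] by simp
qed

section \<open>The orthogonal group as a submanifold\<close>

lemma bounded_bilinear_matrix_mult:

  \<comment> \<open>Matrix products, transposes and the Frobenius inner product\<close>
  "bounded_bilinear ((**) :: real^'n^'m \<Rightarrow> real^'p^'n \<Rightarrow> real^'p^'m)"
  unfolding bilinear_conv_bounded_bilinear[symmetric] bilinear_def
  by (auto intro!: linearI simp: matrix_matrix_mult_def vec_eq_iff sum.distrib
      sum_distrib_left algebra_simps)

lemma bounded_linear_transpose: "bounded_linear (transpose :: real^'n^'m \<Rightarrow> real^'m^'n)"
  unfolding linear_conv_bounded_linear[symmetric]
  by (auto intro!: linearI simp: transpose_def vec_eq_iff)

lemmas matrix_algebra =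
  bounded_bilinear.add_left[OF bounded_bilinear_matrix_mult]
  bounded_bilinear.add_right[OF bounded_bilinear_matrix_mult]
  bounded_bilinear.diff_left[OF bounded_bilinear_matrix_mult]
  bounded_bilinear.diff_right[OF bounded_bilinear_matrix_mult]
  bounded_bilinear.minus_left[OF bounded_bilinear_matrix_mult]
  bounded_bilinear.minus_right[OF bounded_bilinear_matrix_mult]
  bounded_bilinear.scaleR_left[OF bounded_bilinear_matrix_mult]
  bounded_bilinear.scaleR_right[OF bounded_bilinear_matrix_mult]
  matrix_mul_assoc

lemma transpose_add: "transpose (A + B) = transpose A + transpose (B :: real^'n^'m)"
  and transpose_diff: "transpose (A - B) = transpose A - transpose (B :: real^'n^'m)"
  and transpose_minus: "transpose (- A) = - transpose (A :: real^'n^'m)"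
  by (simp_all add: transpose_def vec_eq_iff)

lemmas transpose_algebra = transpose_add transpose_diff transpose_minus transpose_scalar
  matrix_transpose_mul

lemma inner_matrix: "V \<bullet> W = (\<Sum>i\<in>UNIV. \<Sum>j\<in>UNIV. V$i$j * W$i$j)" for V W :: "real^'n^'m"
  by (simp add: inner_vec_def)

lemma frobenius_metric_inner: "frobenius_metric p V W = V \<bullet> W"
  unfolding frobenius_metric_def inner_matrix trace_def matrix_matrix_mult_def transpose_def
  by (simp add: sum.swap[of "\<lambda>i j. V$i$j * W$i$j"])

text \<open>Both sides are the trace of \<open>V^T A^T W\<close>. The sums are swapped because this
  trace runs over columns first and the inner product over rows first.\<close>

lemma inner_matrix_mult_left: "(A ** V) \<bullet> W = V \<bullet> (transpose A ** W)"
  for A :: "real^'n^'m" and V :: "real^'p^'n"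
proof -
  have "trace (transpose (A ** V) ** W) = trace (transpose V ** (transpose A ** W))"
    by (simp add: transpose_algebra matrix_algebra)
  then have "(\<Sum>i\<in>UNIV. \<Sum>k\<in>UNIV. (A ** V)$k$i * W$k$i) =
      (\<Sum>i\<in>UNIV. \<Sum>k\<in>UNIV. V$k$i * (transpose A ** W)$k$i)"
    unfolding trace_def matrix_matrix_mult_def[of "transpose (A ** V)"]
      matrix_matrix_mult_def[of "transpose V"]
    by (simp add: transpose_def)
  then show ?thesis
    unfolding inner_matrix
    by (subst sum.swap, subst (2) sum.swap) simp
qed

lemma inner_transpose: "transpose V \<bullet> transpose W = V \<bullet> W" for V W :: "real^'n^'m"
  unfolding inner_matrix by (subst sum.swap) (simp add: transpose_def)

lemma invertible_matrix_inv:
  assumes "invertible (A :: real^'n^'n)"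
  shows "A ** matrix_inv A = mat 1" "matrix_inv A ** A = mat 1"
proof -
  have "\<exists>A'. A ** A' = mat 1 \<and> A' ** A = mat 1" using assms invertible_def by blast
  then have "A ** matrix_inv A = mat 1 \<and> matrix_inv A ** A = mat 1"
    unfolding matrix_inv_def by (rule someI_ex)
  then show "A ** matrix_inv A = mat 1" "matrix_inv A ** A = mat 1" by auto
qed

lemma matrix_inv_unique: "A ** B = mat 1 \<Longrightarrow> matrix_inv A = B" for A B :: "real^'n^'n"
  by (metis invertible_def invertible_matrix_inv(2) matrix_left_right_inverse matrix_mul_assoc
      matrix_mul_lid matrix_mul_rid)

section \<open>Smoothness of the determinant and of matrix inversion\<close>

lemma smooth_on_matrix:
  fixes F :: "'a::euclidean_space \<Rightarrow> real^'n^'m"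
  assumes "open S" "\<And>i j. smooth_on S (\<lambda>x. F x $ i $ j)"
  shows "smooth_on S F"
proof -
  have "smooth_on S (\<lambda>x. F x \<bullet> b)" if "b \<in> Basis" for b
    using that assms(2) by (auto simp: Basis_vec_def inner_axis)
  then have "smooth_on S (\<lambda>x. \<Sum>b\<in>Basis. (F x \<bullet> b) *\<^sub>R b)"
    by (intro smooth_on_sum assms(1) smooth_on_bounded_linear[OF bounded_linear_scaleR_left]) auto
  then show ?thesis by (simp add: euclidean_representation)
qed

lemma bounded_linear_matrix_entry: "bounded_linear (\<lambda>A :: real^'n^'m. A $ i $ j)"
  by (intro bounded_linear_compose[OF bounded_linear_vec_nth bounded_linear_vec_nth])

lemma smooth_on_prod:
  fixes f :: "'i \<Rightarrow> 'a::euclidean_space \<Rightarrow> real"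
  assumes "open S" "\<And>i. i \<in> A \<Longrightarrow> smooth_on S (f i)"
  shows "smooth_on S (\<lambda>x. \<Prod>i\<in>A. f i x)"
  using assms(2)
  by (induction A rule: infinite_finite_induct)
    (auto intro: smooth_on_const smooth_on_bilinear[OF bounded_bilinear_mult] assms(1))

lemma smooth_on_det:
  fixes F :: "'a::euclidean_space \<Rightarrow> real^'n^'n"
  assumes "open S" "\<And>i j. smooth_on S (\<lambda>x. F x $ i $ j)"
  shows "smooth_on S (\<lambda>x. det (F x))"
  unfolding det_def
  by (intro smooth_on_sum smooth_on_bounded_linear[OF bounded_linear_mult_right] smooth_on_prod assms)

text \<open>The derivative of the reciprocal is built from the reciprocal itself, which the
  induction hypothesis covers at order \<open>k\<close>, and from a derivative of
  \<open>f\<close>.\<close>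

lemma Ck_on_inverse:
  fixes f :: "'a::euclidean_space \<Rightarrow> real"
  assumes "open S" "\<And>x. x \<in> S \<Longrightarrow> f x \<noteq> 0" "Ck_on k S f"
  shows "Ck_on k S (\<lambda>x. inverse (f x))"
  using assms(3)
proof (induction k)
  case 0
  then show ?case using assms(2) continuous_on_inverse by auto
next
  case (Suc k)
  show ?case
  proof (rule Ck_on_SucI[OF assms(1)])
    show "((\<lambda>x. inverse (f x)) has_derivative
        (\<lambda>v. - (inverse (f x) * frechet_derivative f (at x) v * inverse (f x)))) (at x)" if "x \<in> S" for x
      by (rule Deriv.has_derivative_inverse[OF assms(2)[OF that] Ck_on_SucD[OF Suc.prems assms(1) that]])
    have inv: "Ck_on k S (\<lambda>x. inverse (f x))" by (rule Suc.IH[OF Ck_on_pred[OF Suc.prems]])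
    show "Ck_on k S (\<lambda>x. - (inverse (f x) * frechet_derivative f (at x) v * inverse (f x)))" for v
      using Suc.prems
      by (intro Ck_on_bounded_linear[OF bounded_linear_minus[OF bounded_linear_ident]] inv assms(1)
          Ck_on_bilinear[OF bounded_bilinear_mult]) simp
  qed
qed

text \<open>Cramer's rule for the \<open>j\<close>-th column of the equation A A^(-1) = 1. It
  exhibits the entries of the inverse as polynomials in the entries of \<open>A\<close> over
  \<open>det A\<close>, which is how inversion is seen to be smooth.\<close>

lemma matrix_inv_entry:
  fixes A :: "real^'n^'n"
  assumes "det A \<noteq> 0"
  shows "matrix_inv A $ k $ j = det (\<chi> i l. if l = k then (if i = j then 1 else 0) else A$i$l) * inverse (det A)"
proof -
  have "A *v column j (matrix_inv A) = column j (A ** matrix_inv A)"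
    by (simp add: column_def vec_eq_iff matrix_matrix_mult_def matrix_vector_mult_def)
  also have "\<dots> = (\<chi> i. if i = j then 1 else 0)"
    using invertible_matrix_inv(1)[of A] assms
    by (simp add: invertible_det_nz) (simp add: column_def vec_eq_iff mat_def)
  finally have "column j (matrix_inv A) =
    (\<chi> k. det(\<chi> i l. if l = k then (\<chi> i. if i = j then 1 else 0)$i else A$i$l) / det A)"
    unfolding cramer[OF assms] .
  then have "column j (matrix_inv A) $ k =
    (\<chi> k. det(\<chi> i l. if l = k then (\<chi> i. if i = j then 1 else 0)$i else A$i$l) / det A) $ k"
    by simp
  then show ?thesis by (simp add: column_def divide_inverse cong: if_cong)
qed

lemma smooth_on_matrix_inv:
  fixes F :: "'a::euclidean_space \<Rightarrow> real^'n^'n"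
  assumes "open S" "smooth_on S F" "\<And>x. x \<in> S \<Longrightarrow> det (F x) \<noteq> 0"
  shows "smooth_on S (\<lambda>x. matrix_inv (F x))"
proof (rule smooth_on_matrix[OF assms(1)])
  fix k j
  have ent: "smooth_on S (\<lambda>x. F x $ i $ l)" for i l
    by (rule smooth_on_bounded_linear[OF bounded_linear_matrix_entry assms(1,2)])
  have "smooth_on S (\<lambda>x. inverse (det (F x)))"
    using smooth_on_det[OF assms(1) ent] Ck_on_inverse[OF assms(1,3)] by (simp add: smooth_on_def)
  moreover have "smooth_on S (\<lambda>x. det (\<chi> i l. if l = k then (if i = j then 1 else 0) else F x $i$l))"
  proof (rule smooth_on_det[OF assms(1)])
    show "smooth_on S (\<lambda>x. (\<chi> i l. if l = k then (if i = j then 1 else 0) else F x $i$l) $ i $ l)" for i l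
      using ent[of i l] by (cases "l = k") (simp_all add: smooth_on_const[OF assms(1)])
  qed
  ultimately have "smooth_on S (\<lambda>x. det (\<chi> i l. if l = k then (if i = j then 1 else 0) else F x $i$l) *
      inverse (det (F x)))"
    by (intro smooth_on_bilinear[OF bounded_bilinear_mult assms(1)])
  then show "smooth_on S (\<lambda>x. matrix_inv (F x) $ k $ j)"
    by (rule smooth_on_cong[OF assms(1), rotated]) (simp add: matrix_inv_entry[OF assms(3)])
qed

lemma open_det_nonzero:
  assumes "smooth_on UNIV F"
  shows "open {x. det (F x :: real^'n^'n) \<noteq> 0}"
proof -
  have "smooth_on UNIV (\<lambda>x. det (F x))"
    by (rule smooth_on_det[OF open_UNIV smooth_on_bounded_linear[OF bounded_linear_matrix_entry open_UNIV assms]])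
  then have "continuous_on UNIV (\<lambda>x. det (F x))" by (rule smooth_on_continuous_on)
  then have "open ((\<lambda>x. det (F x)) -` (- {0}))"
    by (intro open_vimage) auto
  then show ?thesis by (simp add: vimage_def)
qed

text \<open>This is (1 - A)(1 + A)^(-1) when 1 + A is invertible, written with a single inverse so
  that adding 1 leaves 2 (1 + A)^(-1).\<close>

definition cayley :: "real^'n^'n \<Rightarrow> real^'n^'n" where
  "cayley A = 2 *\<^sub>R matrix_inv (mat 1 + A) - mat 1"

text \<open>Half of \<open>mat 1 + A\<close> inverts \<open>mat 1 + cayley A\<close>; put back into
  the definition, this inverse returns \<open>A\<close>.\<close>

lemma cayley_involution:
  assumes "det (mat 1 + A) \<noteq> 0"
  shows "det (mat 1 + cayley A) \<noteq> 0" "cayley (cayley A) = A"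
proof -
  have inv: "invertible (mat 1 + A)" using assms invertible_det_nz by blast
  have *: "(mat 1 + cayley A) ** ((1/2) *\<^sub>R (mat 1 + A)) = mat 1"
    using invertible_matrix_inv(2)[OF inv] by (simp add: cayley_def bounded_bilinear.scaleR_left[OF bounded_bilinear_matrix_mult]
      bounded_bilinear.scaleR_right[OF bounded_bilinear_matrix_mult])
  then have "invertible (mat 1 + cayley A)"
    using invertible_right_inverse by blast
  then show "det (mat 1 + cayley A) \<noteq> 0" using invertible_det_nz by blast
  show "cayley (cayley A) = A"
    unfolding cayley_def[of "cayley A"] matrix_inv_unique[OF *] by simp
qed

text \<open>With B = 1 + A and W its inverse, skewness reads W + W^T = 1. Multiplying by B on the
  left and B^T on the right, which W and W^T undo, turns this into B^T + B = B B^T, and expanding B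
  leaves A A^T = 1.\<close>

lemma cayley_skew_iff:
  assumes "det (mat 1 + A) \<noteq> 0"
  shows "skew_symmetric (cayley A) \<longleftrightarrow> orthogonal_matrix A"
proof -
  define W where "W = matrix_inv (mat 1 + A)"
  define B where "B = mat 1 + A"
  have inv: "invertible B" using assms invertible_det_nz B_def by blast
  have W: "B ** W = mat 1" "W ** B = mat 1" using invertible_matrix_inv[OF inv] by (simp_all add: W_def B_def)
  have Wt: "transpose W ** transpose B = mat 1" "transpose B ** transpose W = mat 1"
    using W by (simp_all flip: matrix_transpose_mul)
  have "skew_symmetric (cayley A) \<longleftrightarrow> 2 *\<^sub>R transpose W - mat 1 = mat 1 - 2 *\<^sub>R W"
    unfolding skew_symmetric_def cayley_def W_def by (simp add: transpose_algebra)
  also have "\<dots> \<longleftrightarrow> 2 *\<^sub>R (W + transpose W) = 2 *\<^sub>R mat 1"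
    by (simp only: scaleR_right_distrib scaleR_2[of "mat 1"]) (auto simp: algebra_simps)
  also have "\<dots> \<longleftrightarrow> W + transpose W = mat 1" by simp
  also have "\<dots> \<longleftrightarrow> B ** (W + transpose W) ** transpose B = B ** transpose B"
  proof
    assume *: "B ** (W + transpose W) ** transpose B = B ** transpose B"
    have "W ** (B ** (W + transpose W) ** transpose B) ** transpose W =
        (W ** B) ** (W + transpose W) ** (transpose B ** transpose W)"
      by (simp add: matrix_mul_assoc)
    moreover have "W ** (B ** transpose B) ** transpose W = (W ** B) ** (transpose B ** transpose W)"
      by (simp add: matrix_mul_assoc)
    ultimately show "W + transpose W = mat 1" using * W Wt by simp
  qed simp
  also have "B ** (W + transpose W) ** transpose B = transpose B + B"
  proof -
    have "B ** (W + transpose W) ** transpose B = (B ** W) ** transpose B + B ** (transpose W ** transpose B)"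
      by (simp add: matrix_algebra)
    then show ?thesis by (simp add: W Wt)
  qed
  also have "transpose B + B = B ** transpose B \<longleftrightarrow> A ** transpose A = mat 1"
    by (auto simp: B_def matrix_algebra transpose_algebra algebra_simps)
  also have "\<dots> \<longleftrightarrow> orthogonal_matrix A"
    by (simp add: orthogonal_matrix_def matrix_left_right_inverse)
  finally show ?thesis .
qed

section \<open>Orthogonal matrices and the Cayley charts\<close>

lemma orthogonal_groupD:
  assumes "p \<in> orthogonal_group"
  shows "transpose p ** p = mat 1" "p ** transpose p = mat 1"
  using assms by (simp_all add: orthogonal_group_def orthogonal_matrix_def)

lemma orthogonal_group_cancel:
  assumes "p \<in> orthogonal_group"
  shows "transpose p ** (p ** A) = A" "p ** (transpose p ** A) = A"
    "A ** transpose p ** p = A" "A ** p ** transpose p = A"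
  by (simp_all add: orthogonal_groupD[OF assms] matrix_mul_assoc)
    (simp_all add: orthogonal_groupD[OF assms] flip: matrix_mul_assoc)

lemma orthogonal_group_mult:
  "p \<in> orthogonal_group \<Longrightarrow> q \<in> orthogonal_group \<Longrightarrow> p ** q \<in> orthogonal_group"
  by (simp add: orthogonal_group_def orthogonal_matrix_mul)

lemma orthogonal_group_transpose: "p \<in> orthogonal_group \<Longrightarrow> transpose p \<in> orthogonal_group"
  by (simp add: orthogonal_group_def orthogonal_matrix_def)

text \<open>Puts \<open>p\<close> into the domain of its own chart, where
  \<open>mat 1 + transpose p ** p\<close> has to be invertible.\<close>

lemma det_two_nonzero: "det (mat 1 + mat 1 :: real^'n^'n) \<noteq> 0"
proof -
  have "(mat 1 + mat 1) ** ((1/2) *\<^sub>R (mat 1 :: real^'n^'n)) = mat 1"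
    by (simp add: matrix_algebra flip: scaleR_left_distrib)
  then show ?thesis using invertible_right_inverse invertible_det_nz by blast
qed

lemma subspace_skew: "subspace {A :: real^'n^'n. skew_symmetric A}"
  by (auto intro!: subspaceI simp: skew_symmetric_def transpose_algebra)
    (simp add: transpose_def vec_eq_iff)

lemma smooth_on_translate_matrix:
  "open U \<Longrightarrow> smooth_on U (\<lambda>x. B + A ** x)" for A B :: "real^'n^'n"
  by (intro smooth_on_add smooth_on_const smooth_on_id smooth_on_bounded_linear
      [OF bounded_bilinear.bounded_linear_right[OF bounded_bilinear_matrix_mult]])

text \<open>The chart at \<open>p\<close> translates \<open>p\<close> to the identity and applies
  the Cayley transform, which flattens the group to the space of skew matrices. As the transform is
  an involution, it also provides the inverse chart.\<close>

lemma embedded_submanifold_orthogonal_group: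
  "\<exists>d. embedded_submanifold (orthogonal_group :: (real^'n^'n) set) d"
proof (intro exI)
  let ?S = "{A :: real^'n^'n. skew_symmetric A}"
  show "embedded_submanifold (orthogonal_group :: (real^'n^'n) set) (dim ?S)"
    unfolding embedded_submanifold_def
  proof
    fix p :: "real^'n^'n" assume p: "p \<in> orthogonal_group"
    note pc = orthogonal_group_cancel[OF p]
    define U where "U = {x. det (mat 1 + transpose p ** x) \<noteq> 0}"
    define V where "V = {y :: real^'n^'n. det (mat 1 + y) \<noteq> 0}"
    define \<Phi> where "\<Phi> x = cayley (transpose p ** x)" for x
    define \<Psi> where "\<Psi> y = p ** cayley y" for y
    have U: "open U" unfolding U_def by (rule open_det_nonzero[OF smooth_on_translate_matrix[OF open_UNIV]])
    have V: "open V"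
      using open_det_nonzero[OF smooth_on_translate_matrix[OF open_UNIV, of "mat 1" "mat 1"]]
      by (simp add: V_def)
    have pU: "p \<in> U" using det_two_nonzero by (simp add: U_def orthogonal_groupD[OF p])
    have Phi: "smooth_on U \<Phi>" unfolding \<Phi>_def cayley_def
      by (intro smooth_on_diff smooth_on_const smooth_on_matrix_inv U smooth_on_translate_matrix
          smooth_on_bounded_linear[OF bounded_linear_scaleR_right]) (simp add: U_def)
    have "smooth_on V (\<lambda>y. mat 1 + y)"
      by (intro smooth_on_add smooth_on_const smooth_on_id V)
    then have Psi: "smooth_on V \<Psi>" unfolding \<Psi>_def cayley_def
      by (intro smooth_on_diff smooth_on_const smooth_on_matrix_inv V
          smooth_on_bounded_linear[OF bounded_linear_scaleR_right]
          smooth_on_bounded_linear[OF bounded_bilinear.bounded_linear_right[OF bounded_bilinear_matrix_mult]])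
        (simp_all add: V_def)
    have PhiV: "\<Phi> x \<in> V" "\<Psi> (\<Phi> x) = x" if "x \<in> U" for x
      using cayley_involution[of "transpose p ** x"] that
      by (auto simp: \<Phi>_def \<Psi>_def V_def U_def pc)
    have PsiU: "\<Psi> y \<in> U" "\<Phi> (\<Psi> y) = y" if "y \<in> V" for y
      using cayley_involution[of y] that by (auto simp: \<Phi>_def \<Psi>_def V_def U_def pc)
    have image: "\<Phi> ` U = V"
      using PhiV PsiU by (metis image_eqI image_subsetI subsetI subset_antisym)
    have skew: "skew_symmetric (\<Phi> x) \<longleftrightarrow> x \<in> orthogonal_group" if "x \<in> U" for x
    proof -
      have "skew_symmetric (\<Phi> x) \<longleftrightarrow> orthogonal_matrix (transpose p ** x)"
        unfolding \<Phi>_def using cayley_skew_iff that U_def by blast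
      also have "\<dots> \<longleftrightarrow> x \<in> orthogonal_group"
        using orthogonal_group_mult[OF p, of "transpose p ** x"] pc
          orthogonal_group_mult[OF orthogonal_group_transpose[OF p], of x]
        by (auto simp: orthogonal_group_def)
      finally show ?thesis .
    qed
    have "\<Phi> ` (U \<inter> orthogonal_group) = V \<inter> ?S"
    proof (intro set_eqI iffI)
      fix y assume "y \<in> V \<inter> ?S"
      then have "y = \<Phi> (\<Psi> y)" "\<Psi> y \<in> U \<inter> orthogonal_group"
        using PsiU[of y] skew[of "\<Psi> y"] by auto
      then show "y \<in> \<Phi> ` (U \<inter> orthogonal_group)" by blast
    qed (use skew PhiV in auto)
    then have "open U \<and> p \<in> U \<and> open V \<and> smooth_on U \<Phi> \<and> smooth_on V \<Psi> \<and>
        \<Phi> ` U = V \<and> (\<forall>x\<in>U. \<Psi> (\<Phi> x) = x) \<and> (\<forall>y\<in>V. \<Phi> (\<Psi> y) = y) \<and>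
        subspace ?S \<and> dim ?S = dim ?S \<and> \<Phi> ` (U \<inter> orthogonal_group) = V \<inter> ?S"
      using U V pU Phi Psi image PhiV PsiU subspace_skew by blast
    then show "\<exists>U V \<Phi> \<Psi> (S :: (real^'n^'n) set). open U \<and> p \<in> U \<and> open V \<and> smooth_on U \<Phi> \<and> smooth_on V \<Psi> \<and>
        \<Phi> ` U = V \<and> (\<forall>x\<in>U. \<Psi> (\<Phi> x) = x) \<and> (\<forall>y\<in>V. \<Phi> (\<Psi> y) = y) \<and>
        subspace S \<and> dim S = dim ?S \<and> \<Phi> ` (U \<inter> orthogonal_group) = V \<inter> S"
      by (intro exI)
  qed
qed

section \<open>The matrix exponential and tangent spaces\<close>

lemma matrix_pow_scaleR: "matrix_pow (t *\<^sub>R A) k = t ^ k *\<^sub>R matrix_pow A k"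
  by (induction k) (simp_all add: matrix_algebra mult.commute)

lemma matrix_pow_commute: "A ** matrix_pow A k = matrix_pow A k ** A"
proof (induction k)
  case (Suc k)
  then have "A ** (A ** matrix_pow A k) = A ** (matrix_pow A k ** A)" by simp
  then show ?case by (simp add: matrix_mul_assoc)
qed simp

text \<open>Comparison with the real exponential series of \<open>norm A * K\<close>, where
  \<open>K\<close> is a bound for the bilinear matrix product and \<open>norm (mat 1)\<close>
  accounts for the zeroth power.\<close>

lemma summable_matrix_exp: "summable (\<lambda>k. (1 / fact k) *\<^sub>R matrix_pow A k)" for A :: "real^'n^'n"
proof -
  obtain K where K: "K > 0" "\<And>(B :: real^'n^'n) (C :: real^'n^'n). norm (B ** C) \<le> norm B * norm C * K"
    using bounded_bilinear.pos_bounded[OF bounded_bilinear_matrix_mult] by blast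
  have pow: "norm (matrix_pow A k) \<le> norm (mat 1 :: real^'n^'n) * (norm A * K) ^ k" for k
  proof (induction k)
    case (Suc k)
    have "norm (matrix_pow A (Suc k)) \<le> norm A * norm (matrix_pow A k) * K"
      using K(2)[of A "matrix_pow A k"] by simp
    also have "\<dots> \<le> norm A * (norm (mat 1 :: real^'n^'n) * (norm A * K) ^ k) * K"
      using Suc K(1) by (intro mult_left_mono mult_right_mono) auto
    finally show ?case by (simp add: mult_ac)
  qed simp
  have "summable (\<lambda>k. norm (mat 1 :: real^'n^'n) * (inverse (fact k) * (norm A * K) ^ k))"
    by (intro summable_mult summable_exp)
  then show ?thesis
  proof (rule summable_comparison_test')
    show "norm ((1 / fact k) *\<^sub>R matrix_pow A k) \<le> norm (mat 1 :: real^'n^'n) * (inverse (fact k) * (norm A * K) ^ k)" for k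
      using mult_left_mono[OF pow[of k], of "inverse (fact k)"] by (simp add: divide_inverse mult_ac)
  qed
qed

text \<open>Termwise evaluation of the series. It is used for single entries, which are real power
  series in \<open>t\<close>, and for multiplication by a fixed matrix from either side.\<close>

lemma bounded_linear_matrix_exp:
  fixes L :: "real^'n^'n \<Rightarrow> 'b::real_normed_vector"
  assumes "bounded_linear L"
  shows "L (matrix_exp A) = (\<Sum>k. (1 / fact k) *\<^sub>R L (matrix_pow A k))"
    "summable (\<lambda>k. (1 / fact k) *\<^sub>R L (matrix_pow A k))"
  using bounded_linear.suminf[OF assms summable_matrix_exp, of A]
    bounded_linear.summable[OF assms summable_matrix_exp, of A]
  by (simp_all add: matrix_exp_def linear_cmul[OF bounded_linear.linear[OF assms]])

lemma matrix_exp_scaleR_commute: "A ** matrix_exp (t *\<^sub>R A) = matrix_exp (t *\<^sub>R A) ** A" for A :: "real^'n^'n"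
  using bounded_linear_matrix_exp(1)[OF bounded_bilinear.bounded_linear_right[OF bounded_bilinear_matrix_mult], of A "t *\<^sub>R A"]
    bounded_linear_matrix_exp(1)[OF bounded_bilinear.bounded_linear_left[OF bounded_bilinear_matrix_mult], of "t *\<^sub>R A" A]
  by (simp add: matrix_pow_commute matrix_pow_scaleR matrix_algebra)

lemma matrix_exp_0: "matrix_exp (0 :: real^'n^'n) = mat 1"
proof -
  have "matrix_pow (0 :: real^'n^'n) k = (if k = 0 then mat 1 else 0)" for k by (cases k) auto
  then have "(\<lambda>k. (1 / fact k) *\<^sub>R matrix_pow (0 :: real^'n^'n) k) = (\<lambda>k. if k = 0 then mat 1 else 0)" by auto
  then show ?thesis
    unfolding matrix_exp_def using sums_unique[OF sums_single[of 0 "\<lambda>_. mat 1 :: real^'n^'n"]] by metis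
qed

lemma has_vector_derivative_matrix_exp:
  fixes A :: "real^'n^'n"
  shows "((\<lambda>t. matrix_exp (t *\<^sub>R A)) has_vector_derivative A ** matrix_exp (t *\<^sub>R A)) (at t)"
proof -
  have entry: "((\<lambda>t. matrix_exp (t *\<^sub>R A) $ i $ j) has_real_derivative (A ** matrix_exp (t *\<^sub>R A)) $ i $ j) (at t)" for i j
  proof -
    define c where "c k = matrix_pow A k $ i $ j / fact k" for k
    have "(1 / fact k) *\<^sub>R matrix_pow (t *\<^sub>R A) k $ i $ j = c k * t ^ k" for k t
      by (simp add: c_def matrix_pow_scaleR)
    then have ex: "matrix_exp (t *\<^sub>R A) $ i $ j = (\<Sum>k. c k * t ^ k)" "summable (\<lambda>k. c k * t ^ k)" for t
      using bounded_linear_matrix_exp[OF bounded_linear_matrix_entry[of i j], of "t *\<^sub>R A"] by simp_all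
    have lin: "bounded_linear (\<lambda>B. (A ** B) $ i $ j)"
      by (rule bounded_linear_compose[OF bounded_linear_matrix_entry
            bounded_bilinear.bounded_linear_right[OF bounded_bilinear_matrix_mult]])
    have "(1 / fact k) *\<^sub>R (A ** matrix_pow (t *\<^sub>R A) k) $ i $ j = diffs c k * t ^ k" for k
    proof -
      have "(A ** matrix_pow (t *\<^sub>R A) k) $ i $ j = t ^ k * matrix_pow A (Suc k) $ i $ j"
        by (simp add: matrix_pow_scaleR matrix_algebra)
      \<comment> \<open>The factor \<open>Suc k\<close> of \<open>diffs\<close> cancels against
        \<open>fact (Suc k)\<close>, leaving the coefficient of the series for
        \<open>A ** matrix_exp\<close>.\<close>
      moreover have "diffs c k = matrix_pow A (Suc k) $ i $ j / fact k"
        by (simp add: diffs_def c_def del: matrix_pow.simps of_nat_Suc)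
      ultimately show ?thesis by simp
    qed
    then have "(A ** matrix_exp (t *\<^sub>R A)) $ i $ j = (\<Sum>k. diffs c k * t ^ k)"
      using bounded_linear_matrix_exp(1)[OF lin, of "t *\<^sub>R A"] by simp
    then show ?thesis
      unfolding ex(1) using termdiffs_strong_converges_everywhere[OF ex(2)] by simp
  qed
  have "((\<lambda>t. matrix_exp (t *\<^sub>R A)) has_derivative (\<lambda>h. h *\<^sub>R (A ** matrix_exp (t *\<^sub>R A)))) (at t)"
  proof (rule iffD2[OF has_derivative_componentwise_within[of _ _ _ UNIV]], rule ballI)
    fix b :: "real^'n^'n" assume "b \<in> Basis"
    then obtain i j where b: "b = axis i (axis j 1)" by (auto simp: Basis_vec_def)
    have "(*) ((A ** matrix_exp (t *\<^sub>R A)) $ i $ j) = (\<lambda>h. (h *\<^sub>R (A ** matrix_exp (t *\<^sub>R A))) \<bullet> b)"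
      by (auto simp: b inner_axis)
    with entry[of i j] show "((\<lambda>t. matrix_exp (t *\<^sub>R A) \<bullet> b) has_derivative
        (\<lambda>h. (h *\<^sub>R (A ** matrix_exp (t *\<^sub>R A))) \<bullet> b)) (at t)"
      by (simp add: has_field_derivative_def b inner_axis)
  qed
  then show ?thesis by (simp add: has_vector_derivative_def)
qed

text \<open>The equation E' = A E bootstraps: if E is of class \<open>k\<close>, then so is its
  derivative, and E gains one order.\<close>

lemma smooth_on_matrix_exp: "smooth_on UNIV (\<lambda>t. B ** matrix_exp (t *\<^sub>R A))" for A B :: "real^'n^'n"
proof -
  have "Ck_on k UNIV (\<lambda>t. matrix_exp (t *\<^sub>R A))" for k
  proof (induction k)
    case 0
    show ?case
      using has_vector_derivative_continuous[OF has_vector_derivative_matrix_exp[of A]]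
      by (simp add: continuous_on_eq_continuous_at)
  next
    case (Suc k)
    show ?case
    proof (rule Ck_on_SucI[OF open_UNIV])
      show "((\<lambda>t. matrix_exp (t *\<^sub>R A)) has_derivative (\<lambda>h. h *\<^sub>R (A ** matrix_exp (t *\<^sub>R A)))) (at t)" for t
        using has_vector_derivative_matrix_exp has_vector_derivative_def by blast
      show "Ck_on k UNIV (\<lambda>t. h *\<^sub>R (A ** matrix_exp (t *\<^sub>R A)))" for h
        by (intro Ck_on_bounded_linear[OF bounded_linear_scaleR_right]
            Ck_on_bounded_linear[OF bounded_bilinear.bounded_linear_right[OF bounded_bilinear_matrix_mult]]
            open_UNIV Suc)
    qed
  qed
  then show ?thesis
    by (intro smooth_on_bounded_linear[OF bounded_bilinear.bounded_linear_right[OF bounded_bilinear_matrix_mult]])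
      (auto simp: smooth_on_def)
qed

lemma has_vector_derivative_matrix_mult:
  assumes "(f has_vector_derivative f') (at x within s)" "(g has_vector_derivative g') (at x within s)"
  shows "((\<lambda>x. f x ** g x :: real^'n^'n) has_vector_derivative (f x ** g' + f' ** g x)) (at x within s)"
  using bounded_bilinear.has_vector_derivative[OF bounded_bilinear_matrix_mult assms] .

lemma has_vector_derivative_transpose:
  assumes "(f has_vector_derivative f') F"
  shows "((\<lambda>x. transpose (f x) :: real^'n^'n) has_vector_derivative transpose f') F"
  using bounded_linear.has_vector_derivative[OF bounded_linear_transpose assms] .

lemma has_vector_derivative_zero_eq:
  fixes f :: "real \<Rightarrow> 'a::real_normed_vector"
  assumes "convex S" "\<And>x. x \<in> S \<Longrightarrow> (f has_vector_derivative 0) (at x within S)" "x \<in> S" "y \<in> S"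
  shows "f x = f y"
  by (rule has_derivative_zero_unique[OF assms(1) _ assms(3,4)])
    (use assms(2) in \<open>simp add: has_vector_derivative_def\<close>)

text \<open>For E = exp(tA) the derivative of E^T E is E^T (A + A^T) E = 0, and its value at 0 is
  the identity.\<close>

lemma matrix_exp_orthogonal:
  assumes "skew_symmetric (A :: real^'n^'n)"
  shows "matrix_exp (t *\<^sub>R A) \<in> orthogonal_group"
proof -
  let ?E = "\<lambda>t. matrix_exp (t *\<^sub>R A)"
  have "((\<lambda>t. transpose (?E t) ** ?E t) has_vector_derivative 0) (at s within UNIV)" if "s \<in> UNIV" for s
  proof -
    have "((\<lambda>t. transpose (?E t) ** ?E t) has_vector_derivative
        (transpose (?E s) ** (A ** ?E s) + transpose (A ** ?E s) ** ?E s)) (at s)"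
      by (intro has_vector_derivative_matrix_mult has_vector_derivative_transpose
          has_vector_derivative_matrix_exp)
    moreover have "transpose (?E s) ** (A ** ?E s) + transpose (A ** ?E s) ** ?E s = 0"
      using assms by (simp add: skew_symmetric_def transpose_algebra matrix_algebra)
    ultimately show ?thesis by simp
  qed
  from has_vector_derivative_zero_eq[OF convex_UNIV this, of t 0]
  have "transpose (?E t) ** ?E t = mat 1" by (simp add: matrix_exp_0)
  then show ?thesis by (simp add: orthogonal_group_def orthogonal_matrix)
qed

text \<open>E^T is the inverse of E = exp(tA), and \<gamma> E^T has derivative 0; on an interval it
  is a constant, which is \<open>G\<close>.\<close>

lemma matrix_ode_solution:
  fixes A :: "real^'n^'n" and \<gamma> :: "real \<Rightarrow> real^'n^'n"
  assumes "skew_symmetric A" "open I" "is_interval I"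
    "\<And>t. t \<in> I \<Longrightarrow> (\<gamma> has_vector_derivative \<gamma> t ** A) (at t)"
  obtains G where "\<And>t. t \<in> I \<Longrightarrow> \<gamma> t = G ** matrix_exp (t *\<^sub>R A)"
proof -
  let ?E = "\<lambda>t. matrix_exp (t *\<^sub>R A)"
  have At: "transpose A = - A" using assms(1) by (simp add: skew_symmetric_def)
  have "((\<lambda>t. \<gamma> t ** transpose (?E t)) has_vector_derivative 0) (at s within I)" if "s \<in> I" for s
  proof -
    have "((\<lambda>t. \<gamma> t ** transpose (?E t)) has_vector_derivative
        (\<gamma> s ** transpose (A ** ?E s) + \<gamma> s ** A ** transpose (?E s))) (at s)"
      by (intro has_vector_derivative_matrix_mult has_vector_derivative_transpose
          has_vector_derivative_matrix_exp assms(4) that)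
    \<comment> \<open>\<open>A\<close> commutes with its exponential, so after transposition it
      stands next to \<open>\<gamma> s\<close> and cancels the other term.\<close>
    moreover have "transpose (A ** ?E s) = - (A ** transpose (?E s))"
      unfolding matrix_exp_scaleR_commute by (simp add: transpose_algebra At matrix_algebra)
    ultimately have "((\<lambda>t. \<gamma> t ** transpose (?E t)) has_vector_derivative 0) (at s)"
      by (simp add: matrix_algebra)
    then show ?thesis by (rule has_vector_derivative_at_within)
  qed
  then have const: "\<gamma> t ** transpose (?E t) = \<gamma> s ** transpose (?E s)" if "t \<in> I" "s \<in> I" for s t
    using has_vector_derivative_zero_eq[OF is_interval_convex[OF assms(3)]] that by blast
  show thesis
  proof (cases "I = {}")
    case False
    then obtain s where "s \<in> I" by blast
    show thesis
    proof (rule that)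
      fix t assume "t \<in> I"
      from const[OF this \<open>s \<in> I\<close>]
      have "\<gamma> t ** transpose (?E t) ** ?E t = \<gamma> s ** transpose (?E s) ** ?E t" by simp
      then show "\<gamma> t = (\<gamma> s ** transpose (?E s)) ** ?E t"
        by (simp add: orthogonal_group_cancel(3)[OF matrix_exp_orthogonal[OF assms(1)]])
    qed
  qed (use that in auto)
qed

text \<open>Differentiation of the constant
  \<open>transpose (\<gamma> s) ** \<gamma> s\<close>.\<close>

lemma curve_velocity_skew:
  fixes \<gamma> :: "real \<Rightarrow> real^'n^'n"
  assumes "open I" "t \<in> I" "\<gamma> ` I \<subseteq> orthogonal_group" "(\<gamma> has_vector_derivative v) (at t)"
  shows "skew_symmetric (transpose (\<gamma> t) ** v)"
proof -
  have "((\<lambda>s. transpose (\<gamma> s) ** \<gamma> s) has_vector_derivative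
      (transpose (\<gamma> t) ** v + transpose v ** \<gamma> t)) (at t)"
    by (intro has_vector_derivative_matrix_mult has_vector_derivative_transpose assms(4))
  moreover have "((\<lambda>s. transpose (\<gamma> s) ** \<gamma> s) has_vector_derivative 0) (at t)"
    by (rule has_vector_derivative_transform_within_open[OF has_vector_derivative_const[of "mat 1"] assms(1,2)])
      (use assms(3) in \<open>auto simp: orthogonal_groupD\<close>)
  ultimately have "transpose (\<gamma> t) ** v + transpose v ** \<gamma> t = 0"
    by (rule vector_derivative_unique_at)
  then show ?thesis
    by (simp add: skew_symmetric_def transpose_algebra eq_neg_iff_add_eq_0 add.commute)
qed

lemma tangent_space_orthogonal_group:
  assumes "p \<in> orthogonal_group"
  shows "v \<in> tangent_space orthogonal_group p \<longleftrightarrow> skew_symmetric (transpose p ** v :: real^'n^'n)"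
proof
  assume "v \<in> tangent_space orthogonal_group p"
  then obtain \<gamma> \<epsilon> where "\<epsilon> > 0" "\<gamma> ` {-\<epsilon><..<\<epsilon>} \<subseteq> orthogonal_group" "\<gamma> 0 = p"
    "(\<gamma> has_vector_derivative v) (at 0)"
    unfolding tangent_space_def by auto
  then show "skew_symmetric (transpose p ** v)"
    using curve_velocity_skew[of "{-\<epsilon><..<\<epsilon>}" 0 \<gamma> v] by auto
next
  assume skew: "skew_symmetric (transpose p ** v)"
  \<comment> \<open>The one-parameter subgroup of the skew matrix, translated to \<open>p\<close>,
    realises the velocity \<open>v\<close>.\<close>
  define \<gamma> where "\<gamma> t = p ** matrix_exp (t *\<^sub>R (transpose p ** v))" for t
  have "(\<gamma> has_vector_derivative p ** (transpose p ** v ** matrix_exp (0 *\<^sub>R (transpose p ** v)))) (at 0)"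
    unfolding \<gamma>_def
    by (intro bounded_linear.has_vector_derivative[OF bounded_bilinear.bounded_linear_right
          [OF bounded_bilinear_matrix_mult]] has_vector_derivative_matrix_exp)
  then have "(\<gamma> has_vector_derivative v) (at 0)"
    by (simp add: matrix_exp_0 orthogonal_group_cancel[OF assms])
  moreover have "smooth_on {-1<..<1} \<gamma>"
    unfolding \<gamma>_def by (rule smooth_on_subset[OF smooth_on_matrix_exp]) simp
  moreover have "\<gamma> ` {-1<..<1} \<subseteq> orthogonal_group"
    unfolding \<gamma>_def using orthogonal_group_mult[OF assms matrix_exp_orthogonal[OF skew]] by auto
  moreover have "\<gamma> 0 = p" by (simp add: \<gamma>_def matrix_exp_0)
  ultimately show "v \<in> tangent_space orthogonal_group p"
    unfolding tangent_space_def by (auto intro!: exI[of _ \<gamma>] exI[of _ 1])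
qed

section \<open>The Levi-Civita connection of the orthogonal group\<close>

abbreviation (input) "OG \<equiv> orthogonal_group"

definition commutator :: "real^'n^'n \<Rightarrow> real^'n^'n \<Rightarrow> real^'n^'n" where
  "commutator A B = A ** B - B ** A"

text \<open>The left Maurer-Cartan form applied to \<open>X\<close>: on the group,
  \<open>transpose x\<close> is the inverse of \<open>x\<close>. The transpose keeps the expression
  linear in \<open>x\<close> off the group too, so smoothness is immediate.\<close>

definition body :: "(real^'n^'n \<Rightarrow> real^'n^'n) \<Rightarrow> real^'n^'n \<Rightarrow> real^'n^'n" where
  "body X x = transpose x ** X x"

text \<open>The fields with constant \<open>body\<close>. With \<open>A = transpose p ** v\<close>
  such a field extends a single tangent vector \<open>v\<close> at \<open>p\<close> to the whole
  group.\<close>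

definition left_invariant :: "real^'n^'n \<Rightarrow> real^'n^'n \<Rightarrow> real^'n^'n" where
  "left_invariant A x = x ** A"

lemma bounded_bilinear_commutator: "bounded_bilinear (commutator :: real^'n^'n \<Rightarrow> real^'n^'n \<Rightarrow> real^'n^'n)"
  unfolding bilinear_conv_bounded_bilinear[symmetric] bilinear_def
  by (auto intro!: linearI simp: commutator_def matrix_algebra algebra_simps)

lemmas commutator_algebra =
  bounded_bilinear.add_left[OF bounded_bilinear_commutator]
  bounded_bilinear.add_right[OF bounded_bilinear_commutator]
  bounded_bilinear.diff_left[OF bounded_bilinear_commutator]
  bounded_bilinear.diff_right[OF bounded_bilinear_commutator]
  bounded_bilinear.scaleR_left[OF bounded_bilinear_commutator]
  bounded_bilinear.scaleR_right[OF bounded_bilinear_commutator]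

lemma commutator_swap: "commutator A B = - commutator B A"
  by (simp add: commutator_def)

lemma skew_symmetric_commutator:
  "skew_symmetric A \<Longrightarrow> skew_symmetric B \<Longrightarrow> skew_symmetric (commutator A B)"
  by (simp add: skew_symmetric_def commutator_def transpose_algebra matrix_algebra)

lemma skew_symmetric_add: "skew_symmetric A \<Longrightarrow> skew_symmetric B \<Longrightarrow> skew_symmetric (A + B)"
  and skew_symmetric_diff: "skew_symmetric A \<Longrightarrow> skew_symmetric B \<Longrightarrow> skew_symmetric (A - B)"
  and skew_symmetric_scaleR: "skew_symmetric A \<Longrightarrow> skew_symmetric (c *\<^sub>R A)"
  by (simp_all add: skew_symmetric_def transpose_algebra)

lemmas skew_symmetric_intros =
  skew_symmetric_add skew_symmetric_diff skew_symmetric_scaleR skew_symmetric_commutator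

lemma inner_matrix_mult_right: "(V ** A) \<bullet> W = V \<bullet> (W ** transpose A)" for A V W :: "real^'n^'n"
  using inner_matrix_mult_left[of "transpose A" "transpose V" "transpose W"]
  by (metis inner_transpose matrix_transpose_mul transpose_transpose)

text \<open>Transposing the skew \<open>A\<close> only changes its sign on either side of a product.
  This infinitesimal form of bi-invariance makes the half commutator compatible with the metric and
  gives the curvature its sign.\<close>

lemma inner_commutator:
  assumes "skew_symmetric A"
  shows "commutator A B \<bullet> C = - (B \<bullet> commutator A C)"
  using assms
  by (simp add: commutator_def skew_symmetric_def inner_diff_left inner_diff_right
      inner_matrix_mult_left[of A] inner_matrix_mult_right[of B A] matrix_algebra)

lemma inner_orthogonal_group:
  "p \<in> OG \<Longrightarrow> (p ** V) \<bullet> (p ** W) = V \<bullet> W" for V W :: "real^'n^'n"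
  by (simp add: inner_matrix_mult_left orthogonal_group_cancel)

lemma tangent_spaceI: "p \<in> OG \<Longrightarrow> skew_symmetric A \<Longrightarrow> p ** A \<in> tangent_space OG p"
  by (simp add: tangent_space_orthogonal_group orthogonal_group_cancel)

lemma smooth_map_on_body:
  assumes "smooth_map_on M X"
  shows "smooth_map_on M (body X)"
  using smooth_map_on_bilinear[OF bounded_bilinear_matrix_mult
      smooth_map_on_bounded_linear[OF bounded_linear_transpose smooth_map_on_id] assms]
  by (simp add: body_def[abs_def])

lemma body_skew: "X \<in> vector_fields OG \<Longrightarrow> p \<in> OG \<Longrightarrow> skew_symmetric (body X p)"
  using vector_fieldsD(2) tangent_space_orthogonal_group body_def by metis

lemma body_cancel: "p \<in> OG \<Longrightarrow> p ** body X p = X p"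
  by (simp add: body_def orthogonal_group_cancel)

lemma vector_fieldsI:
  assumes "smooth_map_on OG A" "\<And>p. p \<in> OG \<Longrightarrow> skew_symmetric (A p)" "\<And>p. p \<in> OG \<Longrightarrow> X p = p ** A p"
  shows "X \<in> vector_fields (OG :: (real^'n^'n) set)"
proof -
  have "smooth_map_on OG X"
    by (rule smooth_map_on_cong[OF smooth_map_on_bilinear[OF bounded_bilinear_matrix_mult smooth_map_on_id assms(1)]])
      (simp add: assms(3))
  then show ?thesis using assms tangent_spaceI by (auto simp: vector_fields_def)
qed

lemma left_invariant_vector_field:
  "skew_symmetric A \<Longrightarrow> left_invariant A \<in> vector_fields OG"
  by (rule vector_fieldsI[where A = "\<lambda>_. A"]) (auto simp: smooth_map_on_const left_invariant_def)

text \<open>The values of \<open>body Y\<close> on the group satisfy a linear equation, hence so do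
  its derivatives along the group.\<close>

lemma differential_body_skew:
  assumes "Y \<in> vector_fields OG" "p \<in> OG" "v \<in> tangent_space OG p"
  shows "skew_symmetric (differential OG (body Y) p v)"
proof -
  note sm = smooth_map_on_body[OF vector_fieldsD(1)[OF assms(1)]]
  have "transpose (differential OG (body Y) p v) = differential OG (\<lambda>x. transpose (body Y x)) p v"
    by (rule differential_bounded_linear[OF bounded_linear_transpose sm assms(2,3), symmetric])
  also have "\<dots> = differential OG (\<lambda>x. - body Y x) p v"
    by (rule differential_cong[OF assms(2)])
      (use body_skew[OF assms(1)] in \<open>simp add: skew_symmetric_def\<close>)
  also have "\<dots> = - differential OG (body Y) p v"
    by (rule differential_bounded_linear[OF bounded_linear_minus[OF bounded_linear_ident] sm assms(2,3)])
  finally show ?thesis by (simp add: skew_symmetric_def)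
qed

lemma differential_body:
  assumes "Y \<in> vector_fields OG" "p \<in> OG" "v \<in> tangent_space OG p"
  shows "differential OG Y p v = p ** (transpose p ** v ** body Y p + differential OG (body Y) p v)"
proof -
  have "differential OG Y p v = differential OG (\<lambda>x. x ** body Y x) p v"
    by (rule differential_cong[OF assms(2)]) (simp add: body_cancel)
  also have "\<dots> = p ** differential OG (body Y) p v + differential OG (\<lambda>x. x) p v ** body Y p"
    by (rule differential_bilinear[OF bounded_bilinear_matrix_mult smooth_map_on_id
          smooth_map_on_body[OF vector_fieldsD(1)[OF assms(1)]] assms(2,3)])
  finally show ?thesis
    by (simp add: differential_ident[OF assms(3)] matrix_add_ldistrib orthogonal_group_cancel[OF assms(2)]
        matrix_mul_assoc orthogonal_groupD[OF assms(2)])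
qed

lemma lie_bracket_body:
  assumes "X \<in> vector_fields OG" "Y \<in> vector_fields OG" "p \<in> OG"
  shows "lie_bracket OG X Y p = p ** (commutator (body X p) (body Y p)
     + differential OG (body Y) p (X p) - differential OG (body X) p (Y p))"
  unfolding lie_bracket_def
    differential_body[OF assms(2,3) vector_fieldsD(2)[OF assms(1,3)]]
    differential_body[OF assms(1,3) vector_fieldsD(2)[OF assms(2,3)]]
  by (simp add: commutator_def matrix_algebra body_def algebra_simps)

lemma smooth_map_on_differential_body:
  "X \<in> vector_fields M \<Longrightarrow> Y \<in> vector_fields M \<Longrightarrow> smooth_map_on M (\<lambda>x. differential M (body Y) x (X x))"
  by (intro smooth_map_on_differential smooth_map_on_body vector_fieldsD(1))

lemma smooth_map_on_commutator_body:
  "X \<in> vector_fields M \<Longrightarrow> Y \<in> vector_fields M \<Longrightarrow> smooth_map_on M (\<lambda>x. commutator (body X x) (body Y x))"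
  by (intro smooth_map_on_bilinear[OF bounded_bilinear_commutator] smooth_map_on_body vector_fieldsD(1))

text \<open>A difference of ambient derivatives need not look tangent; tangency is read off from
  \<open>lie_bracket_body\<close>, where \<open>p\<close> multiplies a skew matrix.\<close>

lemma lie_bracket_vector_field:
  assumes "X \<in> vector_fields OG" "Y \<in> vector_fields OG"
  shows "lie_bracket OG X Y \<in> vector_fields OG"
  by (rule vector_fieldsI[OF _ _ lie_bracket_body[OF assms]])
    (use assms in \<open>auto intro!: smooth_map_on_add smooth_map_on_diff smooth_map_on_differential_body
      smooth_map_on_commutator_body skew_symmetric_intros body_skew differential_body_skew vector_fieldsD(2)\<close>)

text \<open>The derivative of \<open>body Y\<close> alone gives the flat connection for which
  left-invariant fields are parallel. Its torsion is minus the commutator of the bodies; the half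
  commutator removes it and respects the metric.\<close>

definition nabla :: "(real^'n^'n \<Rightarrow> real^'n^'n) \<Rightarrow> (real^'n^'n \<Rightarrow> real^'n^'n) \<Rightarrow> real^'n^'n \<Rightarrow> real^'n^'n" where
  "nabla X Y p = p ** ((1/2) *\<^sub>R commutator (body X p) (body Y p) + differential OG (body Y) p (X p))"

lemma nabla_vector_field:
  assumes "X \<in> vector_fields OG" "Y \<in> vector_fields OG"
  shows "nabla X Y \<in> vector_fields OG"
  by (rule vector_fieldsI[OF _ _ nabla_def])
    (use assms in \<open>auto intro!: smooth_map_on_add smooth_map_on_bounded_linear[OF bounded_linear_scaleR_right]
      smooth_map_on_differential_body
      smooth_map_on_commutator_body skew_symmetric_intros body_skew differential_body_skew vector_fieldsD(2)\<close>)

lemma nabla_torsion_free: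
  assumes "X \<in> vector_fields OG" "Y \<in> vector_fields OG" "p \<in> OG"
  shows "nabla X Y p - nabla Y X p = lie_bracket OG X Y p"
proof -
  have "(1/2) *\<^sub>R commutator (body X p) (body Y p) - (1/2) *\<^sub>R commutator (body Y p) (body X p) =
      commutator (body X p) (body Y p)"
    unfolding commutator_swap[of "body Y p"] by (simp flip: scaleR_left_distrib)
  then show ?thesis
    unfolding lie_bracket_body[OF assms] nabla_def
      bounded_bilinear.diff_right[OF bounded_bilinear_matrix_mult, symmetric]
    by (intro arg_cong[where f = "(**) p"]) (simp add: algebra_simps)
qed

lemma nabla_metric:
  assumes "X \<in> vector_fields OG" "Y \<in> vector_fields OG" "Z \<in> vector_fields OG" "p \<in> OG"
  shows "differential OG (\<lambda>x. frobenius_metric x (Y x) (Z x)) p (X p) =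
    frobenius_metric p (nabla X Y p) (Z p) + frobenius_metric p (Y p) (nabla X Z p)"
proof -
  have "differential OG (\<lambda>x. frobenius_metric x (Y x) (Z x)) p (X p) =
      differential OG (\<lambda>x. body Y x \<bullet> body Z x) p (X p)"
    by (rule differential_cong[OF assms(4)])
      (metis body_cancel frobenius_metric_inner inner_orthogonal_group)
  also have "\<dots> = body Y p \<bullet> differential OG (body Z) p (X p) + differential OG (body Y) p (X p) \<bullet> body Z p"
    by (rule differential_bilinear[OF bounded_bilinear_inner smooth_map_on_body smooth_map_on_body])
      (use assms vector_fieldsD in blast)+
  \<comment> \<open>The two inserted half commutators cancel by skew-adjointness.\<close>
  also have "\<dots> = ((1/2) *\<^sub>R commutator (body X p) (body Y p) + differential OG (body Y) p (X p)) \<bullet> body Z p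
      + body Y p \<bullet> ((1/2) *\<^sub>R commutator (body X p) (body Z p) + differential OG (body Z) p (X p))"
    using inner_commutator[OF body_skew[OF assms(1,4)], of "body Y p" "body Z p"]
    by (simp add: inner_add_left inner_add_right)
  also have "\<dots> = nabla X Y p \<bullet> Z p + Y p \<bullet> nabla X Z p"
    unfolding nabla_def
    using inner_orthogonal_group[OF assms(4)] body_cancel[OF assms(4)] by metis
  finally show ?thesis by (simp add: frobenius_metric_inner)
qed

lemma affine_connection_nabla: "affine_connection OG (nabla :: (real^'n^'n \<Rightarrow> real^'n^'n) \<Rightarrow> _)"
  unfolding affine_connection_def
proof (intro conjI ballI allI impI)
  fix X Y Z :: "real^'n^'n \<Rightarrow> real^'n^'n" and f h :: "real^'n^'n \<Rightarrow> real" and p :: "real^'n^'n"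
  assume "X \<in> vector_fields OG" "Y \<in> vector_fields OG"
  then show "nabla X Y \<in> vector_fields OG" by (rule nabla_vector_field)
next
  fix X Y Z :: "real^'n^'n \<Rightarrow> real^'n^'n" and f h :: "real^'n^'n \<Rightarrow> real" and p :: "real^'n^'n"
  assume X: "X \<in> vector_fields OG" and Y: "Y \<in> vector_fields OG" and Z: "Z \<in> vector_fields OG" and p: "p \<in> OG"
  have lin: "linear (differential OG (body Z) p)"
    by (rule differential_linear[OF smooth_map_on_body[OF vector_fieldsD(1)[OF Z]] p])
  have "body (\<lambda>x. f x *\<^sub>R X x + h x *\<^sub>R Y x) p = f p *\<^sub>R body X p + h p *\<^sub>R body Y p"
    by (simp add: body_def matrix_algebra)
  then show "nabla (\<lambda>x. f x *\<^sub>R X x + h x *\<^sub>R Y x) Z p = f p *\<^sub>R nabla X Z p + h p *\<^sub>R nabla Y Z p"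
    by (simp add: nabla_def linear_add[OF lin] linear_cmul[OF lin] commutator_algebra matrix_algebra algebra_simps)
next
  fix X Y Z :: "real^'n^'n \<Rightarrow> real^'n^'n" and p :: "real^'n^'n"
  assume X: "X \<in> vector_fields OG" and Y: "Y \<in> vector_fields OG" and Z: "Z \<in> vector_fields OG" and p: "p \<in> OG"
  have "body (\<lambda>x. Y x + Z x) = (\<lambda>x. body Y x + body Z x)"
    by (simp add: body_def[abs_def] matrix_algebra)
  moreover have "differential OG (\<lambda>x. body Y x + body Z x) p (X p) =
      differential OG (body Y) p (X p) + differential OG (body Z) p (X p)"
    using X Y Z p by (intro differential_add smooth_map_on_body vector_fieldsD)
  ultimately show "nabla X (\<lambda>x. Y x + Z x) p = nabla X Y p + nabla X Z p"
    by (simp add: nabla_def commutator_algebra matrix_algebra algebra_simps)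
next
  fix X Y :: "real^'n^'n \<Rightarrow> real^'n^'n" and f :: "real^'n^'n \<Rightarrow> real" and p :: "real^'n^'n"
  assume X: "X \<in> vector_fields OG" and Y: "Y \<in> vector_fields OG" and f: "smooth_map_on OG f" and p: "p \<in> OG"
  have "body (\<lambda>x. f x *\<^sub>R Y x) = (\<lambda>x. f x *\<^sub>R body Y x)"
    by (simp add: body_def[abs_def] matrix_algebra)
  moreover have "differential OG (\<lambda>x. f x *\<^sub>R body Y x) p (X p) =
      f p *\<^sub>R differential OG (body Y) p (X p) + differential OG f p (X p) *\<^sub>R body Y p"
    using X Y p f by (intro differential_bilinear[OF bounded_bilinear_scaleR] smooth_map_on_body vector_fieldsD)
  ultimately have "nabla X (\<lambda>x. f x *\<^sub>R Y x) p = f p *\<^sub>R nabla X Y p + differential OG f p (X p) *\<^sub>R (p ** body Y p)"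
    by (simp add: nabla_def commutator_algebra matrix_algebra algebra_simps)
  then show "nabla X (\<lambda>x. f x *\<^sub>R Y x) p = f p *\<^sub>R nabla X Y p + differential OG f p (X p) *\<^sub>R Y p"
    by (simp add: body_cancel[OF p])
qed

lemma is_levi_civita_nabla: "is_levi_civita OG frobenius_metric (nabla :: (real^'n^'n \<Rightarrow> real^'n^'n) \<Rightarrow> _)"
  unfolding is_levi_civita_def
  using affine_connection_nabla nabla_torsion_free nabla_metric by blast

text \<open>The difference of two Levi-Civita connections is symmetric in its two arguments and
  skew-adjoint in the second one, hence vanishes.\<close>

lemma is_levi_civita_unique:
  fixes D :: "(real^'n^'n \<Rightarrow> real^'n^'n) \<Rightarrow> (real^'n^'n \<Rightarrow> real^'n^'n) \<Rightarrow> real^'n^'n \<Rightarrow> real^'n^'n"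
  assumes D: "is_levi_civita OG frobenius_metric D"
    and X: "X \<in> vector_fields OG" and Y: "Y \<in> vector_fields OG" and p: "p \<in> OG"
  shows "D X Y p = nabla X Y p"
proof -
  define T where "T X Y Z = (D X Y p - nabla X Y p) \<bullet> Z p" for X Y Z
  have tor: "D X Y p - D Y X p = lie_bracket OG X Y p"
    if "X \<in> vector_fields OG" "Y \<in> vector_fields OG" for X Y
    using D that p unfolding is_levi_civita_def by blast
  have met: "differential OG (\<lambda>x. frobenius_metric x (Y x) (Z x)) p (X p) =
      frobenius_metric p (D X Y p) (Z p) + frobenius_metric p (Y p) (D X Z p)"
    if "X \<in> vector_fields OG" "Y \<in> vector_fields OG" "Z \<in> vector_fields OG" for X Y Z
    using D that p unfolding is_levi_civita_def by blast
  have sym: "T X Y Z = T Y X Z" if "X \<in> vector_fields OG" "Y \<in> vector_fields OG" for X Y Z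
  proof -
    have "D X Y p - D Y X p = nabla X Y p - nabla Y X p"
      using tor[OF that] nabla_torsion_free[OF that p] by simp
    then have "D X Y p - nabla X Y p = D Y X p - nabla Y X p" by (simp add: algebra_simps)
    then show ?thesis by (simp add: T_def)
  qed
  have skew: "T X Y Z = - T X Z Y"
    if "X \<in> vector_fields OG" "Y \<in> vector_fields OG" "Z \<in> vector_fields OG" for X Y Z
  proof -
    have "D X Y p \<bullet> Z p + Y p \<bullet> D X Z p = nabla X Y p \<bullet> Z p + Y p \<bullet> nabla X Z p"
      using met[OF that] nabla_metric[OF that p] unfolding frobenius_metric_inner by simp
    then show ?thesis by (simp add: T_def inner_diff_left inner_commute[of "Y p"])
  qed
  \<comment> \<open>T(X,Y,Z) = -T(X,Z,Y) = -T(Z,X,Y) = T(Z,Y,X) = T(Y,Z,X) = -T(Y,X,Z) =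
    -T(X,Y,Z).\<close>
  have zero: "T X Y Z = 0" if Z: "Z \<in> vector_fields OG" for Z
    using sym[OF X Y, of Z] sym[OF X Z, of Y] sym[OF Y Z, of X]
      skew[OF X Y Z] skew[OF Z X Y] skew[OF Y Z X] by linarith
  have "D X Y \<in> vector_fields OG"
    using D X Y unfolding is_levi_civita_def affine_connection_def by simp
  \<comment> \<open>The difference at \<open>p\<close> is tangent, so it is the value at
    \<open>p\<close> of a left-invariant field and may be tested against itself.\<close>
  then have "skew_symmetric (body (D X Y) p - body (nabla X Y) p)"
    by (intro skew_symmetric_diff body_skew nabla_vector_field X Y p)
  from zero[OF left_invariant_vector_field[OF this]]
  have "(D X Y p - nabla X Y p) \<bullet> (D X Y p - nabla X Y p) = 0"
    by (simp add: T_def left_invariant_def matrix_algebra body_cancel[OF p])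
  then show ?thesis by simp
qed

lemma levi_civita_nabla:
  assumes "X \<in> vector_fields OG" "Y \<in> vector_fields OG" "p \<in> OG"
  shows "levi_civita OG frobenius_metric X Y p = nabla X Y p"
  unfolding levi_civita_def
  by (rule is_levi_civita_unique[OF someI[of "is_levi_civita OG frobenius_metric", OF is_levi_civita_nabla] assms])

section \<open>Covariant derivatives along curves and geodesics\<close>

definition skew_part :: "real^'n^'n \<Rightarrow> real^'n^'n" where
  "skew_part A = (1/2) *\<^sub>R (A - transpose A)"

lemma bounded_linear_skew_part: "bounded_linear (skew_part :: real^'n^'n \<Rightarrow> real^'n^'n)"
  unfolding linear_conv_bounded_linear[symmetric]
  by (auto intro!: linearI simp: skew_part_def transpose_algebra algebra_simps)

lemma skew_symmetric_skew_part: "skew_symmetric (skew_part A)"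
  by (simp add: skew_symmetric_def skew_part_def transpose_algebra flip: scaleR_minus_right)

lemma skew_part_skew: "skew_symmetric A \<Longrightarrow> skew_part A = A"
  by (simp add: skew_symmetric_def skew_part_def flip: scaleR_2)

lemma skew_part_symmetric: "transpose A = A \<Longrightarrow> skew_part A = 0"
  by (simp add: skew_part_def)

text \<open>Since (AB)^T = BA for skew factors. This is where the half commutator comes from when
  the ambient derivative is projected.\<close>

lemma skew_part_mult:
  "skew_symmetric A \<Longrightarrow> skew_symmetric B \<Longrightarrow> skew_part (A ** B) = (1/2) *\<^sub>R commutator A B"
  by (simp add: skew_symmetric_def skew_part_def commutator_def transpose_algebra matrix_algebra)

text \<open>For orthogonal \<open>p\<close>, the orthogonal projection of all matrices onto the
  tangent space at \<open>p\<close>: symmetric and skew matrices are orthogonal, and multiplication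
  by \<open>p\<close> is an isometry.\<close>

definition tangent_projection :: "real^'n^'n \<Rightarrow> real^'n^'n \<Rightarrow> real^'n^'n" where
  "tangent_projection p W = p ** skew_part (transpose p ** W)"

lemma bounded_linear_tangent_projection: "bounded_linear (tangent_projection p)"
  unfolding tangent_projection_def[abs_def]
  by (intro bounded_linear_compose[OF bounded_bilinear.bounded_linear_right[OF bounded_bilinear_matrix_mult]]
      bounded_linear_compose[OF bounded_linear_skew_part]
      bounded_bilinear.bounded_linear_right[OF bounded_bilinear_matrix_mult])

lemma tangent_projection_tangent:
  assumes "p \<in> OG" "v \<in> tangent_space OG p"
  shows "tangent_projection p v = v"
  using assms
  by (simp add: skew_part_skew tangent_projection_def tangent_space_orthogonal_group orthogonal_group_cancel)

text \<open>The ambient derivative has body a b + db(X); projecting replaces a b by half the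
  commutator and keeps the skew db(X). This links \<open>nabla\<close> to derivatives along
  curves.\<close>

lemma tangent_projection_differential:
  assumes "X \<in> vector_fields OG" "Y \<in> vector_fields OG" "p \<in> OG"
  shows "tangent_projection p (differential OG Y p (X p)) = nabla X Y p"
proof -
  note v = vector_fieldsD(2)[OF assms(1,3)]
  have "skew_part (body X p ** body Y p + differential OG (body Y) p (X p)) =
      (1/2) *\<^sub>R commutator (body X p) (body Y p) + differential OG (body Y) p (X p)"
    using skew_part_mult[OF body_skew[OF assms(1,3)] body_skew[OF assms(2,3)]]
      skew_part_skew[OF differential_body_skew[OF assms(2,3) v]]
    by (simp add: linear_add[OF bounded_linear.linear[OF bounded_linear_skew_part]])
  then show ?thesis
    unfolding tangent_projection_def nabla_def differential_body[OF assms(2,3) v]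
    by (simp add: orthogonal_group_cancel[OF assms(3)] body_def)
qed

definition covariant_dt :: "(real \<Rightarrow> real^'n^'n) \<Rightarrow> (real \<Rightarrow> real^'n^'n) \<Rightarrow> real \<Rightarrow> real^'n^'n" where
  "covariant_dt \<gamma> V t = tangent_projection (\<gamma> t) (vector_derivative V (at t))"

lemma is_covariant_derivative_along_add:
  "is_covariant_derivative_along M g I \<gamma> D \<Longrightarrow> V \<in> fields_along M I \<gamma> \<Longrightarrow> W \<in> fields_along M I \<gamma> \<Longrightarrow>
    t \<in> I \<Longrightarrow> D (\<lambda>s. V s + W s) t = D V t + D W t"
  unfolding is_covariant_derivative_along_def by blast

lemma is_covariant_derivative_along_scaleR:
  "is_covariant_derivative_along M g I \<gamma> D \<Longrightarrow> V \<in> fields_along M I \<gamma> \<Longrightarrow> smooth_on I f \<Longrightarrow>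
    t \<in> I \<Longrightarrow> D (\<lambda>s. f s *\<^sub>R V s) t = deriv f t *\<^sub>R V t + f t *\<^sub>R D V t"
  unfolding is_covariant_derivative_along_def by blast

locale orthogonal_curve =
  fixes I :: "real set" and \<gamma> :: "real \<Rightarrow> real^'n^'n"
  assumes open_domain: "open I" and smooth_curve: "smooth_on I \<gamma>" and curve_in: "\<gamma> ` I \<subseteq> OG"
begin

lemma curve_mem: "t \<in> I \<Longrightarrow> \<gamma> t \<in> OG"
  using curve_in by blast

lemma velocity_tangent: "t \<in> I \<Longrightarrow> vector_derivative \<gamma> (at t) \<in> tangent_space OG (\<gamma> t)"
  unfolding tangent_space_orthogonal_group[OF curve_mem]
  by (rule curve_velocity_skew[OF open_domain _ curve_in
        smooth_on_has_vector_derivative[OF smooth_curve open_domain]])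

lemma fieldsI:
  "smooth_on I V \<Longrightarrow> (\<And>t. t \<in> I \<Longrightarrow> V t \<in> tangent_space OG (\<gamma> t)) \<Longrightarrow> V \<in> fields_along OG I \<gamma>"
  by (simp add: fields_along_def)

lemma fieldsD:
  assumes "V \<in> fields_along OG I \<gamma>"
  shows "smooth_on I V" "t \<in> I \<Longrightarrow> V t \<in> tangent_space OG (\<gamma> t)"
    "t \<in> I \<Longrightarrow> (V has_vector_derivative vector_derivative V (at t)) (at t)"
  using assms smooth_on_has_vector_derivative[OF _ open_domain] by (auto simp: fields_along_def)

lemma velocity_field: "(\<lambda>s. vector_derivative \<gamma> (at s)) \<in> fields_along OG I \<gamma>"
  by (intro fieldsI smooth_on_vector_derivative open_domain smooth_curve velocity_tangent)

lemma smooth_on_body_along: "smooth_on I V \<Longrightarrow> smooth_on I (\<lambda>t. transpose (\<gamma> t) ** V t)"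
  by (intro smooth_on_bilinear[OF bounded_bilinear_matrix_mult open_domain]
      smooth_on_bounded_linear[OF bounded_linear_transpose open_domain] smooth_curve)

lemma covariant_dt_field:
  assumes "V \<in> fields_along OG I \<gamma>"
  shows "covariant_dt \<gamma> V \<in> fields_along OG I \<gamma>"
proof (rule fieldsI)
  show "smooth_on I (covariant_dt \<gamma> V)"
    unfolding covariant_dt_def[abs_def] tangent_projection_def
    by (intro smooth_on_bilinear[OF bounded_bilinear_matrix_mult open_domain] smooth_curve
        smooth_on_bounded_linear[OF bounded_linear_skew_part open_domain] smooth_on_body_along
        smooth_on_vector_derivative[OF open_domain] fieldsD(1)[OF assms])
  show "covariant_dt \<gamma> V t \<in> tangent_space OG (\<gamma> t)" if "t \<in> I" for t
    unfolding covariant_dt_def tangent_projection_def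
    by (rule tangent_spaceI[OF curve_mem[OF that] skew_symmetric_skew_part])
qed

lemma composition_has_vector_derivative:
  assumes "Y \<in> vector_fields OG" "t \<in> I"
  shows "((\<lambda>s. Y (\<gamma> s)) has_vector_derivative
     differential OG Y (\<gamma> t) (vector_derivative \<gamma> (at t))) (at t)"
  by (rule has_vector_derivative_along_curve[OF smooth_map_on_has_derivative[OF vector_fieldsD(1)[OF assms(1)]
          curve_mem[OF assms(2)]] open_domain assms(2) curve_in
        smooth_on_has_vector_derivative[OF smooth_curve open_domain assms(2)]])

text \<open>The projection is linear and fixes the tangent vector \<open>V t\<close>, whence
  additivity and the Leibniz rule; the chain rule and \<open>tangent_projection_differential\<close>
  give the compatibility with \<open>levi_civita\<close>.\<close>

lemma is_covariant_derivative_along_covariant_dt: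
  "is_covariant_derivative_along OG frobenius_metric I \<gamma> (covariant_dt \<gamma>)"
  unfolding is_covariant_derivative_along_def
proof (intro conjI ballI allI impI)
  show "covariant_dt \<gamma> V \<in> fields_along OG I \<gamma>" if "V \<in> fields_along OG I \<gamma>" for V
    by (rule covariant_dt_field[OF that])
next
  fix V W t assume V: "V \<in> fields_along OG I \<gamma>" and W: "W \<in> fields_along OG I \<gamma>" and t: "t \<in> I"
  have "vector_derivative (\<lambda>s. V s + W s) (at t) = vector_derivative V (at t) + vector_derivative W (at t)"
    by (intro vector_derivative_at has_vector_derivative_add fieldsD V W t)
  then show "covariant_dt \<gamma> (\<lambda>s. V s + W s) t = covariant_dt \<gamma> V t + covariant_dt \<gamma> W t"
    by (simp add: covariant_dt_def linear_add[OF bounded_linear.linear[OF bounded_linear_tangent_projection]])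
next
  fix V t and f :: "real \<Rightarrow> real"
  assume V: "V \<in> fields_along OG I \<gamma>" and f: "smooth_on I f" and t: "t \<in> I"
  have "(f has_vector_derivative vector_derivative f (at t)) (at t)"
    by (rule smooth_on_has_vector_derivative[OF f open_domain t])
  then have "(f has_real_derivative deriv f t) (at t)"
    by (metis DERIV_imp_deriv has_real_derivative_iff_has_vector_derivative)
  from has_vector_derivative_scaleR[OF this fieldsD(3)[OF V t]]
  have "vector_derivative (\<lambda>s. f s *\<^sub>R V s) (at t) =
      f t *\<^sub>R vector_derivative V (at t) + deriv f t *\<^sub>R V t"
    by (rule vector_derivative_at)
  then show "covariant_dt \<gamma> (\<lambda>s. f s *\<^sub>R V s) t = deriv f t *\<^sub>R V t + f t *\<^sub>R covariant_dt \<gamma> V t"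
    using tangent_projection_tangent[OF curve_mem[OF t] fieldsD(2)[OF V t]]
    by (simp add: covariant_dt_def linear_add[OF bounded_linear.linear[OF bounded_linear_tangent_projection]]
        linear_cmul[OF bounded_linear.linear[OF bounded_linear_tangent_projection]])
next
  fix X Y :: "real^'n^'n \<Rightarrow> real^'n^'n" and t assume X: "X \<in> vector_fields OG" and Y: "Y \<in> vector_fields OG" and t: "t \<in> I"
    and eq: "X (\<gamma> t) = vector_derivative \<gamma> (at t)"
  have "vector_derivative (Y \<circ> \<gamma>) (at t) = differential OG Y (\<gamma> t) (X (\<gamma> t))"
    unfolding eq comp_def by (rule vector_derivative_at[OF composition_has_vector_derivative[OF Y t]])
  then show "covariant_dt \<gamma> (Y \<circ> \<gamma>) t = levi_civita OG frobenius_metric X Y (\<gamma> t)"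
    by (simp add: covariant_dt_def tangent_projection_differential[OF X Y curve_mem[OF t]]
        levi_civita_nabla[OF X Y curve_mem[OF t]])
qed

text \<open>Fields along \<open>\<gamma>\<close> that agree on \<open>I\<close> only differ by a field \<open>W\<close> with \<open>W = f W\<close>, where
  \<open>f\<close> is \<open>0\<close> on \<open>I\<close> and \<open>1\<close> elsewhere, so the Leibniz rule makes the derivative local.\<close>

lemma covariant_derivative_local:
  assumes D: "is_covariant_derivative_along OG frobenius_metric I \<gamma> D"
    and V: "V \<in> fields_along OG I \<gamma>" and W: "W \<in> fields_along OG I \<gamma>"
    and eq: "\<And>s. s \<in> I \<Longrightarrow> V s = W s" and t: "t \<in> I"
  shows "D V t = D W t"
proof -
  define f :: "real \<Rightarrow> real" where "f s = (if s \<in> I then 0 else 1)" for s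
  define Z where "Z s = V s - W s" for s
  have f: "smooth_on I f"
    by (rule smooth_on_cong[OF open_domain _ smooth_on_const[OF open_domain, of 0]]) (simp add: f_def)
  have Z: "Z \<in> fields_along OG I \<gamma>"
  proof (rule fieldsI)
    show "smooth_on I Z" unfolding Z_def by (intro smooth_on_diff open_domain fieldsD V W)
    show "Z s \<in> tangent_space OG (\<gamma> s)" if "s \<in> I" for s
      using that by (simp add: Z_def eq tangent_space_orthogonal_group[OF curve_mem] skew_symmetric_def)
        (simp add: transpose_def vec_eq_iff)
  qed
  have "(\<lambda>s. f s *\<^sub>R Z s) = Z" by (auto simp: f_def Z_def eq)
  moreover have "D (\<lambda>s. f s *\<^sub>R Z s) t = deriv f t *\<^sub>R Z t + f t *\<^sub>R D Z t"
    by (rule is_covariant_derivative_along_scaleR[OF D Z f t])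
  ultimately have "D Z t = 0" using t by (simp add: f_def Z_def eq)
  moreover have "D (\<lambda>s. W s + Z s) t = D W t + D Z t"
    by (rule is_covariant_derivative_along_add[OF D W Z t])
  ultimately show ?thesis by (simp add: Z_def)
qed

lemma zero_field: "(\<lambda>s. 0) \<in> fields_along OG I \<gamma>"
  by (intro fieldsI smooth_on_const open_domain)
    (simp add: tangent_space_orthogonal_group[OF curve_mem] skew_symmetric_def transpose_def vec_eq_iff)

lemma add_field:
  assumes "V \<in> fields_along OG I \<gamma>" "W \<in> fields_along OG I \<gamma>"
  shows "(\<lambda>s. V s + W s) \<in> fields_along OG I \<gamma>"
proof (rule fieldsI[OF smooth_on_add[OF open_domain fieldsD(1) fieldsD(1)]])
  show "V t + W t \<in> tangent_space OG (\<gamma> t)" if "t \<in> I" for t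
    using fieldsD(2)[OF assms(1) that] fieldsD(2)[OF assms(2) that]
    by (simp add: tangent_space_orthogonal_group[OF curve_mem[OF that]] matrix_add_ldistrib skew_symmetric_add)
qed (rule assms)+

lemma scaleR_field:
  assumes "smooth_on I f" "V \<in> fields_along OG I \<gamma>"
  shows "(\<lambda>s. f s *\<^sub>R V s) \<in> fields_along OG I \<gamma>"
proof (rule fieldsI[OF smooth_on_bilinear[OF bounded_bilinear_scaleR open_domain assms(1) fieldsD(1)[OF assms(2)]]])
  show "f t *\<^sub>R V t \<in> tangent_space OG (\<gamma> t)" if "t \<in> I" for t
    using fieldsD(2)[OF assms(2) that]
    by (simp add: tangent_space_orthogonal_group[OF curve_mem[OF that]] matrix_algebra skew_symmetric_scaleR)
qed

lemma left_invariant_field: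
  "skew_symmetric A \<Longrightarrow> left_invariant A \<circ> \<gamma> \<in> fields_along OG I \<gamma>"
  unfolding left_invariant_def comp_def
  by (intro fieldsI tangent_spaceI curve_mem smooth_curve open_domain
      smooth_on_bounded_linear[OF bounded_bilinear.bounded_linear_left[OF bounded_bilinear_matrix_mult]])

text \<open>The compatibility axiom needs a vector field through the velocity at the single time
  \<open>t\<close>; the left-invariant one serves, and the axiom then fixes the value.\<close>

lemma covariant_derivative_left_invariant:
  assumes D: "is_covariant_derivative_along OG frobenius_metric I \<gamma> D"
    and D': "is_covariant_derivative_along OG frobenius_metric I \<gamma> D'"
    and A: "skew_symmetric A" and t: "t \<in> I"
  shows "D (left_invariant A \<circ> \<gamma>) t = D' (left_invariant A \<circ> \<gamma>) t"
proof -
  define X where "X = left_invariant (transpose (\<gamma> t) ** vector_derivative \<gamma> (at t))"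
  have "X \<in> vector_fields OG"
    unfolding X_def using velocity_tangent[OF t] tangent_space_orthogonal_group[OF curve_mem[OF t]]
    by (intro left_invariant_vector_field) simp
  moreover have "X (\<gamma> t) = vector_derivative \<gamma> (at t)"
    by (simp add: X_def left_invariant_def orthogonal_group_cancel[OF curve_mem[OF t]])
  ultimately have "E (left_invariant A \<circ> \<gamma>) t = levi_civita OG frobenius_metric X (left_invariant A) (\<gamma> t)"
    if "is_covariant_derivative_along OG frobenius_metric I \<gamma> E" for E
    using that left_invariant_vector_field[OF A] t unfolding is_covariant_derivative_along_def by blast
  from this[OF D] this[OF D'] show ?thesis by simp
qed

text \<open>Left-invariant fields of an orthonormal basis of skew matrices form a frame along the
  curve. With smooth coefficients, additivity and the Leibniz rule reduce everything to the frame
  fields.\<close>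

lemma covariant_derivative_unique:
  assumes D: "is_covariant_derivative_along OG frobenius_metric I \<gamma> D"
    and D': "is_covariant_derivative_along OG frobenius_metric I \<gamma> D'"
    and V: "V \<in> fields_along OG I \<gamma>" and t: "t \<in> I"
  shows "D V t = D' V t"
proof -
  obtain B where B: "B \<subseteq> {A :: real^'n^'n. skew_symmetric A}" "pairwise orthogonal B"
    "\<And>x. x \<in> B \<Longrightarrow> norm x = 1" "independent B" "span B = {A. skew_symmetric A}"
    using orthonormal_basis_subspace[OF subspace_skew] by metis
  have fin: "finite B" using independent_imp_finite[OF B(4)] .
  define f where "f A s = (transpose (\<gamma> s) ** V s) \<bullet> A" for A s
  have f: "smooth_on I (f A)" for A
    unfolding f_def
    by (intro smooth_on_bounded_linear[OF bounded_linear_inner_left open_domain] smooth_on_body_along fieldsD(1) V)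
  \<comment> \<open>Valid on \<open>I\<close> only; \<open>covariant_derivative_local\<close> later
    turns this into an equality of derivatives.\<close>
  have expand: "V s = (\<Sum>A\<in>B. f A s *\<^sub>R (left_invariant A \<circ> \<gamma>) s)" if "s \<in> I" for s
  proof -
    have "transpose (\<gamma> s) ** V s \<in> span B"
      unfolding B(5) using fieldsD(2)[OF V that] tangent_space_orthogonal_group[OF curve_mem[OF that]] by blast
    then have "(\<Sum>A\<in>B. f A s *\<^sub>R A) = transpose (\<gamma> s) ** V s"
      unfolding f_def using B(2,3) fin by (intro orthonormal_basis_expand) auto
    then have "\<gamma> s ** (\<Sum>A\<in>B. f A s *\<^sub>R A) = V s"
      by (simp add: orthogonal_group_cancel[OF curve_mem[OF that]])
    moreover have "\<gamma> s ** (\<Sum>A\<in>B. f A s *\<^sub>R A) = (\<Sum>A\<in>B. \<gamma> s ** (f A s *\<^sub>R A))"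
      by (rule bounded_bilinear.sum_right[OF bounded_bilinear_matrix_mult])
    moreover have "\<gamma> s ** (f A s *\<^sub>R A) = f A s *\<^sub>R (left_invariant A \<circ> \<gamma>) s" for A
      by (simp add: left_invariant_def bounded_bilinear.scaleR_right[OF bounded_bilinear_matrix_mult])
    ultimately show ?thesis by simp
  qed
  \<comment> \<open>Membership in \<open>fields_along\<close> is carried through the induction
    because the axioms apply to such fields only.\<close>
  have sum: "(\<lambda>s. \<Sum>A\<in>C. f A s *\<^sub>R (left_invariant A \<circ> \<gamma>) s) \<in> fields_along OG I \<gamma> \<and>
     D (\<lambda>s. \<Sum>A\<in>C. f A s *\<^sub>R (left_invariant A \<circ> \<gamma>) s) t =
     D' (\<lambda>s. \<Sum>A\<in>C. f A s *\<^sub>R (left_invariant A \<circ> \<gamma>) s) t" if "finite C" "C \<subseteq> B" for C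
    using that
  proof (induction C rule: finite_induct)
    case empty
    have zero: "E (\<lambda>s. 0) t = 0" if E: "is_covariant_derivative_along OG frobenius_metric I \<gamma> E" for E
    proof -
      show ?thesis
        using is_covariant_derivative_along_add[OF E zero_field zero_field t] by simp
    qed
    show ?case using zero_field zero[OF D] zero[OF D'] by simp
  next
    case (insert A C)
    define S where "S s = (\<Sum>A\<in>C. f A s *\<^sub>R (left_invariant A \<circ> \<gamma>) s)" for s
    define L where "L = left_invariant A \<circ> \<gamma>"
    have A: "skew_symmetric A" using insert B(1) by blast
    have L: "L \<in> fields_along OG I \<gamma>" unfolding L_def by (rule left_invariant_field[OF A])
    have fL: "(\<lambda>s. f A s *\<^sub>R L s) \<in> fields_along OG I \<gamma>" by (rule scaleR_field[OF f L])
    have S: "S \<in> fields_along OG I \<gamma>" "D S t = D' S t"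
      using insert unfolding S_def[abs_def] by auto
    have step: "E (\<lambda>s. f A s *\<^sub>R L s + S s) t = deriv (f A) t *\<^sub>R L t + f A t *\<^sub>R E L t + E S t"
      if E: "is_covariant_derivative_along OG frobenius_metric I \<gamma> E" for E
    proof -
      have "E (\<lambda>s. f A s *\<^sub>R L s + S s) t = E (\<lambda>s. f A s *\<^sub>R L s) t + E S t"
        by (rule is_covariant_derivative_along_add[OF E fL S(1) t])
      moreover have "E (\<lambda>s. f A s *\<^sub>R L s) t = deriv (f A) t *\<^sub>R L t + f A t *\<^sub>R E L t"
        by (rule is_covariant_derivative_along_scaleR[OF E L f t])
      ultimately show ?thesis by simp
    qed
    have "(\<lambda>s. \<Sum>A\<in>insert A C. f A s *\<^sub>R (left_invariant A \<circ> \<gamma>) s) = (\<lambda>s. f A s *\<^sub>R L s + S s)"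
      using insert by (simp add: S_def L_def)
    moreover have "D L t = D' L t"
      unfolding L_def by (rule covariant_derivative_left_invariant[OF D D' A t])
    ultimately show ?case
      using add_field[OF fL S(1)] step[OF D] step[OF D'] S(2) by simp
  qed
  from sum[OF fin order_refl]
  show ?thesis
    using covariant_derivative_local[OF D V _ expand t] covariant_derivative_local[OF D' V _ expand t] by simp
qed

lemma covariant_derivative_along_eq:
  "V \<in> fields_along OG I \<gamma> \<Longrightarrow> t \<in> I \<Longrightarrow>
    covariant_derivative_along OG frobenius_metric I \<gamma> V t = covariant_dt \<gamma> V t"
  unfolding covariant_derivative_along_def
  by (rule covariant_derivative_unique[OF someI[of "is_covariant_derivative_along OG frobenius_metric I \<gamma>",
          OF is_covariant_derivative_along_covariant_dt] is_covariant_derivative_along_covariant_dt])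

text \<open>Let a = \<gamma>^T \<gamma>'. Its derivative \<gamma>^T \<gamma>'' + \<gamma>'^T
  \<gamma>' is skew because a is, and the second summand is symmetric; taking skew parts leaves the
  skew part of \<gamma>^T \<gamma>''.\<close>

lemma body_velocity_derivative:
  assumes t: "t \<in> I"
  shows "((\<lambda>s. transpose (\<gamma> s) ** vector_derivative \<gamma> (at s)) has_vector_derivative
    transpose (\<gamma> t) ** covariant_dt \<gamma> (\<lambda>s. vector_derivative \<gamma> (at s)) t) (at t)"
proof -
  define v where "v s = vector_derivative \<gamma> (at s)" for s
  define a where "a s = transpose (\<gamma> s) ** v s" for s
  define w where "w = vector_derivative v (at t)"
  have v: "v \<in> fields_along OG I \<gamma>" unfolding v_def[abs_def] by (rule velocity_field)
  have w: "(v has_vector_derivative w) (at t)" unfolding w_def by (rule fieldsD(3)[OF v t])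
  have g: "(\<gamma> has_vector_derivative v t) (at t)"
    unfolding v_def by (rule smooth_on_has_vector_derivative[OF smooth_curve open_domain t])
  have a: "(a has_vector_derivative (transpose (\<gamma> t) ** w + transpose (v t) ** v t)) (at t)"
    unfolding a_def[abs_def]
    by (intro has_vector_derivative_matrix_mult has_vector_derivative_transpose w g)
  \<comment> \<open>On \<open>I\<close> this is \<open>a\<close> itself, so comparing the two
    derivatives shows that the derivative is skew.\<close>
  have "((\<lambda>s. - transpose (a s)) has_vector_derivative - transpose (transpose (\<gamma> t) ** w + transpose (v t) ** v t)) (at t)"
    by (intro has_vector_derivative_minus has_vector_derivative_transpose a)
  then have "(a has_vector_derivative - transpose (transpose (\<gamma> t) ** w + transpose (v t) ** v t)) (at t)"
    by (rule has_vector_derivative_transform_within_open[OF _ open_domain t])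
      (use fieldsD(2)[OF v] tangent_space_orthogonal_group[OF curve_mem] in
        \<open>simp add: a_def skew_symmetric_def\<close>)
  from vector_derivative_unique_at[OF a this]
  have skew: "skew_symmetric (transpose (\<gamma> t) ** w + transpose (v t) ** v t)"
    unfolding skew_symmetric_def by (metis minus_minus)
  have "transpose (\<gamma> t) ** w + transpose (v t) ** v t =
      skew_part (transpose (\<gamma> t) ** w) + skew_part (transpose (v t) ** v t)"
    using skew_part_skew[OF skew] by (simp add: linear_add[OF bounded_linear.linear[OF bounded_linear_skew_part]])
  also have "skew_part (transpose (v t) ** v t) = 0"
    by (rule skew_part_symmetric) (simp add: transpose_algebra)
  also have "skew_part (transpose (\<gamma> t) ** w) = transpose (\<gamma> t) ** covariant_dt \<gamma> v t"
    by (simp add: covariant_dt_def tangent_projection_def w_def orthogonal_group_cancel[OF curve_mem[OF t]])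
  finally show ?thesis using a by (simp add: a_def[abs_def] v_def[abs_def])
qed

end

text \<open>Geodesics are the curves with constant body velocity. That \<open>I\<close> is an
  interval makes one \<open>A\<close> and one \<open>G\<close> serve on all of
  \<open>I\<close>.\<close>

lemma geodesic_orthogonal_group_iff:
  fixes \<gamma> :: "real \<Rightarrow> real^'n^'n"
  assumes "open I" "is_interval I"
  shows "geodesic OG frobenius_metric I \<gamma> \<longleftrightarrow>
    (\<exists>G\<in>OG. \<exists>A. skew_symmetric A \<and> (\<forall>t\<in>I. \<gamma> t = G ** matrix_exp (t *\<^sub>R A)))"
proof
  assume geo: "geodesic OG frobenius_metric I \<gamma>"
  interpret orthogonal_curve I \<gamma>
    using geo assms by unfold_locales (auto simp: geodesic_def)
  define a where "a s = transpose (\<gamma> s) ** vector_derivative \<gamma> (at s)" for s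
  have "(a has_vector_derivative 0) (at t within I)" if "t \<in> I" for t
  proof -
    have "covariant_dt \<gamma> (\<lambda>s. vector_derivative \<gamma> (at s)) t = 0"
      using geo that covariant_derivative_along_eq[OF velocity_field that] by (simp add: geodesic_def)
    then have "(a has_vector_derivative 0) (at t)"
      using body_velocity_derivative[OF that] by (simp add: a_def[abs_def])
    then show ?thesis by (rule has_vector_derivative_at_within)
  qed
  note const = has_vector_derivative_zero_eq[OF is_interval_convex[OF assms(2)] this]
  show "\<exists>G\<in>OG. \<exists>A. skew_symmetric A \<and> (\<forall>t\<in>I. \<gamma> t = G ** matrix_exp (t *\<^sub>R A))"
  proof (cases "I = {}")
    case True
    have "mat 1 \<in> (OG :: (real^'n^'n) set)" by (simp add: orthogonal_group_def orthogonal_matrix)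
    moreover have "skew_symmetric (0 :: real^'n^'n)"
      by (simp add: skew_symmetric_def transpose_def vec_eq_iff)
    ultimately show ?thesis using True by blast
  next
    case False
    then obtain t0 where t0: "t0 \<in> I" by blast
    define A where "A = a t0"
    have A: "skew_symmetric A"
      using velocity_tangent[OF t0] tangent_space_orthogonal_group[OF curve_mem[OF t0]]
      by (simp add: A_def a_def)
    have "(\<gamma> has_vector_derivative \<gamma> t ** A) (at t)" if "t \<in> I" for t
    proof -
      have "A = a t" unfolding A_def using const[OF _ t0 that] by simp
      then have "\<gamma> t ** A = vector_derivative \<gamma> (at t)"
        by (simp add: a_def orthogonal_group_cancel[OF curve_mem[OF that]])
      then show ?thesis using smooth_on_has_vector_derivative[OF smooth_curve open_domain that] by simp
    qed
    then obtain G where G: "\<And>t. t \<in> I \<Longrightarrow> \<gamma> t = G ** matrix_exp (t *\<^sub>R A)"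
      using matrix_ode_solution[OF A assms] by metis
    \<comment> \<open>Solving for \<open>G\<close> at \<open>t0\<close> exhibits it as a product of
      orthogonal matrices.\<close>
    have "G = \<gamma> t0 ** transpose (matrix_exp (t0 *\<^sub>R A))"
      by (simp add: G[OF t0] orthogonal_group_cancel[OF matrix_exp_orthogonal[OF A]])
    then have "G \<in> OG"
      using orthogonal_group_mult[OF curve_mem[OF t0] orthogonal_group_transpose[OF matrix_exp_orthogonal[OF A]]]
      by simp
    with A G show ?thesis by blast
  qed
next
  assume "\<exists>G\<in>OG. \<exists>A. skew_symmetric A \<and> (\<forall>t\<in>I. \<gamma> t = G ** matrix_exp (t *\<^sub>R A))"
  then obtain G A where G: "G \<in> OG" and A: "skew_symmetric A"
    and eq: "\<And>t. t \<in> I \<Longrightarrow> \<gamma> t = G ** matrix_exp (t *\<^sub>R A)" by blast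
  have smooth: "smooth_on I \<gamma>"
    by (rule smooth_on_cong[OF assms(1) _ smooth_on_subset[OF smooth_on_matrix_exp[of G A]]]) (simp_all add: eq)
  have mem: "\<gamma> ` I \<subseteq> OG"
    using orthogonal_group_mult[OF G matrix_exp_orthogonal[OF A]] eq by auto
  interpret orthogonal_curve I \<gamma> by unfold_locales (rule assms(1) smooth mem)+
  have vel: "transpose (\<gamma> t) ** vector_derivative \<gamma> (at t) = A" if "t \<in> I" for t
  proof -
    have "((\<lambda>t. G ** matrix_exp (t *\<^sub>R A)) has_vector_derivative G ** (A ** matrix_exp (t *\<^sub>R A))) (at t)"
      by (intro bounded_linear.has_vector_derivative[OF bounded_bilinear.bounded_linear_right
            [OF bounded_bilinear_matrix_mult]] has_vector_derivative_matrix_exp)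
    then have "(\<gamma> has_vector_derivative G ** (A ** matrix_exp (t *\<^sub>R A))) (at t)"
      by (rule has_vector_derivative_transform_within_open[OF _ assms(1) that]) (simp add: eq)
    then have "vector_derivative \<gamma> (at t) = \<gamma> t ** A"
      unfolding matrix_exp_scaleR_commute eq[OF that]
      by (simp add: vector_derivative_at matrix_mul_assoc)
    then show ?thesis by (simp add: orthogonal_group_cancel[OF curve_mem[OF that]])
  qed
  have "covariant_dt \<gamma> (\<lambda>s. vector_derivative \<gamma> (at s)) t = 0" if "t \<in> I" for t
  proof -
    have "((\<lambda>s. transpose (\<gamma> s) ** vector_derivative \<gamma> (at s)) has_vector_derivative 0) (at t)"
      by (rule has_vector_derivative_transform_within_open[OF has_vector_derivative_const[of A] assms(1) that])
        (simp add: vel)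
    from vector_derivative_unique_at[OF body_velocity_derivative[OF that] this]
    have "\<gamma> t ** (transpose (\<gamma> t) ** covariant_dt \<gamma> (\<lambda>s. vector_derivative \<gamma> (at s)) t) = 0" by simp
    then show ?thesis by (simp only: orthogonal_group_cancel[OF curve_mem[OF that]])
  qed
  then show "geodesic OG frobenius_metric I \<gamma>"
    using smooth mem covariant_derivative_along_eq[OF velocity_field] by (simp add: geodesic_def)
qed

section \<open>Curvature and symmetry\<close>

lemma commutator_jacobi:
  "commutator A (commutator B C) - commutator B (commutator A C) = commutator (commutator A B) C"
  by (simp add: commutator_def matrix_algebra algebra_simps)

text \<open>\<open>levi_civita\<close> agrees with \<open>nabla\<close> on the group only, so the
  inner derivative in the curvature can be replaced only if values off the group do not
  matter.\<close>

lemma nabla_cong: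
  assumes "\<And>x. x \<in> OG \<Longrightarrow> Y x = Y' x" "p \<in> OG"
  shows "nabla X Y p = nabla X Y' p"
proof -
  have "differential OG (body Y) p (X p) = differential OG (body Y') p (X p)"
    by (rule differential_cong[OF assms(2)]) (simp add: body_def assms(1))
  then show ?thesis by (simp add: nabla_def body_def assms)
qed

lemma levi_civita_vector_field:
  assumes "X \<in> vector_fields OG" "Y \<in> vector_fields OG"
  shows "levi_civita OG frobenius_metric X Y \<in> vector_fields OG"
  by (rule vector_fieldsI[OF smooth_map_on_body[OF vector_fieldsD(1)[OF nabla_vector_field[OF assms]]]
        body_skew[OF nabla_vector_field[OF assms]]])
    (simp_all add: levi_civita_nabla[OF assms] body_cancel)

lemma body_nabla:
  "p \<in> OG \<Longrightarrow> body (nabla X Y) p =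
    (1/2) *\<^sub>R commutator (body X p) (body Y p) + differential OG (body Y) p (X p)"
  by (simp add: body_def nabla_def orthogonal_group_cancel)

lemma body_nabla_nabla:
  assumes X: "X \<in> vector_fields OG" and Y: "Y \<in> vector_fields OG" and Z: "Z \<in> vector_fields OG" and p: "p \<in> OG"
  shows "body (nabla X (nabla Y Z)) p =
    (1/2) *\<^sub>R commutator (body X p) ((1/2) *\<^sub>R commutator (body Y p) (body Z p) + differential OG (body Z) p (Y p)) +
    (1/2) *\<^sub>R (commutator (body Y p) (differential OG (body Z) p (X p)) +
      commutator (differential OG (body Y) p (X p)) (body Z p)) +
    differential OG (\<lambda>x. differential OG (body Z) x (Y x)) p (X p)"
proof -
  note Xp = vector_fieldsD(2)[OF X p]
  note sm = smooth_map_on_body[OF vector_fieldsD(1)]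
  have "differential OG (body (nabla Y Z)) p (X p) =
      differential OG (\<lambda>x. (1/2) *\<^sub>R commutator (body Y x) (body Z x) + differential OG (body Z) x (Y x)) p (X p)"
    by (rule differential_cong[OF p body_nabla])
  also have "\<dots> = differential OG (\<lambda>x. (1/2) *\<^sub>R commutator (body Y x) (body Z x)) p (X p) +
      differential OG (\<lambda>x. differential OG (body Z) x (Y x)) p (X p)"
    by (intro differential_add p Xp smooth_map_on_bounded_linear[OF bounded_linear_scaleR_right]
        smooth_map_on_commutator_body smooth_map_on_differential_body Y Z)
  also have "differential OG (\<lambda>x. (1/2) *\<^sub>R commutator (body Y x) (body Z x)) p (X p) =
      (1/2) *\<^sub>R differential OG (\<lambda>x. commutator (body Y x) (body Z x)) p (X p)"
    by (intro differential_bounded_linear[OF bounded_linear_scaleR_right] p Xp smooth_map_on_commutator_body Y Z)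
  also have "differential OG (\<lambda>x. commutator (body Y x) (body Z x)) p (X p) =
      commutator (body Y p) (differential OG (body Z) p (X p)) + commutator (differential OG (body Y) p (X p)) (body Z p)"
    by (intro differential_bilinear[OF bounded_bilinear_commutator] p Xp sm Y Z)
  finally show ?thesis unfolding body_nabla[OF p] by simp
qed

text \<open>Everything is computed on bodies at \<open>p\<close>. The terms with one derivative
  cancel in pairs, partly against the bracket term; the second derivatives cancel by
  \<open>differential_commutator\<close>.\<close>

lemma curvature_field_orthogonal_group:
  assumes X: "X \<in> vector_fields OG" and Y: "Y \<in> vector_fields OG" and Z: "Z \<in> vector_fields OG" and p: "p \<in> OG"
  shows "curvature_field OG frobenius_metric X Y Z p =
    p ** ((-1/4) *\<^sub>R commutator (commutator (body X p) (body Y p)) (body Z p))"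
proof -
  define a where "a = body X p"
  define b where "b = body Y p"
  define c where "c = body Z p"
  \<comment> \<open>Below, \<open>Xb\<close> stands for the derivative of the body \<open>b\<close>
    along \<open>X\<close>, and similarly for the other names.\<close>
  define Xb where "Xb = differential OG (body Y) p (X p)"
  define Xc where "Xc = differential OG (body Z) p (X p)"
  define Ya where "Ya = differential OG (body X) p (Y p)"
  define Yc where "Yc = differential OG (body Z) p (Y p)"
  define XYc where "XYc = differential OG (\<lambda>x. differential OG (body Z) x (Y x)) p (X p)"
  define YXc where "YXc = differential OG (\<lambda>x. differential OG (body Z) x (X x)) p (Y p)"
  define Lc where "Lc = differential OG (body Z) p (lie_bracket OG X Y p)"
  note L = lie_bracket_vector_field[OF X Y]
  have LC: "levi_civita OG frobenius_metric V (levi_civita OG frobenius_metric W Z) p = nabla V (nabla W Z) p"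
    if "V \<in> vector_fields OG" "W \<in> vector_fields OG" for V W
    unfolding levi_civita_nabla[OF that(1) levi_civita_vector_field[OF that(2) Z] p]
    by (rule nabla_cong[OF levi_civita_nabla[OF that(2) Z] p])
  have com: "XYc - YXc = Lc"
    unfolding XYc_def YXc_def Lc_def
    by (rule differential_commutator[OF smooth_map_on_body[OF vector_fieldsD(1)[OF Z]] X Y p vector_fieldsD(2)[OF L p]])
  have bL: "body (lie_bracket OG X Y) p = commutator a b + Xb - Ya"
    unfolding body_def[of "lie_bracket OG X Y"] lie_bracket_body[OF X Y p]
    by (simp add: orthogonal_group_cancel[OF p] a_def b_def Xb_def Ya_def)
  have "body (\<lambda>x. nabla X (nabla Y Z) x - nabla Y (nabla X Z) x - nabla (lie_bracket OG X Y) Z x) p =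
      body (nabla X (nabla Y Z)) p - body (nabla Y (nabla X Z)) p - body (nabla (lie_bracket OG X Y) Z) p"
    by (simp add: body_def matrix_algebra)
  also have "\<dots> = (1/2) *\<^sub>R commutator a ((1/2) *\<^sub>R commutator b c + Yc) + (1/2) *\<^sub>R (commutator b Xc + commutator Xb c) + XYc
     - ((1/2) *\<^sub>R commutator b ((1/2) *\<^sub>R commutator a c + Xc) + (1/2) *\<^sub>R (commutator a Yc + commutator Ya c) + YXc)
     - ((1/2) *\<^sub>R commutator (commutator a b + Xb - Ya) c + Lc)"
    unfolding body_nabla_nabla[OF X Y Z p] body_nabla_nabla[OF Y X Z p]
      body_nabla[OF p, of "lie_bracket OG X Y" Z] bL
    by (simp only: a_def b_def c_def Xb_def Xc_def Ya_def Yc_def XYc_def YXc_def Lc_def)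
  also have "\<dots> = (1/4) *\<^sub>R (commutator a (commutator b c) - commutator b (commutator a c))
      - (1/2) *\<^sub>R commutator (commutator a b) c"
    unfolding com[symmetric] by (simp add: commutator_algebra scaleR_add_right scaleR_diff_right)
  \<comment> \<open>By the Jacobi identity the first group is 1/4 of the double commutator, and 1/4
    - 1/2 = -1/4.\<close>
  also have "\<dots> = (-1/4) *\<^sub>R commutator (commutator a b) c"
    unfolding commutator_jacobi by (simp flip: scaleR_diff_left)
  finally have "p ** body (\<lambda>x. nabla X (nabla Y Z) x - nabla Y (nabla X Z) x - nabla (lie_bracket OG X Y) Z x) p =
      p ** ((-1/4) *\<^sub>R commutator (commutator a b) c)" by simp
  then show ?thesis
    unfolding body_cancel[OF p] curvature_field_def LC[OF X Y] LC[OF Y X] levi_civita_nabla[OF L Z p]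
    by (simp add: a_def b_def c_def)
qed

text \<open>The field formula involves only values at \<open>p\<close>, so tensoriality comes for
  free. Left-invariant fields with the values \<open>u\<close>, \<open>v\<close>, \<open>w\<close>
  show that the condition under \<open>THE\<close> is not vacuous, hence determines
  \<open>z\<close>.\<close>

lemma riemann_curvature_orthogonal_group:
  assumes p: "p \<in> OG" and u: "u \<in> tangent_space OG p" and v: "v \<in> tangent_space OG p" and w: "w \<in> tangent_space OG p"
  shows "riemann_curvature OG frobenius_metric p u v w =
    p ** ((-1/4) *\<^sub>R commutator (commutator (transpose p ** u) (transpose p ** v)) (transpose p ** w))"
proof -
  have ext: "\<exists>X \<in> vector_fields OG. X p = x" if "x \<in> tangent_space OG p" for x
    using left_invariant_vector_field[of "transpose p ** x"] that
    by (intro bexI[of _ "left_invariant (transpose p ** x)"])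
      (simp_all add: tangent_space_orthogonal_group[OF p] left_invariant_def orthogonal_group_cancel[OF p])
  obtain X Y Z where XYZ: "X \<in> vector_fields OG" "X p = u" "Y \<in> vector_fields OG" "Y p = v"
    "Z \<in> vector_fields OG" "Z p = w"
    using ext[OF u] ext[OF v] ext[OF w] by blast
  show ?thesis
    unfolding riemann_curvature_def
  proof (rule the_equality)
    fix z assume "\<forall>X\<in>vector_fields OG. \<forall>Y\<in>vector_fields OG. \<forall>Z\<in>vector_fields OG.
        X p = u \<longrightarrow> Y p = v \<longrightarrow> Z p = w \<longrightarrow> curvature_field OG frobenius_metric X Y Z p = z"
    then have "curvature_field OG frobenius_metric X Y Z p = z" using XYZ by blast
    then show "z = p ** ((-1/4) *\<^sub>R commutator (commutator (transpose p ** u) (transpose p ** v)) (transpose p ** w))"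
      using XYZ by (simp add: curvature_field_orthogonal_group[OF _ _ _ p] body_def)
  qed (simp add: curvature_field_orthogonal_group[OF _ _ _ p] body_def)
qed

text \<open>Skew-adjointness of the commutator with c moves c to the other factor: -1/4 <[[a,b],c],
  a> = 1/4 <[a,b],[a,c]>.\<close>

lemma inner_riemann_curvature:
  assumes p: "p \<in> OG" and u: "u \<in> tangent_space OG p" and v: "v \<in> tangent_space OG p" and w: "w \<in> tangent_space OG p"
  shows "frobenius_metric p (riemann_curvature OG frobenius_metric p u v w) u =
    1/4 * (commutator (transpose p ** u) (transpose p ** v) \<bullet> commutator (transpose p ** u) (transpose p ** w))"
proof -
  define a where "a = transpose p ** u"
  define b where "b = transpose p ** v"
  define c where "c = transpose p ** w"
  have c: "skew_symmetric c" using w by (simp add: c_def tangent_space_orthogonal_group[OF p])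
  have u': "u = p ** a" by (simp add: a_def orthogonal_group_cancel[OF p])
  have "frobenius_metric p (riemann_curvature OG frobenius_metric p u v w) u =
      ((-1/4) *\<^sub>R commutator (commutator a b) c) \<bullet> a"
    unfolding riemann_curvature_orthogonal_group[OF assms] frobenius_metric_inner a_def[symmetric] b_def[symmetric] c_def[symmetric]
    by (subst u') (rule inner_orthogonal_group[OF p])
  also have "\<dots> = 1/4 * (commutator c (commutator a b) \<bullet> a)"
    unfolding commutator_swap[of "commutator a b" c] by simp
  also have "\<dots> = 1/4 * (commutator a b \<bullet> commutator a c)"
    unfolding inner_commutator[OF c] commutator_swap[of c a] by simp
  finally show ?thesis by (simp add: a_def b_def c_def)
qed

text \<open>For equal last arguments the numerator is a quarter of a squared norm; the denominator
  is nonnegative by Cauchy-Schwarz.\<close>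

lemma nonneg_sectional_curvature_orthogonal_group:
  "nonneg_sectional_curvature (OG :: (real^'n^'n) set) frobenius_metric"
  unfolding nonneg_sectional_curvature_def sectional_curvature_def
proof (intro ballI impI divide_nonneg_nonneg)
  fix p u v :: "real^'n^'n"
  assume "p \<in> OG" "u \<in> tangent_space OG p" "v \<in> tangent_space OG p"
  then show "0 \<le> frobenius_metric p (riemann_curvature OG frobenius_metric p u v v) u"
    by (simp add: inner_riemann_curvature)
  show "0 \<le> frobenius_metric p u u * frobenius_metric p v v - (frobenius_metric p u v)\<^sup>2"
    by (simp add: frobenius_metric_inner Cauchy_Schwarz_ineq)
qed

section \<open>Traces over an orthonormal basis of a tangent space\<close>

lemma inner_skew_part: "skew_symmetric A \<Longrightarrow> skew_part W \<bullet> A = W \<bullet> A"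
  using inner_transpose[of "W" "A"]
  by (simp add: skew_part_def skew_symmetric_def inner_diff_left)

lemma is_orthonormal_basis_tangent:
  "is_orthonormal_basis M g p B \<Longrightarrow> e \<in> B \<Longrightarrow> e \<in> tangent_space M p"
  unfolding is_orthonormal_basis_def using span_base by blast

text \<open>The completeness relation: the bodies of the basis are orthonormal in the skew matrices,
  so expanding an arbitrary \<open>W\<close> in them yields its orthogonal projection.\<close>

lemma is_orthonormal_basis_expand:
  fixes p :: "real^'n^'n"
  assumes p: "p \<in> OG" and B: "is_orthonormal_basis OG frobenius_metric p B"
  shows "(\<Sum>e\<in>B. (W \<bullet> (transpose p ** e)) *\<^sub>R (transpose p ** e)) = skew_part W"
proof -
  have B': "independent B" "span B = tangent_space OG p" "\<And>e e'. e \<in> B \<Longrightarrow> e' \<in> B \<Longrightarrow> e \<bullet> e' = (if e = e' then 1 else 0)"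
    using B by (auto simp: is_orthonormal_basis_def frobenius_metric_inner)
  have skew: "skew_symmetric (transpose p ** e)" if "e \<in> B" for e
    using is_orthonormal_basis_tangent[OF B that] tangent_space_orthogonal_group[OF p] by blast
  define v where "v = p ** skew_part W"
  have inner: "v \<bullet> e = W \<bullet> (transpose p ** e)" if "e \<in> B" for e
    unfolding v_def inner_matrix_mult_left by (rule inner_skew_part[OF skew[OF that]])
  have "v \<in> span B"
    unfolding v_def B'(2) by (rule tangent_spaceI[OF p skew_symmetric_skew_part])
  then have "(\<Sum>e\<in>B. (v \<bullet> e) *\<^sub>R e) = v"
    using B'(3) independent_imp_finite[OF B'(1)]
    by (intro orthonormal_basis_expand) (auto simp: pairwise_def orthogonal_def norm_eq_sqrt_inner)
  then have "transpose p ** (\<Sum>e\<in>B. (W \<bullet> (transpose p ** e)) *\<^sub>R e) = skew_part W"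
    using inner by (simp add: v_def orthogonal_group_cancel[OF p])
  then show ?thesis
    by (simp add: bounded_bilinear.sum_right[OF bounded_bilinear_matrix_mult]
        bounded_bilinear.scaleR_right[OF bounded_bilinear_matrix_mult])
qed

lemma is_orthonormal_basis_entries:
  fixes p :: "real^'n^'n"
  assumes "p \<in> OG" "is_orthonormal_basis OG frobenius_metric p B"
  shows "(\<Sum>e\<in>B. (transpose p ** e)$i$j * (transpose p ** e)$k$l) =
    1/2 * ((if k = i \<and> l = j then 1 else 0) - (if l = i \<and> k = j then 1 else 0))"
proof -
  \<comment> \<open>Testing completeness on a matrix unit turns it into an identity between
    entries.\<close>
  define W :: "real^'n^'n" where "W = axis i (axis j 1)"
  have W: "W \<bullet> A = A$i$j" for A by (simp add: W_def inner_commute[of "axis i (axis j 1)"] inner_axis)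
  have "(\<Sum>e\<in>B. (transpose p ** e)$i$j * (transpose p ** e)$k$l) =
      (\<Sum>e\<in>B. (W \<bullet> (transpose p ** e)) *\<^sub>R (transpose p ** e))$k$l"
    by (simp add: W)
  also have "\<dots> = skew_part W $k$l" unfolding is_orthonormal_basis_expand[OF assms] ..
  also have "\<dots> = 1/2 * ((if k = i \<and> l = j then 1 else 0) - (if l = i \<and> k = j then 1 else 0))"
  proof -
    have "W$k$l = (if k = i \<and> l = j then 1 else 0)" for k l by (simp add: W_def axis_def)
    moreover have "skew_part W $k$l = 1/2 * (W$k$l - W$l$k)" by (simp add: skew_part_def transpose_def)
    ultimately show ?thesis by presburger
  qed
  finally show ?thesis .
qed

lemma matrix_triple_product_entry:
  "(A ** X ** C) $ i $ l = (\<Sum>k\<in>UNIV. \<Sum>j\<in>UNIV. X$j$k * (A$i$j * C$k$l))"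
  for A X C :: "real^'n^'n"
  unfolding matrix_matrix_mult_def vec_lambda_beta sum_distrib_right
  by (intro sum.cong refl) simp

text \<open>Contraction of the entry identity with \<open>X\<close>: its two Kronecker terms give
  the transpose and the trace. The case \<open>X = mat 1\<close> is the Casimir element.\<close>

lemma sum_orthonormal_basis_conjugate:
  fixes p X :: "real^'n^'n"
  assumes "p \<in> OG" "is_orthonormal_basis OG frobenius_metric p B"
  shows "(\<Sum>e\<in>B. (transpose p ** e) ** X ** (transpose p ** e)) = (1/2) *\<^sub>R (transpose X - trace X *\<^sub>R mat 1)"
proof -
  let ?a = "\<lambda>e. transpose p ** e"
  have "(\<Sum>e\<in>B. ?a e ** X ** ?a e) $ i $ l = ((1/2) *\<^sub>R (transpose X - trace X *\<^sub>R mat 1)) $ i $ l" for i l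
  proof -
    have "(\<Sum>e\<in>B. ?a e ** X ** ?a e) $ i $ l = (\<Sum>e\<in>B. \<Sum>k\<in>UNIV. \<Sum>j\<in>UNIV. X$j$k * (?a e$i$j * ?a e$k$l))"
      by (simp only: sum_component matrix_triple_product_entry)
    also have "\<dots> = (\<Sum>k\<in>UNIV. \<Sum>e\<in>B. \<Sum>j\<in>UNIV. X$j$k * (?a e$i$j * ?a e$k$l))"
      by (rule sum.swap)
    also have "\<dots> = (\<Sum>k\<in>UNIV. \<Sum>j\<in>UNIV. \<Sum>e\<in>B. X$j$k * (?a e$i$j * ?a e$k$l))"
      by (intro sum.cong refl sum.swap)
    also have "\<dots> = (\<Sum>k\<in>UNIV. \<Sum>j\<in>UNIV. X$j$k * (1/2 * ((if k = i \<and> l = j then 1 else 0) - (if l = i \<and> k = j then 1 else 0))))"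
      unfolding sum_distrib_left[symmetric] is_orthonormal_basis_entries[OF assms] ..
    \<comment> \<open>The conditions are nested with \<open>j\<close> outermost, so that the inner
      sum collapses to one term.\<close>
    also have "\<dots> = (\<Sum>k\<in>UNIV. \<Sum>j\<in>UNIV. (if j = l then if k = i then X$j$k / 2 else 0 else 0)
        - (if j = k then if l = i then X$j$k / 2 else 0 else 0))"
      by (intro sum.cong refl) auto
    also have "\<dots> = (\<Sum>k\<in>UNIV. (if k = i then X$l$k / 2 else 0)) - (\<Sum>k\<in>UNIV. if l = i then X$k$k / 2 else 0)"
      by (simp add: sum_subtractf)
    also have "\<dots> = ((1/2) *\<^sub>R (transpose X - trace X *\<^sub>R mat 1)) $ i $ l"
      by (auto simp: transpose_def trace_def mat_def sum_divide_distrib[symmetric] diff_divide_distrib)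
    finally show ?thesis .
  qed
  then show ?thesis by (simp add: vec_eq_iff)
qed

lemma trace_skew_symmetric: "skew_symmetric A \<Longrightarrow> trace A = 0" for A :: "real^'n^'n"
proof -
  assume "skew_symmetric A"
  then have "transpose A $ i $ i = (- A) $ i $ i" for i by (simp only: skew_symmetric_def)
  then show ?thesis by (simp add: trace_def transpose_def)
qed

text \<open>Expanding the commutators leaves one sandwich of c and two squares of basis elements.
  All are instances of the conjugation sum; the factor \<open>mat 1\<close> is inserted to give the
  squares its shape.\<close>

lemma sum_inner_commutator:
  fixes p b c :: "real^'n^'n"
  assumes p: "p \<in> OG" and B: "is_orthonormal_basis OG frobenius_metric p B"
    and b: "skew_symmetric b" and c: "skew_symmetric c"
  shows "(\<Sum>e\<in>B. commutator (transpose p ** e) b \<bullet> commutator (transpose p ** e) c) = (real CARD('n) - 2) * (b \<bullet> c)"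
proof -
  let ?a = "\<lambda>e. transpose p ** e"
  have tp: "transpose b = - b" "transpose c = - c" using b c by (simp_all add: skew_symmetric_def)
  have skew: "transpose (?a e) = - ?a e" if "e \<in> B" for e
  proof -
    have "e \<in> tangent_space OG p" using is_orthonormal_basis_tangent[OF B that] .
    then have "skew_symmetric (?a e)" by (simp only: tangent_space_orthogonal_group[OF p])
    then show ?thesis by (simp only: skew_symmetric_def)
  qed
  have expand: "commutator x b \<bullet> commutator x c =
      2 * (b \<bullet> (x ** c ** x)) - b \<bullet> (x ** mat 1 ** x ** c) - b \<bullet> (c ** (x ** mat 1 ** x))"
    if x: "transpose x = - x" for x
  proof -
    have "(x ** b) \<bullet> W = - (b \<bullet> (x ** W))" "(b ** x) \<bullet> W = - (b \<bullet> (W ** x))" for W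
      using x by (simp_all add: inner_matrix_mult_left[of x] inner_matrix_mult_right[of b x] matrix_algebra)
    then show ?thesis
      by (simp add: commutator_def inner_diff_left inner_diff_right matrix_algebra)
  qed
  have sq: "(\<Sum>e\<in>B. ?a e ** mat 1 ** ?a e) = (1/2 * (1 - real CARD('n))) *\<^sub>R (mat 1 :: real^'n^'n)"
    unfolding sum_orthonormal_basis_conjugate[OF p B]
    by (simp add: trace_I scaleR_diff_left scaleR_diff_right diff_divide_distrib)
  have s1: "(\<Sum>e\<in>B. b \<bullet> (?a e ** c ** ?a e)) = - 1/2 * (b \<bullet> c)"
    unfolding inner_sum_right[symmetric] sum_orthonormal_basis_conjugate[OF p B]
    by (simp add: tp trace_skew_symmetric[OF c])
  have s2: "(\<Sum>e\<in>B. b \<bullet> (?a e ** mat 1 ** ?a e ** c)) = 1/2 * (1 - real CARD('n)) * (b \<bullet> c)"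
    unfolding inner_sum_right[symmetric] bounded_bilinear.sum_left[OF bounded_bilinear_matrix_mult, symmetric] sq
    by (simp add: bounded_bilinear.scaleR_left[OF bounded_bilinear_matrix_mult])
  have s3: "(\<Sum>e\<in>B. b \<bullet> (c ** (?a e ** mat 1 ** ?a e))) = 1/2 * (1 - real CARD('n)) * (b \<bullet> c)"
    unfolding inner_sum_right[symmetric] bounded_bilinear.sum_right[OF bounded_bilinear_matrix_mult, symmetric] sq
    by (simp add: bounded_bilinear.scaleR_right[OF bounded_bilinear_matrix_mult])
  have "(\<Sum>e\<in>B. commutator (?a e) b \<bullet> commutator (?a e) c) =
      (\<Sum>e\<in>B. 2 * (b \<bullet> (?a e ** c ** ?a e)) - b \<bullet> (?a e ** mat 1 ** ?a e ** c) - b \<bullet> (c ** (?a e ** mat 1 ** ?a e)))"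
    by (intro sum.cong refl expand skew)
  \<comment> \<open>The sandwich of the traceless skew c contributes -1, and each of the two squares
    contributes (n - 1)/2.\<close>
  also have "\<dots> = 2 * (- 1/2 * (b \<bullet> c)) - 1/2 * (1 - real CARD('n)) * (b \<bullet> c) - 1/2 * (1 - real CARD('n)) * (b \<bullet> c)"
    unfolding sum_subtractf sum_distrib_left[symmetric] s1 s2 s3 ..
  also have "\<dots> = (real CARD('n) - 2) * (b \<bullet> c)" by (simp add: field_simps)
  finally show ?thesis .
qed

text \<open>Counting by unit norms: the sum of |a|^2 is minus the trace of the sum of a a, which the
  conjugation sum evaluates for \<open>X = mat 1\<close>.\<close>

lemma card_is_orthonormal_basis:
  fixes p :: "real^'n^'n"
  assumes p: "p \<in> OG" and B: "is_orthonormal_basis OG frobenius_metric p B"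
  shows "real (card B) = real CARD('n) * (real CARD('n) - 1) / 2"
proof -
  let ?a = "\<lambda>e. transpose p ** e"
  have one: "?a e \<bullet> ?a e = 1" if "e \<in> B" for e
    using B that inner_orthogonal_group[OF orthogonal_group_transpose[OF p], of e e]
    by (simp add: is_orthonormal_basis_def frobenius_metric_inner)
  have skew: "transpose (?a e) = - ?a e" if "e \<in> B" for e
  proof -
    have "e \<in> tangent_space OG p" using is_orthonormal_basis_tangent[OF B that] .
    then have "skew_symmetric (?a e)" by (simp only: tangent_space_orthogonal_group[OF p])
    then show ?thesis by (simp only: skew_symmetric_def)
  qed
  have "real (card B) = (\<Sum>e\<in>B. ?a e \<bullet> ?a e)" by (simp add: one)
  also have "\<dots> = (\<Sum>e\<in>B. - (mat 1 \<bullet> (?a e ** mat 1 ** ?a e)))"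
  proof (rule sum.cong[OF refl])
    fix e assume "e \<in> B"
    have "?a e \<bullet> ?a e = mat 1 \<bullet> (transpose (?a e) ** ?a e)"
      using inner_matrix_mult_left[of "?a e" "mat 1" "?a e"] by simp
    then show "?a e \<bullet> ?a e = - (mat 1 \<bullet> (?a e ** mat 1 ** ?a e))"
      unfolding skew[OF \<open>e \<in> B\<close>] by (simp add: bounded_bilinear.minus_left[OF bounded_bilinear_matrix_mult])
  qed
  also have "\<dots> = - (mat 1 \<bullet> ((1/2) *\<^sub>R (mat 1 - real CARD('n) *\<^sub>R (mat 1 :: real^'n^'n))))"
    unfolding sum_negf inner_sum_right[symmetric] sum_orthonormal_basis_conjugate[OF p B] by (simp add: trace_I)
  also have "(mat 1 :: real^'n^'n) \<bullet> mat 1 = real CARD('n)"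
    using frobenius_metric_inner[of "mat 1" "mat 1" "mat 1 :: real^'n^'n"] by (simp add: frobenius_metric_def trace_I)
  then have "- ((mat 1 :: real^'n^'n) \<bullet> ((1/2) *\<^sub>R (mat 1 - real CARD('n) *\<^sub>R mat 1))) = real CARD('n) * (real CARD('n) - 1) / 2"
    by (simp add: inner_diff_right algebra_simps)
  finally show ?thesis .
qed

text \<open>Existence, without which the \<open>SOME\<close> in \<open>orthonormal_basis\<close>
  would say nothing.\<close>

lemma is_orthonormal_basis_orthonormal_basis:
  fixes p :: "real^'n^'n"
  assumes p: "p \<in> OG"
  shows "is_orthonormal_basis OG frobenius_metric p (orthonormal_basis OG frobenius_metric p)"
proof -
  have "subspace (tangent_space OG p)"
    unfolding subspace_def
    by (auto simp: tangent_space_orthogonal_group[OF p] matrix_algebra intro!: skew_symmetric_intros)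
      (simp add: skew_symmetric_def transpose_def vec_eq_iff)
  then obtain B where B: "B \<subseteq> tangent_space OG p" "pairwise orthogonal B"
    "\<And>x. x \<in> B \<Longrightarrow> norm x = 1" "independent B" "span B = tangent_space OG p"
    using orthonormal_basis_subspace by metis
  have "e \<bullet> e' = (if e = e' then 1 else 0)" if "e \<in> B" "e' \<in> B" for e e'
    using B(2,3) that by (auto simp: pairwise_def orthogonal_def norm_eq_1)
  then have "is_orthonormal_basis OG frobenius_metric p B"
    using B by (simp add: is_orthonormal_basis_def frobenius_metric_inner)
  then show ?thesis unfolding orthonormal_basis_def by (rule someI)
qed

lemma ricci_orthogonal_group:
  fixes p :: "real^'n^'n"
  assumes p: "p \<in> OG" and v: "v \<in> tangent_space OG p" and w: "w \<in> tangent_space OG p"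
  shows "ricci OG frobenius_metric p v w = (real CARD('n) - 2) / 4 * frobenius_metric p v w"
proof -
  let ?B = "orthonormal_basis OG frobenius_metric p"
  note B = is_orthonormal_basis_orthonormal_basis[OF p]
  have tan: "e \<in> tangent_space OG p" if "e \<in> ?B" for e
    using is_orthonormal_basis_tangent[OF B that] .
  have skew: "skew_symmetric (transpose p ** v)" "skew_symmetric (transpose p ** w)"
    using v w by (simp_all add: tangent_space_orthogonal_group[OF p])
  have "ricci OG frobenius_metric p v w = (\<Sum>e\<in>?B. 1/4 *
      (commutator (transpose p ** e) (transpose p ** v) \<bullet> commutator (transpose p ** e) (transpose p ** w)))"
    unfolding ricci_def by (intro sum.cong refl inner_riemann_curvature p v w tan)
  also have "\<dots> = 1/4 * ((real CARD('n) - 2) * ((transpose p ** v) \<bullet> (transpose p ** w)))"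
    unfolding sum_distrib_left[symmetric] sum_inner_commutator[OF p B skew] ..
  also have "(transpose p ** v) \<bullet> (transpose p ** w) = v \<bullet> w"
    by (rule inner_orthogonal_group[OF orthogonal_group_transpose[OF p]])
  finally show ?thesis by (simp add: frobenius_metric_inner[of p v w])
qed

lemma scalar_curvature_orthogonal_group:
  fixes p :: "real^'n^'n"
  assumes p: "p \<in> OG"
  shows "scalar_curvature OG frobenius_metric p =
    (real CARD('n) - 2) * (real CARD('n) - 1) * real CARD('n) / 8"
proof -
  let ?B = "orthonormal_basis OG frobenius_metric p"
  note B = is_orthonormal_basis_orthonormal_basis[OF p]
  have "ricci OG frobenius_metric p e e = (real CARD('n) - 2) / 4" if "e \<in> ?B" for e
  proof -
    have "e \<in> tangent_space OG p" using is_orthonormal_basis_tangent[OF B that] .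
    moreover have "frobenius_metric p e e = 1" using B that by (simp add: is_orthonormal_basis_def)
    ultimately show ?thesis using ricci_orthogonal_group[OF p] by simp
  qed
  then have "scalar_curvature OG frobenius_metric p = (\<Sum>e\<in>?B. (real CARD('n) - 2) / 4)"
    unfolding scalar_curvature_def by (intro sum.cong refl)
  then have "scalar_curvature OG frobenius_metric p = real (card ?B) * ((real CARD('n) - 2) / 4)"
    by simp
  then show ?thesis unfolding card_is_orthonormal_basis[OF p B] by (simp add: field_simps)
qed

section \<open>The Riemannian structure and its point symmetries\<close>

lemma riemannian_manifold_orthogonal_group:
  "riemannian_manifold (OG :: (real^'n^'n) set) frobenius_metric"
  unfolding riemannian_manifold_def
proof (intro conjI ballI allI impI)
  show "smooth_map_on OG (\<lambda>p. frobenius_metric p (X p) (Y p))"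
    if "X \<in> vector_fields OG" "Y \<in> vector_fields OG" for X Y :: "real^'n^'n \<Rightarrow> real^'n^'n"
    unfolding frobenius_metric_inner
    by (rule smooth_map_on_bilinear[OF bounded_bilinear_inner vector_fieldsD(1)[OF that(1)] vector_fieldsD(1)[OF that(2)]])
qed (use embedded_submanifold_orthogonal_group in
    \<open>auto simp: frobenius_metric_inner inner_add_left inner_add_right inner_commute\<close>)

text \<open>The map \<open>s\<close> reverses geodesics through \<open>p\<close>, sending p exp(tA)
  to p exp(-tA). Being linear on all matrices, it is smooth and acts on tangent vectors as
  itself.\<close>

lemma globally_symmetric_orthogonal_group:
  "globally_symmetric (OG :: (real^'n^'n) set) frobenius_metric"
  unfolding globally_symmetric_def
proof (intro conjI ballI riemannian_manifold_orthogonal_group)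
  fix p :: "real^'n^'n" assume p: "p \<in> OG"
  define s where "s x = p ** transpose x ** p" for x
  have lin: "bounded_linear s"
    unfolding s_def[abs_def]
    by (intro bounded_linear_compose[OF bounded_bilinear.bounded_linear_left[OF bounded_bilinear_matrix_mult]]
        bounded_linear_compose[OF bounded_bilinear.bounded_linear_right[OF bounded_bilinear_matrix_mult]]
        bounded_linear_transpose)
  have mem: "s x \<in> OG" if "x \<in> OG" for x
    unfolding s_def by (intro orthogonal_group_mult orthogonal_group_transpose p that)
  have inv: "s (s x) = x" for x
  proof -
    have "s (s x) = (p ** transpose p) ** x ** (transpose p ** p)"
      by (simp add: s_def transpose_algebra matrix_mul_assoc)
    then show ?thesis by (simp add: orthogonal_groupD[OF p])
  qed
  have sp: "s p = p" by (simp add: s_def orthogonal_groupD[OF p])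
  have bij: "bij_betw s OG OG"
    by (rule bij_betw_byWitness[where f' = s]) (use inv mem in auto)
  have smooth: "smooth_map_on OG s"
    by (rule smooth_map_on_bounded_linear[OF lin smooth_map_on_id])
  have "inv_into OG s x = s x" if "x \<in> OG" for x
    using inv_into_f_eq[OF bij_betw_imp_inj_on[OF bij] mem[OF that] inv] .
  then have "smooth_map_on OG (inv_into OG s)"
    using smooth_map_on_cong[OF smooth] by metis
  moreover have "frobenius_metric (s q) (differential OG s q u) (differential OG s q v) = frobenius_metric q u v"
    if "q \<in> OG" "u \<in> tangent_space OG q" "v \<in> tangent_space OG q" for q u v
  proof -
    have d: "differential OG s q w = s w" if "w \<in> tangent_space OG q" for w
      using differential_bounded_linear[OF lin smooth_map_on_id \<open>q \<in> OG\<close> that] differential_ident[OF that] by simp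
    have "s u \<bullet> s v = (p ** (transpose u ** p)) \<bullet> (p ** (transpose v ** p))"
      by (simp add: s_def matrix_mul_assoc)
    also have "\<dots> = (transpose u ** p) \<bullet> (transpose v ** p)" by (rule inner_orthogonal_group[OF p])
    also have "\<dots> = u \<bullet> v"
      by (simp add: inner_matrix_mult_right[of "transpose u"] orthogonal_group_cancel[OF p] inner_transpose)
    finally show ?thesis using d that by (simp add: frobenius_metric_inner)
  qed
  ultimately have iso: "riemannian_isometry OG frobenius_metric s"
    using bij smooth by (simp add: riemannian_isometry_def)
  define U where "U = {x. det (mat 1 + transpose p ** x) \<noteq> 0}"
  have U: "open U" unfolding U_def by (rule open_det_nonzero[OF smooth_on_translate_matrix[OF open_UNIV]])
  have pU: "p \<in> U" using det_two_nonzero by (simp add: U_def orthogonal_groupD[OF p])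
  \<comment> \<open>A fixed point gives a symmetric orthogonal y = p^T x, so (1 + y)(y - 1) = 0. On
    the chart domain 1 + y is invertible, hence y = 1.\<close>
  have "x = p" if x: "x \<in> OG \<inter> U" "s x = x" for x
  proof -
    define y where "y = transpose p ** x"
    have "transpose y = transpose p ** s x"
      by (simp add: y_def s_def transpose_algebra matrix_mul_assoc orthogonal_groupD[OF p])
    then have sym: "transpose y = y" using x by (simp add: y_def)
    have "y \<in> OG" unfolding y_def using x by (intro orthogonal_group_mult orthogonal_group_transpose p) auto
    then have "y ** y = mat 1" using orthogonal_groupD(1) sym by metis
    then have zero: "(mat 1 + y) ** (y - mat 1) = 0" by (simp add: matrix_algebra)
    have "invertible (mat 1 + y)" using x by (simp add: U_def y_def invertible_det_nz)
    then have "y - mat 1 = matrix_inv (mat 1 + y) ** ((mat 1 + y) ** (y - mat 1))"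
      by (simp only: matrix_mul_assoc invertible_matrix_inv matrix_mul_lid)
    then have "y = mat 1" unfolding zero by simp
    then have "p ** (transpose p ** x) = p" by (simp add: y_def)
    then show ?thesis by (simp only: orthogonal_group_cancel[OF p])
  qed
  then show "\<exists>s. riemannian_isometry OG frobenius_metric s \<and> (\<forall>x\<in>OG. s (s x) = x) \<and> s p = p \<and>
      (\<exists>U. open U \<and> p \<in> U \<and> (\<forall>x\<in>OG \<inter> U. s x = x \<longrightarrow> x = p))"
    using iso inv sp U pU by blast
qed

theorem proposition4p3:
  "let M = (orthogonal_group :: (real^'n^'n) set);
       g = (frobenius_metric :: real^'n^'n \<Rightarrow> real^'n^'n \<Rightarrow> real^'n^'n \<Rightarrow> real);
       n = real CARD('n)
   in
     (globally_symmetric M g \<and> nonneg_sectional_curvature M g) \<and>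
     (\<forall>I \<gamma>. open I \<and> is_interval I \<longrightarrow>
        (geodesic M g I \<gamma> \<longleftrightarrow>
         (\<exists>G\<in>M. \<exists>A. skew_symmetric A \<and> (\<forall>t\<in>I. \<gamma> t = G ** matrix_exp (t *\<^sub>R A))))) \<and>
     (einstein_manifold M g \<and>
      (\<forall>p\<in>M. \<forall>v\<in>tangent_space M p. \<forall>w\<in>tangent_space M p.
         ricci M g p v w = (n - 2) / 4 * g p v w) \<and>
      (\<forall>p\<in>M. scalar_curvature M g p = (n - 2) * (n - 1) * n / 8))"
  unfolding Let_def einstein_manifold_def
  by (intro conjI allI ballI impI exI[of _ "(real CARD('n) - 2) / 4"])
    (simp_all add: globally_symmetric_orthogonal_group nonneg_sectional_curvature_orthogonal_group
      geodesic_orthogonal_group_iff riemannian_manifold_orthogonal_group ricci_orthogonal_group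
      scalar_curvature_orthogonal_group)

end
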